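(* Let $d\in\{2,3\}$, $r_2=3$, $r_3=4$ and $T>0$. Let $u\in C([0,T];\dot Z_{r_d,r_d}(\mathbb{R}^d))$ be a solution of the initial value problem $$\partial_t u-\mathcal{R}_1\Delta u+u\,\partial_{x_1}u=0,\qquad u(x,0)=u_0(x),\qquad x\in\mathbb{R}^d .$$ If there exist $t_1,t_2\in[0,T]$, $t_1\ne t_2$, such that $$u(\cdot,t_j)\in Z_{d/2+3,\,d/2+3}(\mathbb{R}^d),\qquad j=1,2,$$ and $$\int_{\mathbb{R}^d} x_1u(x,t_1)\,dx=0\qquad\text{or}\qquad \int_{\mathbb{R}^d} x_1u(x,t_2)\,dx=0,$$ then $u\equiv 0$.
   Context: Functions $u=u(x,t)$ are real-valued. $\mathcal{R}_1=-\partial_{x_1}(-\Delta)^{-1/2}$ is the Riesz transform, the Fourier multiplier operator with symbol $-i\xi_1/|\xi|$, where $\widehat f(\xi)=\int_{\mathbb{R}^d}e^{-ix\cdot\xi}f(x)\,dx$. $$Z_{s,r}(\mathbb{R}^d)=H^s(\mathbb{R}^d)\cap L^2(|x|^{2r}dx),\qquad \dot Z_{s,r}(\mathbb{R}^d)=\{f\in Z_{s,r}(\mathbb{R}^d):\ \widehat f(0)=0\},$$ with norm $\|f\|_{H^s}+\||x|^rf\|_{L^2}$. Solutions are understood in the sense of Duhamel's formula $u(t)=e^{t\mathcal{R}_1\Delta}u_0-\int_0^te^{(t-\tau)\mathcal{R}_1\Delta}u(\tau)\partial_{x_1}u(\tau)\,d\tau$, where $e^{t\mathcal{R}_1\Delta}$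 has Fourier symbol $e^{it\xi_1|\xi|}$. *)

theory Defs
  imports "HOL-Analysis.Analysis"
begin

text \<open>Elements of $L^2$ and of the spaces below are represented by Borel functions;
  two representatives of the same element agree almost everywhere.\<close>

definition L2_space :: "('a::euclidean_space \<Rightarrow> 'b::real_normed_vector) set" where
  "L2_space = {f \<in> borel_measurable lborel. integrable lborel (\<lambda>x. (norm (f x))\<^sup>2)}"

definition L2_norm :: "('a::euclidean_space \<Rightarrow> 'b::real_normed_vector) \<Rightarrow> real" where
  "L2_norm f = sqrt (LINT x|lborel. (norm (f x))\<^sup>2)"

definition fourier_L1 :: "('a::euclidean_space \<Rightarrow> complex) \<Rightarrow> 'a \<Rightarrow> complex" where
  "fourier_L1 f \<xi> = (LINT x|lborel. exp (- (\<i> * complex_of_real (x \<bullet> \<xi>))) * f x)"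

text \<open>The Fourier transform on $L^2$ is the $L^2$ limit of the transforms of the truncations
  to balls (these are integrable); it is determined up to a null set.\<close>

definition has_fourier_L2 ::
    "('a::euclidean_space \<Rightarrow> complex) \<Rightarrow> ('a \<Rightarrow> complex) \<Rightarrow> bool" where
  "has_fourier_L2 f g \<longleftrightarrow> f \<in> L2_space \<and> g \<in> L2_space \<and>
     ((\<lambda>R. L2_norm (\<lambda>\<xi>. fourier_L1 (\<lambda>x. indicator (cball 0 R) x *\<^sub>R f x) \<xi> - g \<xi>)) \<longlongrightarrow> 0) at_top"

definition fourier_L2 :: "('a::euclidean_space \<Rightarrow> complex) \<Rightarrow> 'a \<Rightarrow> complex" where
  "fourier_L2 f = (SOME g. has_fourier_L2 f g)"

text \<open>For \<open>f\<close> in $L^2$ such that \<open>m\<close> times the transform of \<open>f\<close> is in $L^2$, a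
  representative of the function with that transform.\<close>

definition fourier_multiplier ::
    "('a::euclidean_space \<Rightarrow> complex) \<Rightarrow> ('a \<Rightarrow> complex) \<Rightarrow> 'a \<Rightarrow> complex" where
  "fourier_multiplier m f = (SOME g. has_fourier_L2 g (\<lambda>\<xi>. m \<xi> * fourier_L2 f \<xi>))"

text \<open>Sobolev spaces of order \<open>s \<ge> 0\<close>, as subspaces of $L^2$.\<close>

definition sobolev_weighted ::
    "real \<Rightarrow> ('a::euclidean_space \<Rightarrow> complex) \<Rightarrow> 'a \<Rightarrow> complex" where
  "sobolev_weighted s f \<xi> = (1 + (norm \<xi>)\<^sup>2) powr (s / 2) *\<^sub>R fourier_L2 f \<xi>"

definition sobolev_space :: "real \<Rightarrow> ('a::euclidean_space \<Rightarrow> complex) set" where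
  "sobolev_space s = {f \<in> L2_space. sobolev_weighted s f \<in> L2_space}"

definition sobolev_norm :: "real \<Rightarrow> ('a::euclidean_space \<Rightarrow> complex) \<Rightarrow> real" where
  "sobolev_norm s f = L2_norm (sobolev_weighted s f)"

abbreviation cplx :: "('a \<Rightarrow> real) \<Rightarrow> 'a \<Rightarrow> complex" where
  "cplx f \<equiv> \<lambda>x. complex_of_real (f x)"

definition Z_space :: "real \<Rightarrow> real \<Rightarrow> ('a::euclidean_space \<Rightarrow> real) set" where
  "Z_space s r = {f. cplx f \<in> sobolev_space s \<and> (\<lambda>x. norm x powr r * f x) \<in> L2_space}"

definition Z_norm :: "real \<Rightarrow> real \<Rightarrow> ('a::euclidean_space \<Rightarrow> real) \<Rightarrow> real" where
  "Z_norm s r f = sobolev_norm s (cplx f) + L2_norm (\<lambda>x. norm x powr r * f x)"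

text \<open>The value of the transform at the origin is meaningful for \<open>2 * r > DIM('a)\<close>, when
  elements of \<open>Z_space s r\<close> are integrable; the dotted space is used only in this case.\<close>

definition Zdot_space :: "real \<Rightarrow> real \<Rightarrow> ('a::euclidean_space \<Rightarrow> real) set" where
  "Zdot_space s r = {f \<in> Z_space s r. fourier_L1 (cplx f) 0 = 0}"

definition C_Zdot :: "real \<Rightarrow> real \<Rightarrow> real \<Rightarrow> (real \<Rightarrow> 'a::euclidean_space \<Rightarrow> real) set" where
  "C_Zdot T s r = {u. \<forall>t\<in>{0..T}. u t \<in> Zdot_space s r \<and>
     ((\<lambda>t'. Z_norm s r (\<lambda>x. u t' x - u t x)) \<longlongrightarrow> 0) (at t within {0..T})}"

text \<open>The integral over $[a,b]$ of an $L^2$-valued function, as an element of $L^2$: this is the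
  definition of \<open>has_integral\<close> with the norm of $L^2$ (whose elements do not form a type here).
  For integrands continuous into $L^2$ it is the usual Riemann or Bochner integral.\<close>

definition has_L2_integral ::
    "(real \<Rightarrow> 'a::euclidean_space \<Rightarrow> 'b::real_normed_vector) \<Rightarrow> ('a \<Rightarrow> 'b) \<Rightarrow> real \<Rightarrow> real \<Rightarrow> bool" where
  "has_L2_integral F w a b \<longleftrightarrow> (\<forall>\<tau>\<in>{a..b}. F \<tau> \<in> L2_space) \<and> w \<in> L2_space \<and>
     (\<forall>e>0. \<exists>\<gamma>. gauge \<gamma> \<and>
        (\<forall>\<D>. \<D> tagged_division_of {a..b} \<and> \<gamma> fine \<D> \<longrightarrow>
           L2_norm (\<lambda>x. (\<Sum>(\<tau>, K)\<in>\<D>. measure lborel K *\<^sub>R F \<tau> x) - w x) < e))"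

text \<open>The index \<open>1\<close> denotes the first coordinate. Only the existence of a distinguished
  index is used, so the index type ranges over \<open>2\<close> and \<open>3\<close> among others.\<close>

definition dispersive_group ::
    "real \<Rightarrow> (real ^ 'n::{finite,one} \<Rightarrow> complex) \<Rightarrow> real ^ 'n::{finite,one} \<Rightarrow> complex" where
  "dispersive_group t = fourier_multiplier (\<lambda>\<xi>. exp (\<i> * complex_of_real (t * \<xi> $ 1 * norm \<xi>)))"

definition partial_1 ::
    "(real ^ 'n::{finite,one} \<Rightarrow> complex) \<Rightarrow> real ^ 'n::{finite,one} \<Rightarrow> complex" where
  "partial_1 = fourier_multiplier (\<lambda>\<xi>. \<i> * complex_of_real (\<xi> $ 1))"

text \<open>Duhamel's formula on $[0,T]$ with initial datum \<open>u0\<close>, each equality holding almost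
  everywhere in \<open>x\<close>.\<close>

definition is_duhamel_solution ::
    "real \<Rightarrow> (real ^ 'n::{finite,one} \<Rightarrow> real) \<Rightarrow> (real \<Rightarrow> real ^ 'n::{finite,one} \<Rightarrow> real) \<Rightarrow> bool" where
  "is_duhamel_solution T u0 u \<longleftrightarrow> u0 \<in> L2_space \<and> (AE x in lborel. u 0 x = u0 x) \<and>
     (\<forall>t\<in>{0..T}. \<exists>w.
        has_L2_integral
          (\<lambda>\<tau>. dispersive_group (t - \<tau>) (\<lambda>x. cplx (u \<tau>) x * partial_1 (cplx (u \<tau>)) x)) w 0 t \<and>
        (AE x in lborel. cplx (u t) x = dispersive_group t (cplx u0) x - w x))"

end

theory Submission
  imports Defs "HOL-Probability.Characteristic_Functions" "HOL-Probability.Sinc_Integral"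
begin

text \<open>The transform of \<open>u(t)\<close> satisfies, at every frequency \<open>\<xi>\<close>, an ordinary differential equation in
time with the symbol \<open>\<i> \<xi>\<^sub>1 |\<xi>|\<close>. Spatial decay of \<open>u(t)\<close> is regularity of its transform, and the
symbol is not smooth at the origin. The difference \<open>f = u(t2) - u(t1)\<close> has the decay
\<open>|x|\<^bsup>d/2+3\<^esup> f \<in> L\<^sup>2\<close>, which just fails to put three derivatives of its transform into the continuous
functions, but forbids a term that is homogeneous of degree three and not a polynomial. Expanding
Duhamel's formula between \<open>t1\<close> and \<open>t2\<close> at \<open>\<xi> = l e\<^sub>1\<close>, \<open>l > 0\<close>, where the symbol is \<open>\<i> l\<^sup>2\<close>, the
    real part
of the transform of \<open>f\<close> is a multiple of \<open>l\<^sup>2\<close> plus a multiple of \<open>l\<^sup>3\<close>, up to smaller terms. As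
    this real part is
even in \<open>l\<close>, the second term is a multiple of \<open>|l|\<^sup>3\<close> and has to vanish. Its coefficient is, up to the
factor \<open>t2 - t1\<close>, the sum of two contributions: the factor \<open>\<i> l\<^sup>2 (t2
    - t1)\<close> from the group times the linear term
\<open>-\<i> l \<integral> x\<^sub>1 u(t1)\<close> of the transform at \<open>t1\<close> (there is no constant term because \<open>u(t1)\<close> has mean
zero), and the factor \<open>\<i> l\<^sup>2 (t2 - \<tau>)\<close> times the value \<open>\<i> l/2 \<parallel>u(\<tau>)\<parallel>\<^sup>2\<close> of the transform of \<open>u \<partial>\<^sub>1 u
    = \<partial>\<^sub>1(u\<^sup>2)/2\<close>. This
gives \<open>third_order_obstruction\<close>: with \<open>\<tau> = t1 + \<theta> (t2 - t1)\<close>,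
  \<open>\<integral> x\<^sub>1 u(t1) dx + (t2 - t1)/2 * \<integral>\<^sub>0\<^sup>1 (1 - \<theta>) \<parallel>u(\<tau>)\<parallel>\<^sup>2 d\<theta> = 0\<close>.
If the first moment vanishes, then so does \<open>u\<close> between the two times; the formula is valid for either
order of \<open>t1\<close> and \<open>t2\<close>, so that the two alternatives of the hypothesis are treated alike. A solution
that vanishes at one time vanishes always (\<open>zero_everywhere\<close>), by a Gronwall argument in \<open>L\<^sup>2\<close>.

To make \<open>|l|\<^sup>3\<close> visible, we apply the sixth central difference with step \<open>l\<close>, taken at the origin.
    It is the
integral of \<open>f\<close> against a multiple of \<open>sin\<^sup>6(l x\<^sub>1/2)\<close>, and the critical decay makes it \<open>o(l\<^sup>3)\<close>
(\<open>weighted_low_frequency\<close>); on the other side it annihilates the polynomial \<open>l\<^sup>2\<close> but not \<open>|l|\<^sup>3\<close>. A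
difference of order six rather than four makes all integrals that occur dominated by the single
integrable weight \<open>decay\<close>.

The spaces and the group are defined through representatives and choices, so a substantial part is
Plancherel's theorem (\<open>Plancherel\<close>) and its consequence that a multiplier acts by an absolutely
convergent inversion integral (\<open>fourier_multiplier_eq\<close>) on the functions to which it is applied here:
these and their multiplied transforms are both integrable
    and square integrable. With it, the \<open>L\<^sup>2\<close>-valued integral in
Duhamel's formula becomes an ordinary integral at each frequency (\<open>Duhamel_fourier\<close>).\<close>

section \<open>Square-integrable functions\<close>

text \<open>Integrate Young's inequality \<open>2 t |f g| \<le> t\<^sup>2 f\<^sup>2 + g\<^sup>2\<close> and choose the best \<open>t\<close>.\<close>

lemma Cauchy_Schwarz_integral:
  fixes f g :: "'a \<Rightarrow> real"
  assumes f: "f \<in> borel_measurable M" "integrable M (\<lambda>x. (f x)\<^sup>2)"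
    and g: "g \<in> borel_measurable M" "integrable M (\<lambda>x. (g x)\<^sup>2)"
  shows "integrable M (\<lambda>x. f x * g x)"
    and "(LINT x|M. \<bar>f x * g x\<bar>) \<le> sqrt (LINT x|M. (f x)\<^sup>2) * sqrt (LINT x|M. (g x)\<^sup>2)"
proof -
  note [measurable] = f(1) g(1)
  have young: "2 * (t * \<bar>f x * g x\<bar>) \<le> t\<^sup>2 * (f x)\<^sup>2 + (g x)\<^sup>2" for t x
  proof -
    have "0 \<le> (t * \<bar>f x\<bar> - \<bar>g x\<bar>)\<^sup>2" by simp
    then show ?thesis
      by (simp add: power2_diff power_mult_distrib abs_mult algebra_simps)
  qed
  show int: "integrable M (\<lambda>x. f x * g x)"
    by (rule Bochner_Integration.integrable_bound[where f = "\<lambda>x. (f x)\<^sup>2 + (g x)\<^sup>2"])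
       (use f g young[of 1] in \<open>auto intro!: AE_I2 order_trans[OF _ young[of 1, simplified]]\<close>)
  define a b c where "a = (LINT x|M. (f x)\<^sup>2)" and "b = (LINT x|M. (g x)\<^sup>2)"
    and "c = (LINT x|M. \<bar>f x * g x\<bar>)"
  have ab: "a \<ge> 0" "b \<ge> 0" "c \<ge> 0" by (auto simp: a_def b_def c_def)
  have *: "2 * (t * c) \<le> t\<^sup>2 * a + b" for t
  proof -
    have "(LINT x|M. 2 * (t * \<bar>f x * g x\<bar>)) \<le> (LINT x|M. t\<^sup>2 * (f x)\<^sup>2 + (g x)\<^sup>2)"
      using f g int by (intro integral_mono young) auto
    then show ?thesis using f g int by (simp add: a_def b_def c_def)
  qed
  have "c\<^sup>2 \<le> a * b"
  proof (cases "a = 0")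
    case True
    have "c = 0"
    proof (rule ccontr)
      assume "c \<noteq> 0"
      then show False using *[of "(b + 1) / c"] True ab by simp
    qed
    then show ?thesis using ab by simp
  next
    case False
    then have "2 * (c * c) \<le> c * c + a * b"
      using *[of "c / a"] ab by (simp add: power2_eq_square field_simps)
    then show ?thesis by (simp add: power2_eq_square)
  qed
  then have "c \<le> sqrt (a * b)" by (rule real_le_rsqrt)
  then show "(LINT x|M. \<bar>f x * g x\<bar>) \<le> sqrt (LINT x|M. (f x)\<^sup>2) * sqrt (LINT x|M. (g x)\<^sup>2)"
    by (simp add: a_def b_def c_def real_sqrt_mult)
qed

lemma L2_spaceI:
  "f \<in> borel_measurable lborel \<Longrightarrow> integrable lborel (\<lambda>x. (norm (f x))\<^sup>2) \<Longrightarrow> f \<in> L2_space"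
  by (simp add: L2_space_def)

lemma L2_spaceD:
  assumes "f \<in> L2_space"
  shows "f \<in> borel_measurable lborel" "integrable lborel (\<lambda>x. (norm (f x))\<^sup>2)"
  using assms by (auto simp: L2_space_def)

lemma L2_norm_nonneg [simp]: "0 \<le> L2_norm f"
  by (simp add: L2_norm_def)

lemma L2_norm_sq: "(L2_norm f)\<^sup>2 = (LINT x|lborel. (norm (f x))\<^sup>2)"
  by (simp add: L2_norm_def)

lemma L2_norm_cong_AE:
  assumes "AE x in lborel. norm (f x) = norm (g x)"
    "f \<in> borel_measurable lborel" "g \<in> borel_measurable lborel"
  shows "L2_norm f = L2_norm g"
  unfolding L2_norm_def using assms by (intro arg_cong[where f = sqrt] integral_cong_AE) auto

lemma L2_space_cong_AE:
  fixes f :: "'a::euclidean_space \<Rightarrow> 'b::real_normed_vector"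
  assumes "f \<in> L2_space" "g \<in> borel_measurable lborel" "AE x in lborel. norm (g x) = norm (f x)"
  shows "g \<in> L2_space"
proof (rule L2_spaceI)
  note L2_spaceD[OF assms(1)]
  then show "integrable lborel (\<lambda>x. (norm (g x))\<^sup>2)"
    using assms(2,3) by (subst integrable_cong_AE[where g = "\<lambda>x. (norm (f x))\<^sup>2"]) auto
qed fact

lemma L2_space_bound:
  fixes f :: "'a::euclidean_space \<Rightarrow> 'b::real_normed_vector"
    and g :: "'a::euclidean_space \<Rightarrow> 'c::real_normed_vector"
  assumes "f \<in> L2_space" "g \<in> borel_measurable lborel" "AE x in lborel. norm (g x) \<le> norm (f x)"
  shows "g \<in> L2_space" "L2_norm g \<le> L2_norm f"
proof -
  note f = L2_spaceD[OF assms(1)]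
  have int: "integrable lborel (\<lambda>x. (norm (g x))\<^sup>2)"
    using assms(2,3) by (intro Bochner_Integration.integrable_bound[OF f(2)])
      (auto intro: power_mono elim!: eventually_mono)
  then show "g \<in> L2_space" using assms(2) by (rule L2_spaceI[rotated])
  show "L2_norm g \<le> L2_norm f"
    unfolding L2_norm_def using assms(3)
    by (intro real_sqrt_le_mono integral_mono_AE int f) (auto intro: power_mono elim!: eventually_mono)
qed

lemma
  fixes f :: "'a::euclidean_space \<Rightarrow> 'b::{real_normed_vector,second_countable_topology}"
  assumes "f \<in> L2_space" "g \<in> L2_space"
  shows L2_space_add: "(\<lambda>x. f x + g x) \<in> L2_space"
    and L2_norm_triangle: "L2_norm (\<lambda>x. f x + g x) \<le> L2_norm f + L2_norm g"
proof -
  note f [measurable] = L2_spaceD[OF assms(1)]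
  note g [measurable] = L2_spaceD[OF assms(2)]
  have fg: "integrable lborel (\<lambda>x. norm (f x) * norm (g x))"
    "(LINT x|lborel. \<bar>norm (f x) * norm (g x)\<bar>) \<le> L2_norm f * L2_norm g"
    using Cauchy_Schwarz_integral[of "\<lambda>x. norm (f x)" lborel "\<lambda>x. norm (g x)"] f g
    by (simp_all add: L2_norm_def)
  have le: "(norm (f x + g x))\<^sup>2 \<le> (norm (f x))\<^sup>2 + (norm (g x))\<^sup>2 + 2 * (norm (f x) * norm (g x))" for x
    using power_mono[OF norm_triangle_ineq[of "f x" "g x"], of 2]
    by (simp add: power2_sum algebra_simps)
  have int: "integrable lborel (\<lambda>x. (norm (f x))\<^sup>2 + (norm (g x))\<^sup>2 + 2 * (norm (f x) * norm (g x)))"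
    using f g fg by auto
  have int': "integrable lborel (\<lambda>x. (norm (f x + g x))\<^sup>2)"
    by (rule Bochner_Integration.integrable_bound[OF int]) (auto intro!: AE_I2 le order_trans[OF le])
  then show "(\<lambda>x. f x + g x) \<in> L2_space" by (intro L2_spaceI) auto
  have "(L2_norm (\<lambda>x. f x + g x))\<^sup>2 \<le> (L2_norm f)\<^sup>2 + (L2_norm g)\<^sup>2 + 2 * (L2_norm f * L2_norm g)"
    unfolding L2_norm_sq using integral_mono[OF int' int le] f g fg by simp
  also have "\<dots> = (L2_norm f + L2_norm g)\<^sup>2" by (simp add: power2_sum)
  finally show "L2_norm (\<lambda>x. f x + g x) \<le> L2_norm f + L2_norm g"
    by (rule power2_le_imp_le) simp
qed

lemma
  fixes f :: "'a::euclidean_space \<Rightarrow> 'b::{real_normed_vector,second_countable_topology}"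
  assumes "f \<in> L2_space"
  shows L2_space_scaleR: "(\<lambda>x. c *\<^sub>R f x) \<in> L2_space"
    and L2_norm_scaleR: "L2_norm (\<lambda>x. c *\<^sub>R f x) = \<bar>c\<bar> * L2_norm f"
proof -
  note f [measurable] = L2_spaceD[OF assms(1)]
  show "(\<lambda>x. c *\<^sub>R f x) \<in> L2_space" using f by (intro L2_spaceI) (auto simp: power_mult_distrib)
  show "L2_norm (\<lambda>x. c *\<^sub>R f x) = \<bar>c\<bar> * L2_norm f"
    by (simp add: L2_norm_def power_mult_distrib real_sqrt_mult)
qed

lemma
  fixes f :: "'a::euclidean_space \<Rightarrow> 'b::{real_normed_vector,second_countable_topology}"
  assumes "f \<in> L2_space" "g \<in> L2_space"
  shows L2_space_diff: "(\<lambda>x. f x - g x) \<in> L2_space"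
    and L2_norm_triangle_diff: "L2_norm f \<le> L2_norm g + L2_norm (\<lambda>x. f x - g x)"
proof -
  show *: "(\<lambda>x. f x - g x) \<in> L2_space"
    using L2_space_add[OF assms(1) L2_space_scaleR[OF assms(2), of "-1"]] by simp
  show "L2_norm f \<le> L2_norm g + L2_norm (\<lambda>x. f x - g x)"
    using L2_norm_triangle[OF assms(2) *] by simp
qed

lemma L2_norm_minus_commute: "L2_norm (\<lambda>x. f x - g x) = L2_norm (\<lambda>x. g x - f x)"
  by (simp add: L2_norm_def norm_minus_commute)

lemma L2_norm_eq_0_AE:
  fixes f :: "'a::euclidean_space \<Rightarrow> 'b::{real_normed_vector,second_countable_topology}"
  assumes "f \<in> L2_space" "L2_norm f = 0"
  shows "AE x in lborel. f x = 0"
proof -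
  note f [measurable] = L2_spaceD[OF assms(1)]
  have "(LINT x|lborel. (norm (f x))\<^sup>2) = 0" using assms(2) L2_norm_sq[of f] by simp
  then have "AE x in lborel. (norm (f x))\<^sup>2 = 0"
    using f by (subst (asm) integral_nonneg_eq_0_iff_AE) auto
  then show ?thesis by simp
qed

lemma L2_space_sum:
  fixes f :: "'i \<Rightarrow> 'a::euclidean_space \<Rightarrow> 'b::{real_normed_vector,second_countable_topology}"
  assumes "\<And>i. i \<in> I \<Longrightarrow> f i \<in> L2_space"
  shows "(\<lambda>x. \<Sum>i\<in>I. f i x) \<in> L2_space"
  using assms
proof (induction I rule: infinite_finite_induct)
  case (insert i I)
  then show ?case by (simp add: L2_space_add)
qed (auto simp: L2_space_def)

text \<open>Regularity of Lebesgue measure gives a closed subset and an open superset that differ by a set of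
small measure; an Urysohn function between them is the approximation.\<close>

lemma indicator_approx_continuous:
  fixes A :: "'a::euclidean_space set"
  assumes A: "A \<in> sets lborel" "emeasure lborel A < \<infinity>" and e: "e > 0"
  obtains g :: "'a \<Rightarrow> real" where "continuous_on UNIV g" "\<And>x. 0 \<le> g x" "\<And>x. g x \<le> 1"
    "integrable lborel g" "(LINT x|lborel. \<bar>indicator A x - g x\<bar>) < e"
proof -
  have Al: "A \<in> sets lebesgue" using A by simp
  have e2: "e / 2 > 0" using e by simp
  obtain U where U: "open U" "A \<subseteq> U" "emeasure lebesgue (U - A) < ennreal (e/2)"
    using sets_lebesgue_outer_open[OF Al e2] by metis
  obtain K where K: "closed K" "K \<subseteq> A" "emeasure lebesgue (A - K) < ennreal (e/2)"
    using sets_lebesgue_inner_closed[OF Al e2] by metis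
  have UA: "emeasure lborel (U - A) < ennreal (e/2)" and AK: "emeasure lborel (A - K) < ennreal (e/2)"
    using U K A by (auto simp: emeasure_completion)
  obtain g :: "'a \<Rightarrow> real" where g: "continuous_on UNIV g" "\<And>x. g x \<in> closed_segment 1 0"
      "\<And>x. x \<in> K \<Longrightarrow> g x = 1" "\<And>x. x \<in> -U \<Longrightarrow> g x = 0"
  proof (rule Urysohn[of K "- U" "1::real" 0])
    show "closed (- U)" "K \<inter> - U = {}" using U K by auto
  qed (use K in auto)
  have g01: "0 \<le> g x" "g x \<le> 1" for x using g(2)[of x] by (auto simp: closed_segment_eq_real_ivl)
  have [measurable]: "g \<in> borel_measurable lborel" 
    using borel_measurable_continuous_onI[OF g(1)] by simp
  have sets [measurable]: "U \<in> sets borel" "K \<in> sets borel" "A \<in> sets borel"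
    using U K A by auto
  have emU: "emeasure lborel U < \<infinity>"
  proof -
    have "emeasure lborel U = emeasure lborel (A \<union> (U - A))" using U by (simp add: Un_absorb1)
    also have "\<dots> \<le> emeasure lborel A + emeasure lborel (U - A)" by (rule emeasure_subadditive) measurable
    also have "\<dots> < \<infinity>" using A UA by (auto simp: top.not_eq_extremum[symmetric] ennreal_add_eq_top)
    finally show ?thesis .
  qed
  have "integrable lborel (indicator U :: 'a \<Rightarrow> real)" using emU sets by
      (simp add: integrable_indicator_iff)
  then have gi: "integrable lborel g"
    by (rule Bochner_Integration.integrable_bound) (use g(4) g01 in \<open>auto simp: indicator_def\<close>)
  have UK: "U - K = (U - A) \<union> (A - K)" using U K by auto
  have emUK: "emeasure lborel (U - K) < ennreal e"
  proof -
    have "emeasure lborel (U - K) \<le> emeasure lborel (U - A) + emeasure lborel (A - K)"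
      unfolding UK by (rule emeasure_subadditive) measurable
    also have "\<dots> < ennreal (e/2) + ennreal (e/2)"
      using UA AK by (rule add_strict_mono)
    also have "\<dots> = ennreal e" using e by (simp flip: ennreal_plus)
    finally show ?thesis .
  qed
  then have fin: "emeasure lborel (U - K) < \<infinity>" by (simp add: less_top order.strict_trans)
  have "(LINT x|lborel. \<bar>indicator A x - g x\<bar>) \<le> (LINT x|lborel. indicator (U - K) x)"
  proof (rule integral_mono)
    show "integrable lborel (\<lambda>x. \<bar>indicator A x - g x\<bar>)" using A gi by auto
    show "integrable lborel (indicator (U - K) :: 'a \<Rightarrow> real)" using fin sets by
        (simp add: integrable_indicator_iff)
    show "\<bar>indicator A x - g x\<bar> \<le> indicator (U - K) x" for x
      using g01[of x] g(3,4)[of x] U K by (auto simp: indicator_def)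
  qed
  also have "\<dots> = measure lborel (U - K)" by simp
  also have "\<dots> < e" using emUK e fin by (simp add: emeasure_eq_ennreal_measure ennreal_less_iff)
  finally show ?thesis using that g(1) g01 gi by blast
qed

lemma integrable_approx_continuous:
  fixes f :: "'a::euclidean_space \<Rightarrow> 'b::euclidean_space"
  assumes "integrable lborel f" "e > 0"
  shows "\<exists>g. continuous_on UNIV g \<and> integrable lborel g \<and> (LINT x|lborel. norm (f x - g x)) < e"
  using assms
proof (induction arbitrary: e rule: integrable_induct)
  case (base A c)
  define e' where "e' = e / (norm c + 1)"
  have e': "e' > 0" using base by (simp add: e'_def add_nonneg_pos)
  from base have A: "A \<in> sets lborel" "emeasure lborel A < \<infinity>" by auto
  obtain g :: "'a \<Rightarrow> real" where g: "continuous_on UNIV g" "\<And>x. 0 \<le> g x" "\<And>x. g x \<le> 1"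
    "integrable lborel g" "(LINT x|lborel. \<bar>indicator A x - g x\<bar>) < e'"
    using indicator_approx_continuous[OF A e'] by blast
  have "(LINT x|lborel. norm (indicator A x *\<^sub>R c - g x *\<^sub>R c)) = (LINT x|lborel. \<bar>indicator A x
      - g x\<bar>) * norm c"
    by (simp flip: scaleR_diff_left)
  also have "\<dots> \<le> e' * norm c" using g(5) by (intro mult_right_mono) auto
  also have "\<dots> < e' * (norm c + 1)" using e' by simp
  also have "\<dots> = e" by (simp add: e'_def add_nonneg_eq_0_iff)
  finally show ?case
    using g by (intro exI[of _ "\<lambda>x. g x *\<^sub>R c"]) (auto intro!: continuous_intros)
next
  case (add f1 f2)
  from add.IH(1)[of "e/2"] add.prems obtain g1 where g1: "continuous_on UNIV g1" "integrable lborel g1"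
    "(LINT x|lborel. norm (f1 x - g1 x)) < e/2" by auto
  from add.IH(2)[of "e/2"] add.prems obtain g2 where g2: "continuous_on UNIV g2" "integrable lborel g2"
    "(LINT x|lborel. norm (f2 x - g2 x)) < e/2" by auto
  have "(LINT x|lborel. norm (f1 x + f2 x - (g1 x + g2 x)))
      \<le> (LINT x|lborel. norm (f1 x - g1 x) + norm (f2 x - g2 x))"
    using add.hyps g1 g2 by (intro integral_mono) (auto intro: norm_diff_triangle_ineq)
  also have "\<dots> < e" using add.hyps g1 g2 by simp
  finally show ?case using g1 g2
    by (intro exI[of _ "\<lambda>x. g1 x + g2 x"]) (auto intro!: continuous_intros)
next
  case (lim f s)
  have "(\<lambda>i. LINT x|lborel. norm (s i x - f x)) \<longlonglongrightarrow> (LINT x|lborel. norm (f x - f x))"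
  proof (rule integral_dominated_convergence[where w = "\<lambda>x. 3 * norm (f x)"])
    show "AE x in lborel. (\<lambda>i. norm (s i x - f x)) \<longlonglongrightarrow> norm (f x - f x)"
      using lim by (intro AE_I2 tendsto_intros) auto
    show "AE x in lborel. norm (norm (s i x - f x)) \<le> 3 * norm (f x)" for i
    proof (intro AE_I2)
      fix x
      show "norm (norm (s i x - f x)) \<le> 3 * norm (f x)"
        using lim(3)[of x i] norm_triangle_ineq4[of "s i x" "f x"] by simp
    qed
  qed (use lim in auto)
  then have "(\<lambda>i. LINT x|lborel. norm (s i x - f x)) \<longlonglongrightarrow> 0" by simp
  from order_tendstoD(2)[OF this, of "e/2"] lim.prems obtain i
    where i: "(LINT x|lborel. norm (s i x - f x)) < e/2" by (auto simp: eventually_sequentially)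
  from lim.IH[of "e/2" i] lim.prems obtain g where g: "continuous_on UNIV g" "integrable lborel g"
    "(LINT x|lborel. norm (s i x - g x)) < e/2" by auto
  have "(LINT x|lborel. norm (f x - g x)) \<le> (LINT x|lborel. norm (s i x - f x) + norm (s i x - g x))"
    using lim g
    by (intro integral_mono) (auto, metis norm_minus_commute norm_triangle_ineq diff_add_cancel
        add_diff_eq)
  also have "\<dots> < e" using lim.hyps g i by simp
  finally show ?case using g by blast
qed

text \<open>An approximation in \<open>L\<^sup>1\<close> is made one in \<open>L\<^sup>2\<close> by projecting its values to the ball of radius \<open>M\<close>. The
projection is a contraction that fixes the values of \<open>f\<close>, so the error does not grow; and it is
bounded by \<open>2 M\<close>, so its square is controlled by its first power.\<close>

lemma L2_approx_continuous_of_bounded: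
  fixes f :: "'a::euclidean_space \<Rightarrow> 'b::euclidean_space"
  assumes f: "integrable lborel f" and M: "\<And>x. norm (f x) \<le> M" and e: "e > 0"
  obtains g where "continuous_on UNIV g" "integrable lborel g" "g \<in> L2_space"
    "\<And>x. norm (g x) \<le> M" "L2_norm (\<lambda>x. f x - g x) < e"
proof -
  note [measurable] = borel_measurable_integrable[OF f]
  have M0: "M \<ge> 0" using M[of 0] norm_ge_zero[of "f 0"] by linarith
  define d where "d = e\<^sup>2 / (2 * M + 1)"
  have d: "d > 0" using M0 e by (simp add: d_def)
  obtain h where h: "continuous_on UNIV h" "integrable lborel h" "(LINT x|lborel. norm (f x - h x)) < d"
    using integrable_approx_continuous[OF f d] by blast
  define P where "P = closest_point (cball (0::'b) M)"
  define g where "g x = P (h x)" for x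
  have Pc: "continuous_on UNIV P"
    unfolding P_def using M0 by (intro continuous_on_closest_point) auto
  have P1: "norm (P x - P y) \<le> norm (x - y)" for x y
    using closest_point_lipschitz[of "cball (0::'b) M" x y] M0 by (simp add: P_def dist_norm)
  have P2: "P x = x" if "norm x \<le> M" for x
    unfolding P_def using that by (intro closest_point_self) auto
  have P3: "norm (P x) \<le> M" for x
    using closest_point_in_set[of "cball (0::'b) M" x] M0 by (simp add: P_def)
  have gc: "continuous_on UNIV g"
    unfolding g_def by (rule continuous_on_compose2[OF Pc h(1)]) auto
  have [measurable]: "g \<in> borel_measurable lborel" "h \<in> borel_measurable lborel"
    using borel_measurable_continuous_onI[OF gc] h by auto
  have gM: "norm (g x) \<le> M" for x by (simp add: g_def P3)
  have gh: "norm (g x) \<le> norm (h x)" for x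
    using P1[of "h x" 0] P2[of 0] M0 by (simp add: g_def)
  have gi: "integrable lborel g"
    by (rule Bochner_Integration.integrable_bound[OF h(2)]) (auto simp: gh)
  have fg: "norm (f x - g x) \<le> norm (f x - h x)" for x
    using P1[of "f x" "h x"] P2[OF M[of x]] by (simp add: g_def)
  have fg2: "norm (f x - g x) \<le> 2 * M" for x
    using norm_triangle_ineq4[of "f x" "g x"] gM[of x] M[of x] by linarith
  have sq: "(norm (f x - g x))\<^sup>2 \<le> 2 * M * norm (f x - h x)" for x
    unfolding power2_eq_square using fg[of x] fg2[of x] M0 by (intro mult_mono) auto
  have i2: "integrable lborel (\<lambda>x. (norm (g x))\<^sup>2)"
  proof (rule Bochner_Integration.integrable_bound)
    show "integrable lborel (\<lambda>x. M * norm (h x))" using h by auto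
    show "AE x in lborel. norm ((norm (g x))\<^sup>2) \<le> norm (M * norm (h x))"
      using gM gh M0 by (intro AE_I2) (auto simp: power2_eq_square abs_mult intro!: mult_mono)
  qed auto
  have "(L2_norm (\<lambda>x. f x - g x))\<^sup>2 \<le> (LINT x|lborel. 2 * M * norm (f x - h x))"
    unfolding L2_norm_sq
  proof (rule integral_mono[OF _ _ sq])
    show "integrable lborel (\<lambda>x. 2 * M * norm (f x - h x))" using f h by auto
    then show "integrable lborel (\<lambda>x. (norm (f x - g x))\<^sup>2)"
      by (rule Bochner_Integration.integrable_bound)
         (auto intro!: AE_I2 order_trans[OF sq])
  qed
  also have "\<dots> \<le> 2 * M * d" using h(3) M0 by (auto intro!: mult_left_mono)
  also have "\<dots> < e\<^sup>2" using M0 e by (simp add: d_def field_simps)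
  finally have "L2_norm (\<lambda>x. f x - g x) < e" by (rule power2_less_imp_less) (use e in simp)
  moreover have "g \<in> L2_space" by (rule L2_spaceI[OF _ i2]) measurable
  ultimately show ?thesis using that gc gi gM by blast
qed

lemma L2_approx_continuous:
  fixes f :: "'a::euclidean_space \<Rightarrow> 'b::euclidean_space"
  assumes f: "integrable lborel f" "f \<in> L2_space" and e: "e > 0"
  obtains g where "continuous_on UNIV g" "integrable lborel g" "g \<in> L2_space"
    "bounded (range g)" "L2_norm (\<lambda>x. f x - g x) < e"
proof -
  note f2 [measurable] = L2_spaceD[OF f(2)]
  define t where "t k x = (if norm (f x) \<le> real k then f x else 0)" for k x
  have t_meas [measurable]: "t k \<in> borel_measurable lborel" for k unfolding t_def by measurable
  have ti: "integrable lborel (t k)" for k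
    by (rule Bochner_Integration.integrable_bound[OF f(1)]) (auto simp: t_def)
  have "(\<lambda>k. LINT x|lborel. (norm (f x - t k x))\<^sup>2) \<longlonglongrightarrow> (LINT x|(lborel :: 'a measure). (0::real))"
  proof (rule integral_dominated_convergence[where f = "\<lambda>x. 0" and s = "\<lambda>k x. (norm (f x
      - t k x))\<^sup>2" and w = "\<lambda>x. (norm (f x))\<^sup>2"])
    show "AE x in lborel. (\<lambda>k. (norm (f x - t k x))\<^sup>2) \<longlonglongrightarrow> 0"
    proof (intro AE_I2 tendsto_eventually)
      fix x
      show "eventually (\<lambda>k. (norm (f x - t k x))\<^sup>2 = 0) sequentially"
        using eventually_ge_at_top[of "nat \<lceil>norm (f x)\<rceil>"]
        by eventually_elim (auto simp: t_def nat_le_iff ceiling_le_iff)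
    qed
  qed (use f2 in \<open>auto simp: t_def\<close>)
  then have "eventually (\<lambda>k. (LINT x|lborel. (norm (f x - t k x))\<^sup>2) < (e/2)\<^sup>2) sequentially"
    using e by (intro order_tendstoD) auto
  then obtain k where "(L2_norm (\<lambda>x. f x - t k x))\<^sup>2 < (e/2)\<^sup>2"
    unfolding L2_norm_sq using eventually_happens'[OF sequentially_bot] by blast
  then have k: "L2_norm (\<lambda>x. f x - t k x) < e/2" by (rule power2_less_imp_less) (use e in simp)
  have tk: "norm (t k x) \<le> real k" for x by (simp add: t_def)
  have e2: "e / 2 > 0" using e by simp
  obtain g where g: "continuous_on UNIV g" "integrable lborel g" "g \<in> L2_space"
    "\<And>x. norm (g x) \<le> real k" "L2_norm (\<lambda>x. t k x - g x) < e/2"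
    using L2_approx_continuous_of_bounded[OF ti tk e2] by blast
  have tL: "t k \<in> L2_space"
    by (rule L2_space_bound[OF f(2)]) (auto simp: t_def)
  have "L2_norm (\<lambda>x. f x - g x) \<le> L2_norm (\<lambda>x. f x - t k x) + L2_norm (\<lambda>x. t k x - g x)"
    using L2_norm_triangle[OF L2_space_diff[OF f(2) tL] L2_space_diff[OF tL g(3)]] by simp
  then have "L2_norm (\<lambda>x. f x - g x) < e" using g(5) k by linarith
  moreover have "bounded (range g)" using g(4) by (auto simp: bounded_iff)
  ultimately show ?thesis using that g by blast
qed

section \<open>Integrals over a Euclidean space\<close>

lemma
  fixes \<phi> :: "'a::euclidean_space \<Rightarrow> real \<Rightarrow> 'c::{real_normed_field,banach,second_countable_topology}"
  assumes int: "\<And>b. b \<in> Basis \<Longrightarrow> integrable lborel (\<phi> b)"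
  shows integrable_lborel_prod: "integrable lborel (\<lambda>x::'a. \<Prod>b\<in>Basis. \<phi> b (x \<bullet> b))"
    and integral_lborel_prod:
      "(LINT x|lborel. (\<Prod>b\<in>Basis. \<phi> b ((x::'a) \<bullet> b))) = (\<Prod>b\<in>Basis. LINT x|lborel. \<phi> b x)"
proof -
  interpret P: product_sigma_finite "\<lambda>_::'a. lborel :: real measure" ..
  have [measurable]: "\<phi> b \<in> borel_measurable borel" if "b \<in> Basis" for b
    using borel_measurable_integrable[OF int[OF that]] by simp
  have eq: "(\<Prod>b\<in>Basis. \<phi> b ((\<Sum>j\<in>Basis. f j *\<^sub>R j) \<bullet> b)) = (\<Prod>b\<in>Basis. \<phi> b (f b))" for f :: "'a \<Rightarrow> real"
    by (intro prod.cong) simp_all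
  have meas: "(\<lambda>x::'a. \<Prod>b\<in>Basis. \<phi> b (x \<bullet> b)) \<in> borel_measurable borel" by measurable
  have meas2: "(\<lambda>f. \<Sum>j\<in>Basis. f j *\<^sub>R j) \<in> (\<Pi>\<^sub>M b\<in>(Basis::'a set). lborel) \<rightarrow>\<^sub>M (borel :: 'a measure)"
    by measurable
  show "integrable lborel (\<lambda>x::'a. \<Prod>b\<in>Basis. \<phi> b (x \<bullet> b))"
    unfolding lborel_eq[where 'a = 'a]
    by (subst integrable_distr_eq[OF meas2 meas], unfold eq) (rule P.product_integrable_prod[OF
        finite_Basis int])
  show "(LINT x|lborel. (\<Prod>b\<in>Basis. \<phi> b ((x::'a) \<bullet> b))) = (\<Prod>b\<in>Basis. LINT x|lborel. \<phi> b x)"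
    unfolding lborel_eq[where 'a = 'a]
    by (subst integral_distr[OF meas2 meas], unfold eq) (rule P.product_integral_prod[OF
        finite_Basis int])
qed

lemma
  fixes f :: "'a::euclidean_space \<Rightarrow> 'b::{banach,second_countable_topology}"
  assumes f [measurable]: "f \<in> borel_measurable borel" and c: "c \<noteq> 0"
  shows integral_lborel_affine:
      "(LINT x|lborel. f (t + c *\<^sub>R x)) = (1 / \<bar>c\<bar> ^ DIM('a)) *\<^sub>R (LINT x|lborel. f x)"
    and integrable_lborel_affine_iff:
      "integrable lborel (\<lambda>x. f (t + c *\<^sub>R x)) \<longleftrightarrow> integrable lborel f"
proof -
  have "(LINT x|lborel. f x) = (LINT x|density (distr lborel borel (\<lambda>x. t
      + c *\<^sub>R x)) (\<lambda>_. ennreal (\<bar>c\<bar> ^ DIM('a))). f x)"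
    using lborel_affine[OF c, of t] by (simp add: ennreal_power)
  also have "\<dots> = \<bar>c\<bar> ^ DIM('a) *\<^sub>R (LINT x|lborel. f (t + c *\<^sub>R x))"
    by (subst integral_density) (auto simp: integral_distr)
  finally show "(LINT x|lborel. f (t + c *\<^sub>R x)) = (1 / \<bar>c\<bar> ^ DIM('a)) *\<^sub>R (LINT x|lborel. f x)"
    using c by simp
  have "integrable lborel f \<longleftrightarrow> integrable (density (distr lborel borel (\<lambda>x. t
      + c *\<^sub>R x)) (\<lambda>_. ennreal (\<bar>c\<bar> ^ DIM('a)))) f"
    using lborel_affine[OF c, of t] by (simp add: ennreal_power)
  also have "\<dots> \<longleftrightarrow> integrable lborel (\<lambda>x. f (t + c *\<^sub>R x))"
  proof -
    have "integrable lborel (\<lambda>x. f (t + c *\<^sub>R x))"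
      if "integrable lborel (\<lambda>x. \<bar>c\<bar> ^ DIM('a) *\<^sub>R f (t + c *\<^sub>R x))"
      using integrable_scaleR_right[OF that, of "1 / \<bar>c\<bar> ^ DIM('a)"] c by simp
    then show ?thesis by (subst integrable_density) (auto simp: integrable_distr_eq)
  qed
  finally show "integrable lborel (\<lambda>x. f (t + c *\<^sub>R x)) \<longleftrightarrow> integrable lborel f" by simp
qed

lemmas integral_lborel_uminus = integral_lborel_affine[where c = "-1" and t = 0, simplified]
  and integrable_lborel_uminus = integrable_lborel_affine_iff[where c = "-1" and t = 0, simplified]

lemma nn_integral_lborel_translate:
  fixes f :: "'a::euclidean_space \<Rightarrow> ennreal"
  assumes [measurable]: "f \<in> borel_measurable borel"
  shows "(\<integral>\<^sup>+x. f (x + t) \<partial>lborel) = (\<integral>\<^sup>+x. f x \<partial>lborel)"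
  by (subst (2) lborel_distr_plus[symmetric, of t]) (simp add: nn_integral_distr add.commute)

text \<open>With the kernels \<open>e\<^bsup>-ix\<xi>\<^esup>\<close> and \<open>e\<^bsup>ix\<xi>\<^esup>\<close> this moves the Fourier transform from one factor of a
pairing to the other.\<close>

lemma Fubini_bounded_kernel:
  fixes f :: "'a::euclidean_space \<Rightarrow> complex" and g :: "'b::euclidean_space \<Rightarrow> complex"
  assumes f: "integrable lborel f" and g: "integrable lborel g"
    and k [measurable]: "(\<lambda>p. k (fst p) (snd p)) \<in> borel_measurable (lborel \<Otimes>\<^sub>M lborel)"
    and bound: "\<And>x y. norm (k x y) \<le> B"
  shows "(LINT x|lborel. (LINT y|lborel. k x y * g y) * f x)
      = (LINT y|lborel. (LINT x|lborel. k x y * f x) * g y)"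
proof -
  note [measurable] = borel_measurable_integrable[OF f] borel_measurable_integrable[OF g]
  have 1: "integrable (lborel \<Otimes>\<^sub>M lborel) (\<lambda>(x,y). g y * f x)"
  proof (rule lborel_pair.Fubini_integrable)
    show "integrable lborel (\<lambda>x. LINT y|lborel. norm (case (x, y) of (x, y) \<Rightarrow> g y * f x))"
      using f by (simp add: norm_mult)
  qed (use g in \<open>auto simp: norm_mult\<close>)
  have B: "B \<ge> 0" using bound[of undefined undefined] norm_ge_zero order_trans by blast
  have 2: "integrable (lborel \<Otimes>\<^sub>M lborel) (\<lambda>(x,y). k x y * g y * f x)"
  proof (rule Bochner_Integration.integrable_bound)
    show "integrable (lborel \<Otimes>\<^sub>M lborel) (\<lambda>p. B *\<^sub>R (case p of (x,y) \<Rightarrow> g y * f x))" using 1 by auto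
    show "(\<lambda>(x,y). k x y * g y * f x) \<in> borel_measurable (lborel \<Otimes>\<^sub>M lborel)"
      unfolding split_beta by measurable
    show "AE p in lborel \<Otimes>\<^sub>M lborel. norm (case p of (x, y) \<Rightarrow> k x y * g y * f x)
        \<le> norm (B *\<^sub>R (case p of (x, y) \<Rightarrow> g y * f x))"
      using B bound by (intro AE_I2) (auto simp: norm_mult mult.assoc intro!: mult_right_mono)
  qed
  have "(LINT x|lborel. (LINT y|lborel. k x y * g y) * f x) = (LINT x|lborel. (LINT y|lborel. k x y
      * g y * f x))"
    by simp
  also have "\<dots> = (LINT y|lborel. (LINT x|lborel. k x y * g y * f x))"
    using lborel_pair.Fubini_integral[OF 2] by simp
  also have "\<dots> = (LINT y|lborel. (LINT x|lborel. (k x y * f x) * g y))"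
    by (simp add: ac_simps)
  finally show "(LINT x|lborel. (LINT y|lborel. k x y * g y) * f x)
      = (LINT y|lborel. (LINT x|lborel. k x y * f x) * g y)" by simp
qed

section \<open>The Fourier transform of integrable functions\<close>

abbreviation iexp_conj :: "real \<Rightarrow> complex" where
  "iexp_conj t \<equiv> exp (- (\<i> * complex_of_real t))"

lemma norm_exp_i [simp]: "norm (iexp_conj t) = 1" "norm (iexp t) = 1"
  by (simp_all add: norm_exp_eq_Re)

lemma integrable_fourier_kernel:
  fixes f :: "'a::euclidean_space \<Rightarrow> complex"
  assumes "integrable lborel f"
  shows "integrable lborel (\<lambda>x. iexp_conj (x \<bullet> \<xi>) * f x)"
    "integrable lborel (\<lambda>x. iexp (x \<bullet> \<xi>) * f x)"
  using borel_measurable_integrable[OF assms]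
  by (auto intro!: Bochner_Integration.integrable_bound[OF assms] simp: norm_mult)

lemma norm_fourier_L1_le: "norm (fourier_L1 f \<xi>) \<le> (LINT x|lborel. norm (f x))"
  unfolding fourier_L1_def
  by (rule order_trans[OF integral_norm_bound]) (simp add: norm_mult)

lemma fourier_L1_cong_AE:
  assumes "AE x in lborel. f x = g x" "f \<in> borel_measurable lborel" "g \<in> borel_measurable lborel"
  shows "fourier_L1 f = fourier_L1 g"
  unfolding fourier_L1_def using assms by (intro ext integral_cong_AE) auto

lemma fourier_L1_diff:
  assumes "integrable lborel f" "integrable lborel g"
  shows "fourier_L1 (\<lambda>x. f x - g x) \<xi> = fourier_L1 f \<xi> - fourier_L1 g \<xi>"
  unfolding fourier_L1_def using integrable_fourier_kernel[OF assms(1)] integrable_fourier_kernel[OF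
      assms(2)]
  by (simp add: algebra_simps)

lemma fourier_L1_cmult: "fourier_L1 (\<lambda>x. c * f x) \<xi> = c * fourier_L1 f \<xi>"
proof -
  have "exp z * (c * f x) = c * (exp z * f x)" for z x by simp
  then show ?thesis unfolding fourier_L1_def by (simp only: integral_mult_right_zero)
qed

lemma continuous_fourier_L1:
  fixes f :: "'a::euclidean_space \<Rightarrow> complex"
  assumes f: "integrable lborel f"
  shows "continuous_on S (fourier_L1 f)"
proof -
  note [measurable] = borel_measurable_integrable[OF f]
  have "(\<lambda>n. fourier_L1 f (\<xi>s n)) \<longlonglongrightarrow> fourier_L1 f \<xi>" if "\<xi>s \<longlonglongrightarrow> \<xi>" for \<xi>s \<xi>
    unfolding fourier_L1_def
  proof (rule integral_dominated_convergence[where w = "\<lambda>x. norm (f x)"])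
    show "AE x in lborel. (\<lambda>n. iexp_conj (x \<bullet> \<xi>s n) * f x)
      \<longlonglongrightarrow> iexp_conj (x \<bullet> \<xi>) * f x"
      using that by (intro AE_I2 tendsto_intros)
  qed (use f in \<open>auto simp: norm_mult\<close>)
  then show ?thesis
    by (simp add: continuous_on_sequentially comp_def)
qed

lemma measurable_fourier_L1 [measurable]:
  "integrable lborel f \<Longrightarrow> fourier_L1 f \<in> borel_measurable borel"
  by (intro borel_measurable_continuous_onI continuous_fourier_L1)

lemma multiplication_formula:
  fixes f g :: "'a::euclidean_space \<Rightarrow> complex"
  assumes "integrable lborel f" "integrable lborel g"
  shows "(LINT \<xi>|lborel. fourier_L1 f \<xi> * g \<xi>) = (LINT x|lborel. f x * fourier_L1 g x)"
  using Fubini_bounded_kernel[OF assms(2,1), of "\<lambda>\<xi> x. iexp_conj (x \<bullet> \<xi>)" 1]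
  unfolding fourier_L1_def by (simp add: inner_commute mult.commute)

lemma fourier_L1_modulation:
  "fourier_L1 (\<lambda>x. iexp (x \<bullet> \<eta>) * f x) \<xi> = fourier_L1 f (\<xi> - \<eta>)"
proof -
  have "iexp_conj (x \<bullet> \<xi>) * iexp (x \<bullet> \<eta>)
      = iexp_conj (x \<bullet> (\<xi> - \<eta>))" for x
    unfolding mult_exp_exp by (simp add: inner_diff_right algebra_simps)
  then show ?thesis unfolding fourier_L1_def by (simp only: mult.assoc[symmetric])
qed

lemma fourier_L1_reflect:
  fixes f :: "'a::euclidean_space \<Rightarrow> complex"
  assumes "f \<in> borel_measurable borel"
  shows "fourier_L1 (\<lambda>x. f (- x)) \<xi> = fourier_L1 f (- \<xi>)"
  unfolding fourier_L1_def
  using integral_lborel_uminus[of "\<lambda>x. iexp_conj (x \<bullet> (-\<xi>)) * f x"] assms by simp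

lemma fourier_L1_cnj: "fourier_L1 (\<lambda>x. cnj (f x)) \<xi> = cnj (fourier_L1 f (- \<xi>))"
proof -
  have "iexp_conj (x \<bullet> \<xi>) * cnj (f x)
      = cnj (iexp_conj (x \<bullet> (- \<xi>)) * f x)" for x
    by (simp add: exp_cnj)
  then have "fourier_L1 (\<lambda>x. cnj (f x)) \<xi> = (LINT x|lborel. cnj (iexp_conj (x \<bullet> (- \<xi>)) * f x))"
    unfolding fourier_L1_def by (intro Bochner_Integration.integral_cong) auto
  then show ?thesis unfolding fourier_L1_def Bochner_Integration.integral_cnj .
qed

section \<open>The Gaussian\<close>

text \<open>The standard normal density, as a product over the coordinates: both its integral and its Fourier
transform then reduce to the one-dimensional ones.\<close>

definition gauss :: "'a::euclidean_space \<Rightarrow> real" where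
  "gauss x = (\<Prod>b\<in>Basis. std_normal_density (x \<bullet> b))"

lemma gauss_nonneg [simp]: "0 \<le> gauss x"
  by (auto simp: gauss_def intro!: prod_nonneg)

lemma measurable_gauss [measurable]: "gauss \<in> borel_measurable borel"
  unfolding gauss_def[abs_def] by measurable

lemma exp_norm_sq_prod: "exp (- (norm x)\<^sup>2 / 2) = (\<Prod>b\<in>Basis. exp (- (x \<bullet> b)\<^sup>2 / 2))"
  for x :: "'a::euclidean_space"
proof -
  have "(norm x)\<^sup>2 = (\<Sum>b\<in>Basis. (x \<bullet> b)\<^sup>2)"
    by (subst power2_norm_eq_inner, subst euclidean_inner) (simp add: power2_eq_square)
  then show ?thesis
    by (simp add: exp_sum[symmetric] sum_negf sum_divide_distrib)
qed

lemma gauss_eq: "exp (- (norm x)\<^sup>2 / 2) = sqrt (2 * pi) ^ DIM('a) * gauss (x::'a::euclidean_space)"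
proof -
  have "exp (- (norm x)\<^sup>2 / 2) = (\<Prod>b\<in>Basis. exp (- (x \<bullet> b)\<^sup>2 / 2))"
    by (rule exp_norm_sq_prod)
  also have "\<dots> = (\<Prod>b\<in>(Basis::'a set). sqrt (2 * pi) * std_normal_density (x \<bullet> b))"
    by (intro prod.cong) (auto simp: std_normal_density_def)
  finally show ?thesis by (simp add: prod.distrib gauss_def)
qed

lemma integrable_gauss [simp]: "integrable lborel gauss"
  unfolding gauss_def[abs_def] by (rule integrable_lborel_prod) simp

lemma integral_gauss [simp]: "(LINT x|lborel. gauss (x::'a::euclidean_space)) = 1"
  unfolding gauss_def[abs_def] by (subst integral_lborel_prod) simp_all

lemma fourier_gauss: "fourier_L1 (\<lambda>x. complex_of_real (gauss x)) \<xi>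
    = complex_of_real (exp (- (norm \<xi>)\<^sup>2 / 2))"
  for \<xi> :: "'a::euclidean_space"
proof -
  have one: "(LINT x|lborel. complex_of_real (std_normal_density x) * iexp_conj (x * t))
      = complex_of_real (exp (- t\<^sup>2 / 2))" for t
  proof -
    have "char std_normal_distribution (- t)
        = (LINT x|lborel. complex_of_real (std_normal_density x) * iexp_conj (x * t))"
      unfolding char_def
      by (subst integral_density) (auto simp: scaleR_conv_of_real mult.commute)
    then show ?thesis using fun_cong[OF char_std_normal_distribution, of "- t"] by simp
  qed
  have int: "integrable lborel (\<lambda>x. complex_of_real (std_normal_density x) * iexp_conj (x * t))" for t
  proof -
    have "integrable lborel std_normal_density" by simp
    then show ?thesis
      by (rule Bochner_Integration.integrable_bound) (auto simp: norm_mult)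
  qed
  have exp_eq: "iexp_conj (x \<bullet> \<xi>) = (\<Prod>b\<in>Basis. iexp_conj ((x \<bullet> b) * (\<xi> \<bullet> b)))" for x
  proof -
    have "- (\<i> * complex_of_real (x \<bullet> \<xi>)) = (\<Sum>b\<in>Basis. - (\<i> * complex_of_real ((x \<bullet> b) * (\<xi> \<bullet> b))))"
      by (subst euclidean_inner) (simp add: sum_negf sum_distrib_left)
    then show ?thesis by (simp only: exp_sum[OF finite_Basis])
  qed
  have "fourier_L1 (\<lambda>x. complex_of_real (gauss x)) \<xi>
    = (LINT x|lborel. (\<Prod>b\<in>Basis. complex_of_real (std_normal_density (x \<bullet> b)) * iexp_conj ((x \<bullet> b)
        * (\<xi> \<bullet> b))))"
    unfolding fourier_L1_def exp_eq gauss_def by (simp add: prod.distrib mult.commute)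
  also have "\<dots> = (\<Prod>b\<in>(Basis::'a set). complex_of_real (exp (- (\<xi> \<bullet> b)\<^sup>2 / 2)))"
    by (subst integral_lborel_prod[OF int]) (simp only: one)
  also have "\<dots> = complex_of_real (exp (- (norm \<xi>)\<^sup>2 / 2))"
    by (simp only: exp_norm_sq_prod of_real_prod)
  finally show ?thesis .
qed

section \<open>Plancherel's theorem\<close>

abbreviation gauss_damp :: "real \<Rightarrow> 'a::euclidean_space \<Rightarrow> real" where
  "gauss_damp \<epsilon> \<xi> \<equiv> exp (- (norm (\<epsilon> *\<^sub>R \<xi>))\<^sup>2 / 2)"

lemma integrable_gauss_damp:
  assumes "\<epsilon> > 0"
  shows "integrable lborel (\<lambda>\<xi>::'a::euclidean_space. gauss_damp \<epsilon> \<xi>)"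
  unfolding gauss_eq
  using integrable_lborel_affine_iff[of "gauss :: 'a \<Rightarrow> real" \<epsilon> 0] assms by simp

lemma fourier_gauss_damp:
  fixes w :: "'a::euclidean_space"
  assumes \<epsilon>: "\<epsilon> > 0"
  shows "fourier_L1 (\<lambda>\<xi>. complex_of_real (gauss_damp \<epsilon> \<xi>)) w
    = complex_of_real ((2 * pi) ^ DIM('a) / \<epsilon> ^ DIM('a) * gauss ((1 / \<epsilon>) *\<^sub>R w))"
proof -
  define s where "s = sqrt (2 * pi) ^ DIM('a)"
  have "s * s = (sqrt (2 * pi) * sqrt (2 * pi)) ^ DIM('a)" unfolding s_def power_mult_distrib ..
  then have s2: "s * s = (2 * pi) ^ DIM('a)" by simp
  define \<phi> where "\<phi> \<zeta> = iexp_conj (\<zeta> \<bullet> ((1 / \<epsilon>) *\<^sub>R w)) * complex_of_real (gauss \<zeta>)" for \<zeta> :: 'a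
  have [measurable]: "\<phi> \<in> borel_measurable borel" unfolding \<phi>_def[abs_def] by measurable
  have "fourier_L1 (\<lambda>\<xi>. complex_of_real (gauss_damp \<epsilon> \<xi>)) w = (LINT \<xi>|lborel. complex_of_real s
      * \<phi> (0 + \<epsilon> *\<^sub>R \<xi>))"
    unfolding fourier_L1_def gauss_eq using \<epsilon>
    by (intro Bochner_Integration.integral_cong) (auto simp: \<phi>_def s_def)
  also have "\<dots> = complex_of_real s * (1 / \<epsilon> ^ DIM('a)) *\<^sub>R fourier_L1 (\<lambda>\<zeta>. complex_of_real (gauss
      \<zeta>)) ((1 / \<epsilon>) *\<^sub>R w)"
  proof -
    have "fourier_L1 (\<lambda>\<zeta>. complex_of_real (gauss \<zeta>)) ((1 / \<epsilon>) *\<^sub>R w) = (LINT \<zeta>|lborel. \<phi> \<zeta>)"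
      unfolding \<phi>_def fourier_L1_def ..
    then show ?thesis
      using \<epsilon> by (subst integral_mult_right_zero, subst integral_lborel_affine) simp_all
  qed
  also have "\<dots> = complex_of_real (s * (1 / \<epsilon> ^ DIM('a)) * (s * gauss ((1 / \<epsilon>) *\<^sub>R w)))"
    unfolding fourier_gauss gauss_eq s_def by (simp add: scaleR_conv_of_real)
  also have "s * (1 / \<epsilon> ^ DIM('a)) * (s * gauss ((1 / \<epsilon>) *\<^sub>R w)) = (2 * pi) ^ DIM('a) / \<epsilon> ^ DIM('a)
      * gauss ((1 / \<epsilon>) *\<^sub>R w)"
    using s2 by (simp add: power_mult_distrib)
  finally show ?thesis .
qed

text \<open>The average of \<open>f\<close> over translates with Gaussian weights, that is, its convolution with the Gaussian of
width \<open>\<epsilon>\<close>; in this form the limit \<open>\<epsilon> \<rightarrow> 0\<close> is a pointwise limit under the integral.\<close>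

definition mollify :: "real \<Rightarrow> ('a::euclidean_space \<Rightarrow> complex) \<Rightarrow> 'a \<Rightarrow> complex" where
  "mollify \<epsilon> f x = (LINT z|lborel. f (x + \<epsilon> *\<^sub>R z) * complex_of_real (gauss z))"

text \<open>The multiplication formula for \<open>f\<close> and a damped character: the transform of the latter is a Gaussian
centred at \<open>x\<close>.\<close>

lemma damped_inversion:
  fixes f :: "'a::euclidean_space \<Rightarrow> complex"
  assumes f: "integrable lborel f" and \<epsilon>: "\<epsilon> > 0"
  shows "(LINT \<xi>|lborel. iexp (\<xi> \<bullet> x) * (fourier_L1 f \<xi> * complex_of_real (gauss_damp \<epsilon> \<xi>)))
    = complex_of_real ((2 * pi) ^ DIM('a)) * mollify \<epsilon> f x"
proof -
  note [measurable] = borel_measurable_integrable[OF f]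
  define g where "g \<xi> = iexp (\<xi> \<bullet> x) * complex_of_real (gauss_damp \<epsilon> \<xi>)" for \<xi> :: 'a
  have gi: "integrable lborel g" unfolding g_def[abs_def]
    by (rule integrable_fourier_kernel(2)) (rule integrable_of_real[OF integrable_gauss_damp[OF \<epsilon>]])
  have Fg: "fourier_L1 g y = complex_of_real ((2 * pi) ^ DIM('a) / \<epsilon> ^ DIM('a)
      * gauss ((1 / \<epsilon>) *\<^sub>R (y - x)))" for y
    unfolding g_def[abs_def] fourier_L1_modulation by (rule fourier_gauss_damp[OF \<epsilon>])
  define \<psi> where "\<psi> y = f y * complex_of_real (gauss ((1 / \<epsilon>) *\<^sub>R (y - x)))" for y
  have [measurable]: "\<psi> \<in> borel_measurable borel" unfolding \<psi>_def[abs_def] by measurable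
  have "(LINT \<xi>|lborel. iexp (\<xi> \<bullet> x) * (fourier_L1 f \<xi> * complex_of_real (gauss_damp \<epsilon> \<xi>)))
    = (LINT \<xi>|lborel. fourier_L1 f \<xi> * g \<xi>)"
    by (intro Bochner_Integration.integral_cong) (simp_all add: g_def)
  also have "\<dots> = (LINT y|lborel. f y * fourier_L1 g y)" by (rule multiplication_formula[OF f gi])
  also have "\<dots> = (LINT y|lborel. complex_of_real ((2 * pi) ^ DIM('a) / \<epsilon> ^ DIM('a)) * \<psi> y)"
    by (intro Bochner_Integration.integral_cong) (simp_all add: \<psi>_def Fg)
  also have "\<dots> = complex_of_real ((2 * pi) ^ DIM('a)) * ((1 / \<epsilon> ^ DIM('a)) *\<^sub>R (LINT y|lborel. \<psi> y))"
    by (simp add: scaleR_conv_of_real)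
  also have "(1 / \<epsilon> ^ DIM('a)) *\<^sub>R (LINT y|lborel. \<psi> y) = (LINT z|lborel. \<psi> (x + \<epsilon> *\<^sub>R z))"
    using \<epsilon> by (subst integral_lborel_affine) auto
  also have "\<dots> = mollify \<epsilon> f x" using \<epsilon> by (simp add: \<psi>_def mollify_def)
  finally show ?thesis .
qed

lemma integrable_fourier_damp:
  fixes f :: "'a::euclidean_space \<Rightarrow> complex"
  assumes f: "integrable lborel f" and \<epsilon>: "\<epsilon> > 0"
  shows "integrable lborel (\<lambda>\<xi>. fourier_L1 f \<xi> * complex_of_real (gauss_damp \<epsilon> \<xi>))"
proof (rule Bochner_Integration.integrable_bound)
  show "integrable lborel (\<lambda>\<xi>::'a. (LINT x|lborel. norm (f x)) * gauss_damp \<epsilon> \<xi>)"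
    by (rule integrable_mult_right) (rule integrable_gauss_damp[OF \<epsilon>])
  show "(\<lambda>\<xi>. fourier_L1 f \<xi> * complex_of_real (gauss_damp \<epsilon> \<xi>)) \<in> borel_measurable lborel"
    using f by measurable
qed (intro AE_I2, auto simp: norm_mult intro!: mult_right_mono order_trans[OF norm_fourier_L1_le])

text \<open>The square of the modulus of the transform is a double integral of
\<open>f(x) cnj (f(y)) e\<^bsup>-i(x-y)\<xi>\<^esup>\<close>. The damping makes it absolutely integrable in all variables,
    and the integral
over \<open>\<xi>\<close> can be done first.\<close>

lemma damped_energy:
  fixes f :: "'a::euclidean_space \<Rightarrow> complex"
  assumes f: "integrable lborel f" and \<epsilon>: "\<epsilon> > 0"
  shows "complex_of_real (LINT \<xi>|lborel. (norm (fourier_L1 f \<xi>))\<^sup>2 * gauss_damp \<epsilon> \<xi>)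
    = complex_of_real ((2 * pi) ^ DIM('a)) * (LINT x|lborel. mollify \<epsilon> f x * cnj (f x))"
proof -
  define h where "h \<xi> = fourier_L1 f \<xi> * complex_of_real (gauss_damp \<epsilon> \<xi>)" for \<xi>
  have hi: "integrable lborel h" unfolding h_def[abs_def] by (rule integrable_fourier_damp[OF f \<epsilon>])
  have cf: "integrable lborel (\<lambda>x. cnj (f x))" using f by simp
  have cnj_F: "cnj (fourier_L1 f \<xi>) = (LINT x|lborel. iexp (\<xi> \<bullet> x) * cnj (f x))" for \<xi>
    unfolding fourier_L1_def Bochner_Integration.integral_cnj[symmetric]
    by (intro Bochner_Integration.integral_cong) (simp_all add: exp_cnj inner_commute)
  have "complex_of_real (LINT \<xi>|lborel. (norm (fourier_L1 f \<xi>))\<^sup>2 * gauss_damp \<epsilon> \<xi>)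
     = (LINT \<xi>|lborel. (LINT x|lborel. iexp (\<xi> \<bullet> x) * cnj (f x)) * h \<xi>)"
  proof -
    have "complex_of_real ((norm (fourier_L1 f \<xi>))\<^sup>2 * gauss_damp \<epsilon> \<xi>) = cnj (fourier_L1 f \<xi>)
        * h \<xi>" for \<xi>
      unfolding of_real_mult complex_norm_square h_def by (simp only: mult_ac)
    then show ?thesis
      unfolding cnj_F[symmetric] by (subst integral_complex_of_real[symmetric]) (simp only:)
  qed
  also have "\<dots> = (LINT x|lborel. (LINT \<xi>|lborel. iexp (\<xi> \<bullet> x) * h \<xi>) * cnj (f x))"
    by (rule Fubini_bounded_kernel[OF hi cf, of _ 1]) auto
  also have "\<dots> = (LINT x|lborel. complex_of_real ((2 * pi) ^ DIM('a)) * (mollify \<epsilon> f x * cnj (f x)))"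
    unfolding h_def damped_inversion[OF f \<epsilon>] by (simp only: mult.assoc)
  finally show ?thesis by simp
qed

lemma norm_integral_le_nn_integral:
  "ennreal (norm (integral\<^sup>L M f)) \<le> (\<integral>\<^sup>+x. ennreal (norm (f x)) \<partial>M)"
  by (cases "integrable M f") (simp_all add: integral_norm_bound_ennreal not_integrable_integral_eq)

text \<open>Schur's test: \<open>2 |f(x) f(y)| \<le> |f(x)|\<^sup>2 + |f(y)|\<^sup>2\<close> is integrated against a kernel of total mass
one in each of the two variables.\<close>

lemma mollify_pairing_le:
  fixes f :: "'a::euclidean_space \<Rightarrow> complex"
  assumes [measurable]: "f \<in> borel_measurable borel"
  shows "ennreal (norm (LINT x|lborel. mollify \<epsilon> f x * cnj (f x)))
      \<le> (\<integral>\<^sup>+x. ennreal ((norm (f x))\<^sup>2) \<partial>lborel)"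
proof -
  define S where "S = (\<integral>\<^sup>+x. ennreal ((norm (f x))\<^sup>2) \<partial>lborel)"
  have young: "norm (f (x + \<epsilon> *\<^sub>R z)) * gauss z * norm (f x)
      \<le> gauss z / 2 * (norm (f (x + \<epsilon> *\<^sub>R z)))\<^sup>2 + gauss z / 2 * (norm (f x))\<^sup>2" for x z
  proof -
    have "2 * (norm (f (x + \<epsilon> *\<^sub>R z)) * norm (f x)) \<le> (norm (f (x + \<epsilon> *\<^sub>R z)))\<^sup>2 + (norm (f x))\<^sup>2"
      using sum_squares_bound[of "norm (f (x + \<epsilon> *\<^sub>R z))" "norm (f x)"] by simp
    from mult_left_mono[OF this, of "gauss z / 2"] show ?thesis by (simp add: algebra_simps)
  qed
  have "ennreal (norm (LINT x|lborel. mollify \<epsilon> f x * cnj (f x)))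
      \<le> (\<integral>\<^sup>+x. ennreal (norm (mollify \<epsilon> f x * cnj (f x))) \<partial>lborel)"
    by (rule norm_integral_le_nn_integral)
  also have "\<dots> \<le> (\<integral>\<^sup>+x. \<integral>\<^sup>+z. ennreal (norm (f (x + \<epsilon> *\<^sub>R z)) * gauss z * norm (f x)) \<partial>lborel \<partial>lborel)"
  proof (rule nn_integral_mono)
    fix x
    have "ennreal (norm (mollify \<epsilon> f x * cnj (f x))) = ennreal (norm (mollify \<epsilon> f x))
        * ennreal (norm (f x))"
      by (simp add: norm_mult ennreal_mult')
    also have "\<dots> \<le> (\<integral>\<^sup>+z. ennreal (norm (f (x + \<epsilon> *\<^sub>R z) * complex_of_real (gauss z))) \<partial>lborel)
        * ennreal (norm (f x))"
      unfolding mollify_def by (intro mult_right_mono norm_integral_le_nn_integral) auto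
    also have "\<dots> = (\<integral>\<^sup>+z. ennreal (norm (f (x + \<epsilon> *\<^sub>R z)) * gauss z * norm (f x)) \<partial>lborel)"
      by (subst nn_integral_multc[symmetric]) (auto simp: norm_mult ennreal_mult')
    finally show "ennreal (norm (mollify \<epsilon> f x * cnj (f x)))
      \<le> (\<integral>\<^sup>+z. ennreal (norm (f (x + \<epsilon> *\<^sub>R z)) * gauss z * norm (f x)) \<partial>lborel)" .
  qed
  also have "\<dots> \<le> (\<integral>\<^sup>+x. \<integral>\<^sup>+z. ennreal (gauss z / 2) * ennreal ((norm (f (x + \<epsilon> *\<^sub>R z)))\<^sup>2)
      + ennreal (gauss z / 2) * ennreal ((norm (f x))\<^sup>2) \<partial>lborel \<partial>lborel)"
  proof (intro nn_integral_mono)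
    fix x z
    show "ennreal (norm (f (x + \<epsilon> *\<^sub>R z)) * gauss z * norm (f x))
      \<le> ennreal (gauss z / 2) * ennreal ((norm (f (x + \<epsilon> *\<^sub>R z)))\<^sup>2) + ennreal (gauss z / 2)
          * ennreal ((norm (f x))\<^sup>2)"
      using ennreal_leI[OF young[of x z]]
      by (subst (asm) ennreal_plus) (simp_all add: ennreal_mult del: times_divide_eq_left
          times_divide_eq_right)
  qed
  also have "\<dots> = (\<integral>\<^sup>+z. \<integral>\<^sup>+x. ennreal (gauss z / 2) * ennreal ((norm (f (x + \<epsilon> *\<^sub>R z)))\<^sup>2)
      + ennreal (gauss z / 2) * ennreal ((norm (f x))\<^sup>2) \<partial>lborel \<partial>lborel)"
    by (rule lborel_pair.Fubini') measurable
  also have "\<dots> = (\<integral>\<^sup>+z. ennreal (gauss (z::'a) / 2) * S + ennreal (gauss z / 2) * S \<partial>lborel)"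
    by (simp add: nn_integral_add nn_integral_cmult S_def nn_integral_lborel_translate[where f
        = "\<lambda>x. ennreal ((norm (f x))\<^sup>2)"])
  also have "\<dots> = (\<integral>\<^sup>+z. ennreal (gauss (z::'a)) * S \<partial>lborel)"
    by (intro nn_integral_cong) (simp flip: distrib_right ennreal_plus)
  also have "\<dots> = S"
    by (simp add: nn_integral_multc nn_integral_eq_integral)
  finally show ?thesis unfolding S_def .
qed

text \<open>Fatou's lemma, applied to the energy identity as the damping is removed, gives one half of Plancherel's
theorem.\<close>

lemma
  fixes f :: "'a::euclidean_space \<Rightarrow> complex"
  assumes f: "integrable lborel f" "f \<in> L2_space"
  shows fourier_L1_in_L2: "fourier_L1 f \<in> L2_space"
    and fourier_L1_L2_norm_le: "L2_norm (fourier_L1 f) \<le> sqrt ((2 * pi) ^ DIM('a)) * L2_norm f"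
proof -
  note [measurable] = borel_measurable_integrable[OF f(1)] measurable_fourier_L1[OF f(1)]
  note f2 = L2_spaceD[OF f(2)]
  define c where "c = (2 * pi) ^ DIM('a)"
  have c: "c > 0" by (simp add: c_def)
  define S where "S = (LINT x|lborel. (norm (f x))\<^sup>2)"
  have S: "(\<integral>\<^sup>+x. ennreal ((norm (f x))\<^sup>2) \<partial>lborel) = ennreal S"
    unfolding S_def by (rule nn_integral_eq_integral) (use f2 in auto)
  have S0: "S \<ge> 0" by (simp add: S_def)
  define \<epsilon> where "\<epsilon> k = 1 / real (Suc k)" for k
  have \<epsilon>: "\<epsilon> k > 0" for k by (simp add: \<epsilon>_def)
  have damp1: "gauss_damp (\<epsilon> k) \<xi> \<le> 1" for k and \<xi> :: 'a by simp
  have step: "(\<integral>\<^sup>+\<xi>. ennreal ((norm (fourier_L1 f \<xi>))\<^sup>2 * gauss_damp (\<epsilon> k) \<xi>) \<partial>lborel) \<le> ennreal (c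
      * S)" for k
  proof -
    have "integrable lborel (\<lambda>\<xi>. (LINT x|lborel. norm (f x)) * norm (fourier_L1 f \<xi>
        * complex_of_real (gauss_damp (\<epsilon> k) \<xi>)))"
      using integrable_fourier_damp[OF f(1) \<epsilon>] by (intro integrable_mult_right integrable_norm)
    then have int: "integrable lborel (\<lambda>\<xi>. (norm (fourier_L1 f \<xi>))\<^sup>2 * gauss_damp (\<epsilon> k) \<xi>)"
    proof (rule Bochner_Integration.integrable_bound)
      show "AE \<xi> in lborel. norm ((norm (fourier_L1 f \<xi>))\<^sup>2 * gauss_damp (\<epsilon> k) \<xi>)
        \<le> norm ((LINT x|lborel. norm (f x)) * norm (fourier_L1 f \<xi>
            * complex_of_real (gauss_damp (\<epsilon> k) \<xi>)))"
      proof (intro AE_I2)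
        fix \<xi>
        have "norm (fourier_L1 f \<xi>) * (norm (fourier_L1 f \<xi>) * gauss_damp (\<epsilon> k) \<xi>)
          \<le> (LINT x|lborel. norm (f x)) * (norm (fourier_L1 f \<xi>) * gauss_damp (\<epsilon> k) \<xi>)"
          by (intro mult_right_mono norm_fourier_L1_le) auto
        then show "norm ((norm (fourier_L1 f \<xi>))\<^sup>2 * gauss_damp (\<epsilon> k) \<xi>)
          \<le> norm ((LINT x|lborel. norm (f x)) * norm (fourier_L1 f \<xi>
              * complex_of_real (gauss_damp (\<epsilon> k) \<xi>)))"
          by (simp add: norm_mult power2_eq_square[of "norm (fourier_L1 f \<xi>)"] abs_mult mult.assoc)
      qed
    qed measurable
    have "(\<integral>\<^sup>+\<xi>. ennreal ((norm (fourier_L1 f \<xi>))\<^sup>2 * gauss_damp (\<epsilon> k) \<xi>) \<partial>lborel)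
        = ennreal (LINT \<xi>|lborel. (norm (fourier_L1 f \<xi>))\<^sup>2 * gauss_damp (\<epsilon> k) \<xi>)"
      by (rule nn_integral_eq_integral[OF int]) auto
    also have "\<dots> = ennreal (norm (complex_of_real (LINT \<xi>|lborel. (norm (fourier_L1 f \<xi>))\<^sup>2
        * gauss_damp (\<epsilon> k) \<xi>)))"
      unfolding norm_of_real by (subst abs_of_nonneg) auto
    also have "\<dots> = ennreal c * ennreal (norm (LINT x|lborel. mollify (\<epsilon> k) f x * cnj (f x)))"
      unfolding damped_energy[OF f(1) \<epsilon>] using c by (simp add: c_def norm_mult ennreal_mult' norm_power)
    also have "\<dots> \<le> ennreal c * ennreal S"
      unfolding S[symmetric] by (intro mult_left_mono mollify_pairing_le) auto
    finally show ?thesis using c by (simp add: ennreal_mult')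
  qed
  have lim: "(\<lambda>k. ennreal ((norm (fourier_L1 f \<xi>))\<^sup>2 * gauss_damp (\<epsilon> k) \<xi>))
      \<longlonglongrightarrow> ennreal ((norm (fourier_L1 f \<xi>))\<^sup>2)" for \<xi>
  proof -
    have e0: "\<epsilon> \<longlonglongrightarrow> 0" unfolding \<epsilon>_def[abs_def] using LIMSEQ_inverse_real_of_nat by
        (simp add: inverse_eq_divide)
    have "(\<lambda>k. (norm (fourier_L1 f \<xi>))\<^sup>2 * gauss_damp (\<epsilon> k) \<xi>) \<longlonglongrightarrow> (norm (fourier_L1 f \<xi>))\<^sup>2
        * exp (- (norm (0 *\<^sub>R \<xi>))\<^sup>2 / 2)"
      by (intro tendsto_intros e0) simp
    then show ?thesis by (intro tendsto_ennrealI) simp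
  qed
  have "(\<integral>\<^sup>+\<xi>. ennreal ((norm (fourier_L1 f \<xi>))\<^sup>2) \<partial>lborel)
      = (\<integral>\<^sup>+\<xi>. liminf (\<lambda>k. ennreal ((norm (fourier_L1 f \<xi>))\<^sup>2 * gauss_damp (\<epsilon> k) \<xi>)) \<partial>lborel)"
    using lim_imp_Liminf[OF sequentially_bot lim] by simp
  also have "\<dots> \<le> liminf (\<lambda>k. \<integral>\<^sup>+\<xi>. ennreal ((norm (fourier_L1 f \<xi>))\<^sup>2 * gauss_damp (\<epsilon> k) \<xi>) \<partial>lborel)"
    by (rule nn_integral_liminf) measurable
  also have "\<dots> \<le> liminf (\<lambda>k. ennreal (c * S))" by (intro Liminf_mono always_eventually allI step)
  also have "\<dots> = ennreal (c * S)" by (simp add: Liminf_const)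
  finally have le: "(\<integral>\<^sup>+\<xi>. ennreal ((norm (fourier_L1 f \<xi>))\<^sup>2) \<partial>lborel) \<le> ennreal (c * S)" .
  then have "(\<integral>\<^sup>+\<xi>. ennreal (norm ((norm (fourier_L1 f \<xi>))\<^sup>2)) \<partial>lborel) < \<infinity>"
    by (simp add: order_le_less_trans)
  then have int: "integrable lborel (\<lambda>\<xi>. (norm (fourier_L1 f \<xi>))\<^sup>2)"
    by (intro integrableI_bounded) auto
  then show "fourier_L1 f \<in> L2_space" by (intro L2_spaceI) auto
  have "(LINT \<xi>|lborel. (norm (fourier_L1 f \<xi>))\<^sup>2) \<le> c * S"
    using le c S0 int by (subst (asm) nn_integral_eq_integral) auto
  then show "L2_norm (fourier_L1 f) \<le> sqrt ((2 * pi) ^ DIM('a)) * L2_norm f"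
    unfolding L2_norm_def S_def c_def real_sqrt_mult[symmetric] by (rule real_sqrt_le_mono)
qed

lemma mollify_tendsto:
  fixes f :: "'a::euclidean_space \<Rightarrow> complex"
  assumes f: "continuous_on UNIV f" "\<And>x. norm (f x) \<le> B" and e: "\<epsilon> \<longlonglongrightarrow> 0"
  shows "(\<lambda>k. mollify (\<epsilon> k) f x) \<longlonglongrightarrow> f x"
proof -
  have [measurable]: "f \<in> borel_measurable borel" by (rule borel_measurable_continuous_onI[OF f(1)])
  have "(\<lambda>k. mollify (\<epsilon> k) f x) \<longlonglongrightarrow> (LINT z|lborel. f x * complex_of_real (gauss (z::'a)))"
    unfolding mollify_def
  proof (rule integral_dominated_convergence[where w = "\<lambda>z. B * gauss z"])
    show "AE z in lborel. (\<lambda>k. f (x + \<epsilon> k *\<^sub>R z) * complex_of_real (gauss z)) \<longlonglongrightarrow> f x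
        * complex_of_real (gauss z)"
    proof (intro AE_I2 tendsto_mult tendsto_const)
      fix z
      have "(\<lambda>k. x + \<epsilon> k *\<^sub>R z) \<longlonglongrightarrow> x + 0 *\<^sub>R z" by (intro tendsto_intros e)
      then show "(\<lambda>k. f (x + \<epsilon> k *\<^sub>R z)) \<longlonglongrightarrow> f x"
        using f(1) by (auto simp: continuous_on_eq_continuous_at continuous_at_sequentially comp_def)
    qed
  qed (use f(2) in \<open>auto simp: norm_mult intro!: mult_right_mono\<close>)
  then show ?thesis by simp
qed

lemma norm_mollify_le:
  fixes f :: "'a::euclidean_space \<Rightarrow> complex"
  assumes "\<And>x. norm (f x) \<le> B"
  shows "norm (mollify \<epsilon> f x) \<le> B"
proof -
  have B: "B \<ge> 0" using assms[of undefined] norm_ge_zero order_trans by blast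
  have "ennreal (norm (mollify \<epsilon> f x)) \<le> (\<integral>\<^sup>+z. ennreal (norm (f (x + \<epsilon> *\<^sub>R z)
      * complex_of_real (gauss z))) \<partial>lborel)"
    unfolding mollify_def by (rule norm_integral_le_nn_integral)
  also have "\<dots> \<le> (\<integral>\<^sup>+z. ennreal (B * gauss (z::'a)) \<partial>lborel)"
    by (intro nn_integral_mono ennreal_leI) (auto simp: norm_mult assms intro!: mult_right_mono)
  also have "\<dots> = ennreal B"
    using B by (subst nn_integral_eq_integral) auto
  finally show ?thesis using B by simp
qed

text \<open>For a bounded continuous function the mollification converges everywhere, and both sides of the energy
identity pass to the limit.\<close>

lemma Plancherel_bounded_continuous:
  fixes f :: "'a::euclidean_space \<Rightarrow> complex"
  assumes f: "integrable lborel f" "f \<in> L2_space" "continuous_on UNIV f" and B: "\<And>x. norm (f x) \<le> B"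
  shows "L2_norm (fourier_L1 f) = sqrt ((2 * pi) ^ DIM('a)) * L2_norm f"
proof -
  note [measurable] = borel_measurable_integrable[OF f(1)] measurable_fourier_L1[OF f(1)]
  define c where "c = (2 * pi) ^ DIM('a)"
  define \<epsilon> where "\<epsilon> k = 1 / real (Suc k)" for k
  have \<epsilon>: "\<epsilon> k > 0" for k by (simp add: \<epsilon>_def)
  have e0: "\<epsilon> \<longlonglongrightarrow> 0" unfolding \<epsilon>_def[abs_def] using LIMSEQ_inverse_real_of_nat by
      (simp add: inverse_eq_divide)
  note F2 = L2_spaceD[OF fourier_L1_in_L2[OF f(1,2)]]
  have l1: "(\<lambda>k. LINT \<xi>|lborel. (norm (fourier_L1 f \<xi>))\<^sup>2 * gauss_damp (\<epsilon> k) \<xi>)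
      \<longlonglongrightarrow> (LINT \<xi>|lborel. (norm (fourier_L1 f \<xi>))\<^sup>2)"
  proof (rule integral_dominated_convergence[where w = "\<lambda>\<xi>. (norm (fourier_L1 f \<xi>))\<^sup>2"])
    have "(\<lambda>k. (norm (fourier_L1 f \<xi>))\<^sup>2 * gauss_damp (\<epsilon> k) \<xi>) \<longlonglongrightarrow> (norm (fourier_L1 f \<xi>))\<^sup>2
        * exp (- (norm (0 *\<^sub>R \<xi>))\<^sup>2 / 2)" for \<xi>
      by (intro tendsto_intros e0) simp
    then show "AE \<xi> in lborel. (\<lambda>k. (norm (fourier_L1 f \<xi>))\<^sup>2 * gauss_damp (\<epsilon> k) \<xi>)
        \<longlonglongrightarrow> (norm (fourier_L1 f \<xi>))\<^sup>2"
      by simp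
  qed (use F2 in \<open>auto simp: intro!: mult_left_le\<close>)
  have "integrable lborel (\<lambda>x. cnj (f x))" using f(1) by simp
  then have [measurable]: "(\<lambda>x. cnj (f x)) \<in> borel_measurable borel"
    using borel_measurable_integrable by fastforce
  have mm [measurable]: "mollify e f \<in> borel_measurable borel" for e
    unfolding mollify_def[abs_def] by measurable
  have l2: "(\<lambda>k. LINT x|lborel. mollify (\<epsilon> k) f x * cnj (f x)) \<longlonglongrightarrow> (LINT x|lborel. f x * cnj (f x))"
  proof (rule integral_dominated_convergence[where w = "\<lambda>x. B * norm (f x)"])
    show "AE x in lborel. (\<lambda>k. mollify (\<epsilon> k) f x * cnj (f x)) \<longlonglongrightarrow> f x * cnj (f x)"
      by (intro AE_I2 tendsto_mult tendsto_const mollify_tendsto[OF f(3) B e0])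
    show "AE x in lborel. norm (mollify (\<epsilon> k) f x * cnj (f x)) \<le> B * norm (f x)" for k
      by (intro AE_I2) (auto simp: norm_mult intro!: mult_right_mono norm_mollify_le B)
  qed (use f(1) in auto)
  have "(\<lambda>k. complex_of_real (LINT \<xi>|lborel. (norm (fourier_L1 f \<xi>))\<^sup>2 * gauss_damp (\<epsilon> k) \<xi>))
      \<longlonglongrightarrow> complex_of_real c * (LINT x|lborel. f x * cnj (f x))"
    unfolding damped_energy[OF f(1) \<epsilon>] c_def by (intro tendsto_mult tendsto_const l2)
  from LIMSEQ_unique[OF this tendsto_of_real[OF l1]]
  have "complex_of_real (LINT \<xi>|lborel. (norm (fourier_L1 f \<xi>))\<^sup>2) = complex_of_real c
      * (LINT x|lborel. f x * cnj (f x))" by simp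
  also have "(LINT x|lborel. f x * cnj (f x)) = complex_of_real (LINT x|lborel. (norm (f x))\<^sup>2)"
    by (subst integral_complex_of_real[symmetric]) (simp only: complex_norm_square)
  finally have "(LINT \<xi>|lborel. (norm (fourier_L1 f \<xi>))\<^sup>2) = c * (LINT x|lborel. (norm (f x))\<^sup>2)"
    by (simp only: of_real_mult[symmetric] of_real_eq_iff)
  then show ?thesis by (simp add: L2_norm_def c_def real_sqrt_mult)
qed

text \<open>Both norms are continuous on \<open>L\<^sup>2\<close>, the left one by the inequality already proved, and bounded continuous
functions are dense.\<close>

theorem Plancherel:
  fixes f :: "'a::euclidean_space \<Rightarrow> complex"
  assumes f: "integrable lborel f" "f \<in> L2_space"
  shows "L2_norm (fourier_L1 f) = sqrt ((2 * pi) ^ DIM('a)) * L2_norm f"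
proof (rule antisym[OF fourier_L1_L2_norm_le[OF f]])
  define c where "c = sqrt ((2 * pi) ^ DIM('a))"
  have c: "c > 0" by (simp add: c_def)
  have "c * L2_norm f \<le> L2_norm (fourier_L1 f) + e" if "e > 0" for e
  proof -
    define d where "d = e / (2 * c)"
    have d: "d > 0" using that c by (simp add: d_def)
    obtain g where g: "continuous_on UNIV g" "integrable lborel g" "g \<in> L2_space"
      "bounded (range g)" and fg: "L2_norm (\<lambda>x. f x - g x) < d"
      by (rule L2_approx_continuous[OF f d])
    obtain B where B: "\<And>x. norm (g x) \<le> B" using g(4) unfolding bounded_iff by blast
    have Fg: "L2_norm (fourier_L1 g) = c * L2_norm g"
      unfolding c_def by (rule Plancherel_bounded_continuous[OF g(2,3,1) B])
    have gf: "integrable lborel (\<lambda>x. g x - f x)" "(\<lambda>x. g x - f x) \<in> L2_space"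
      using g f by (auto intro: L2_space_diff)
    have "L2_norm (fourier_L1 g) \<le> L2_norm (fourier_L1 f) + L2_norm (\<lambda>\<xi>. fourier_L1 g \<xi>
        - fourier_L1 f \<xi>)"
      using f g by (intro L2_norm_triangle_diff fourier_L1_in_L2)
    also have "L2_norm (\<lambda>\<xi>. fourier_L1 g \<xi> - fourier_L1 f \<xi>) \<le> c * L2_norm (\<lambda>x. g x - f x)"
    proof -
      have "fourier_L1 (\<lambda>x. g x - f x) = (\<lambda>\<xi>. fourier_L1 g \<xi> - fourier_L1 f \<xi>)"
        by (intro ext fourier_L1_diff g f)
      then show ?thesis using fourier_L1_L2_norm_le[OF gf] by (simp add: c_def)
    qed
    also have "\<dots> \<le> c * d" using fg c L2_norm_minus_commute[of g f] by (intro mult_left_mono) auto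
    finally have 1: "c * L2_norm g \<le> L2_norm (fourier_L1 f) + c * d" by (simp add: Fg)
    have "L2_norm f \<le> L2_norm g + d" using L2_norm_triangle_diff[OF f(2) g(3)] fg by linarith
    then have "c * L2_norm f \<le> c * L2_norm g + c * d" using c by (simp flip: distrib_left)
    with 1 have "c * L2_norm f \<le> L2_norm (fourier_L1 f) + 2 * (c * d)" by linarith
    also have "2 * (c * d) = e" using c by (simp add: d_def)
    finally show ?thesis .
  qed
  then show "sqrt ((2 * pi) ^ DIM('a)) * L2_norm f \<le> L2_norm (fourier_L1 f)"
    unfolding c_def by (rule field_le_epsilon)
qed

section \<open>The transform of square-integrable functions and multipliers\<close>

definition inv_fourier :: "('a::euclidean_space \<Rightarrow> complex) \<Rightarrow> 'a \<Rightarrow> complex" where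
  "inv_fourier g x = fourier_L1 g (- x) / complex_of_real ((2 * pi) ^ DIM('a))"

abbreviation truncate :: "real \<Rightarrow> ('a::euclidean_space \<Rightarrow> 'b::real_normed_vector) \<Rightarrow> 'a \<Rightarrow> 'b" where
  "truncate R f \<equiv> \<lambda>x. indicator (cball 0 R) x *\<^sub>R f x"

lemma
  fixes f :: "'a::euclidean_space \<Rightarrow> complex"
  assumes f: "f \<in> L2_space"
  shows truncate_L2: "truncate R f \<in> L2_space"
    and truncate_integrable: "integrable lborel (truncate R f)"
    and truncate_tendsto: "((\<lambda>R. L2_norm (\<lambda>x. truncate R f x - f x)) \<longlongrightarrow> 0) at_top"
proof -
  note f2 [measurable] = L2_spaceD[OF f]
  show "truncate R f \<in> L2_space"
    by (rule L2_space_bound[OF f]) (auto simp: indicator_def)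
  have fin: "emeasure lborel (cball (0::'a) R) < \<infinity>"
    by (rule emeasure_bounded_finite) simp
  have sq: "(indicator A x :: real)\<^sup>2 = indicator A x" for A :: "'a set" and x by
      (simp add: indicator_def)
  have "(\<lambda>x. indicator (cball (0::'a) R) x :: real) \<in> borel_measurable lborel"
    by (intro borel_measurable_indicator) simp
  then have "integrable lborel (\<lambda>x. indicator (cball 0 R) x * norm (f x))"
    by (rule Cauchy_Schwarz_integral) (use f2 fin in \<open>auto simp: sq\<close>)
  then show "integrable lborel (truncate R f)"
    by (rule Bochner_Integration.integrable_bound) (auto simp: indicator_def)
  have "((\<lambda>R. LINT x|lborel. (norm (truncate R f x - f x))\<^sup>2) \<longlongrightarrow> (LINT x|(lborel::'a measure). 0)) at_top"
  proof (rule integral_dominated_convergence_at_top[where w = "\<lambda>x. (norm (f x))\<^sup>2"])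
    show "AE x in lborel. ((\<lambda>R. (norm (truncate R f x - f x))\<^sup>2) \<longlongrightarrow> 0) at_top"
    proof (intro AE_I2 tendsto_eventually)
      fix x
      show "eventually (\<lambda>R. (norm (truncate R f x - f x))\<^sup>2 = 0) at_top"
        using eventually_ge_at_top[of "norm x"] by eventually_elim (auto simp: indicator_def)
    qed
  qed (use f2 in \<open>auto simp: indicator_def\<close>)
  then show "((\<lambda>R. L2_norm (\<lambda>x. truncate R f x - f x)) \<longlongrightarrow> 0) at_top"
    unfolding L2_norm_def using tendsto_real_sqrt by fastforce
qed

lemma L2_inner_expand:
  fixes f g :: "'a::euclidean_space \<Rightarrow> complex"
  assumes "f \<in> L2_space" "g \<in> L2_space"
  shows "(L2_norm (\<lambda>x. f x - g x))\<^sup>2 = (L2_norm f)\<^sup>2 - 2 * Re (LINT x|lborel. f x * cnj (g x))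
      + (L2_norm g)\<^sup>2"
proof -
  note f [measurable] = L2_spaceD[OF assms(1)]
  note g [measurable] = L2_spaceD[OF assms(2)]
  have cg: "(\<lambda>x. cnj (g x)) \<in> borel_measurable lborel"
    using borel_measurable_continuous_onI[OF continuous_on_cnj[OF continuous_on_id]] g(1) by
        (auto intro: measurable_compose)
  have "integrable lborel (\<lambda>x. norm (f x) * norm (g x))"
    by (rule Cauchy_Schwarz_integral) (use f g in auto)
  then have int: "integrable lborel (\<lambda>x. f x * cnj (g x))"
    by (rule Bochner_Integration.integrable_bound) (use cg in \<open>auto simp: norm_mult\<close>)
  define h where "h x = f x * cnj (g x)" for x
  have hi: "integrable lborel h" using int by (simp add: h_def[abs_def])
  have "(norm (f x - g x))\<^sup>2 = (norm (f x))\<^sup>2 - 2 * Re (h x) + (norm (g x))\<^sup>2" for x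
    unfolding cmod_power2 h_def by (simp add: power2_eq_square algebra_simps)
  then have "(L2_norm (\<lambda>x. f x - g x))\<^sup>2
      = (LINT x|lborel. (norm (f x))\<^sup>2 - 2 * Re (h x) + (norm (g x))\<^sup>2)"
    unfolding L2_norm_sq by simp
  also have "\<dots> = (L2_norm f)\<^sup>2 - 2 * (LINT x|lborel. Re (h x)) + (L2_norm g)\<^sup>2"
    unfolding L2_norm_sq using f g hi by simp
  also have "(LINT x|lborel. Re (h x)) = Re (LINT x|lborel. f x * cnj (g x))"
    unfolding h_def[symmetric] using hi by (simp add: h_def[abs_def, symmetric])
  finally show ?thesis .
qed

lemma has_fourier_L2_fourier_L1:
  fixes f :: "'a::euclidean_space \<Rightarrow> complex"
  assumes f: "integrable lborel f" "f \<in> L2_space"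
  shows "has_fourier_L2 f (fourier_L1 f)"
  unfolding has_fourier_L2_def
proof (intro conjI f fourier_L1_in_L2)
  have "L2_norm (\<lambda>\<xi>. fourier_L1 (truncate R f) \<xi> - fourier_L1 f \<xi>) = sqrt ((2 * pi) ^ DIM('a))
      * L2_norm (\<lambda>x. truncate R f x - f x)" for R
  proof -
    have "(\<lambda>\<xi>. fourier_L1 (truncate R f) \<xi> - fourier_L1 f \<xi>) = fourier_L1 (\<lambda>x. truncate R f x - f x)"
      using f(1) truncate_integrable[OF f(2)] by (intro ext fourier_L1_diff[symmetric])
    then show ?thesis
      using Plancherel[of "\<lambda>x. truncate R f x - f x"] f truncate_integrable[OF f(2), of R]
        L2_space_diff[OF truncate_L2[OF f(2), of R] f(2)] by simp
  qed
  then show "((\<lambda>R. L2_norm (\<lambda>\<xi>. fourier_L1 (truncate R f) \<xi> - fourier_L1 f \<xi>)) \<longlongrightarrow> 0) at_top"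
    using tendsto_mult_right_zero[OF truncate_tendsto[OF f(2)]] by simp
qed

text \<open>The function \<open>inv_fourier g\<close> need not be integrable, so its transform is a limit over truncations. In the
square of the distance between the transform of a truncation and \<open>g\<close>, the multiplication formula moves
the transform of the mixed term to \<open>g\<close>, where it reproduces \<open>inv_fourier g\<close>; the result is a
constant times the squared distance of \<open>inv_fourier g\<close> to its truncation.\<close>

lemma
  fixes g :: "'a::euclidean_space \<Rightarrow> complex"
  assumes g: "integrable lborel g" "g \<in> L2_space"
  shows inv_fourier_L2: "inv_fourier g \<in> L2_space"
    and L2_norm_inv_fourier: "L2_norm g = sqrt ((2 * pi) ^ DIM('a)) * L2_norm (inv_fourier g)"
    and has_fourier_L2_inv_fourier: "has_fourier_L2 (inv_fourier g) g"
proof -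
  define c where "c = (2 * pi) ^ DIM('a)"
  have c: "c > 0" by (simp add: c_def)
  note [measurable] = measurable_fourier_L1[OF g(1)]
  note F2 = L2_spaceD[OF fourier_L1_in_L2[OF g]]
  have inv_eq: "inv_fourier g x = (1 / c) *\<^sub>R fourier_L1 g (- x)" for x
    by (simp add: inv_fourier_def c_def scaleR_conv_of_real)
  have [measurable]: "(\<lambda>\<xi>. (norm (fourier_L1 g \<xi>))\<^sup>2) \<in> borel_measurable borel" by measurable
  have refl: "(\<lambda>x. fourier_L1 g (- x)) \<in> L2_space"
    using F2(2) by (intro L2_spaceI) (auto simp: integrable_lborel_uminus[of "\<lambda>\<xi>. (norm (fourier_L1
        g \<xi>))\<^sup>2"])
  have refl_norm: "L2_norm (\<lambda>x. fourier_L1 g (- x)) = L2_norm (fourier_L1 g)"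
    unfolding L2_norm_def by (simp add: integral_lborel_uminus[of "\<lambda>\<xi>. (norm (fourier_L1 g \<xi>))\<^sup>2"])
  have inv_fun: "inv_fourier g = (\<lambda>x. (1 / c) *\<^sub>R fourier_L1 g (- x))" by (rule ext) (rule inv_eq)
  show f2: "inv_fourier g \<in> L2_space"
    unfolding inv_fun by (rule L2_space_scaleR[OF refl])
  have "L2_norm (inv_fourier g) = 1 / c * (sqrt c * L2_norm g)"
    unfolding inv_fun L2_norm_scaleR[OF refl] refl_norm Plancherel[OF g] using c by (simp add: c_def)
  then show norm: "L2_norm g = sqrt ((2 * pi) ^ DIM('a)) * L2_norm (inv_fourier g)"
    unfolding c_def[symmetric] using c by (simp add: mult.assoc[symmetric])
  define f where "f = inv_fourier g"
  have f: "f \<in> L2_space" using f2 by (simp add: f_def)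
  have cg: "integrable lborel (\<lambda>x. cnj (g x))" using g by simp
  have Fcg: "fourier_L1 (\<lambda>x. cnj (g x)) x = complex_of_real c * cnj (f x)" for x
    unfolding fourier_L1_cnj f_def inv_eq using c by (simp add: scaleR_conv_of_real)
  have key: "(L2_norm (\<lambda>\<xi>. fourier_L1 (truncate R f) \<xi> - g \<xi>))\<^sup>2 = c * (L2_norm (\<lambda>x. truncate R f x
      - f x))\<^sup>2" for R
  proof -
    note tr = truncate_integrable[OF f, of R] truncate_L2[OF f, of R]
    have "(LINT \<xi>|lborel. fourier_L1 (truncate R f) \<xi> * cnj (g \<xi>))
        = (LINT x|lborel. complex_of_real c * (truncate R f x * cnj (f x)))"
      using multiplication_formula[OF tr(1) cg] by (simp only: Fcg mult.left_commute)
    then have "Re (LINT \<xi>|lborel. fourier_L1 (truncate R f) \<xi> * cnj (g \<xi>)) = c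
        * Re (LINT x|lborel. truncate R f x * cnj (f x))"
      by (simp only: integral_mult_right_zero Re_complex_of_real times_complex.sel Im_complex_of_real)
    moreover have "(L2_norm (fourier_L1 (truncate R f)))\<^sup>2 = c * (L2_norm (truncate R f))\<^sup>2"
      unfolding Plancherel[OF tr] c_def[symmetric] using c by (simp add: power_mult_distrib)
    moreover have "(L2_norm g)\<^sup>2 = c * (L2_norm f)\<^sup>2"
      unfolding norm f_def c_def[symmetric] using c by (simp add: power_mult_distrib)
    ultimately show ?thesis
      unfolding L2_inner_expand[OF fourier_L1_in_L2[OF tr] g(2)] L2_inner_expand[OF tr(2) f]
      by (simp add: algebra_simps)
  qed
  have "L2_norm (\<lambda>\<xi>. fourier_L1 (truncate R f) \<xi> - g \<xi>) = sqrt c * L2_norm (\<lambda>x. truncate R f x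
      - f x)" for R
    using arg_cong[OF key[of R], of sqrt] by (simp add: real_sqrt_mult)
  then show "has_fourier_L2 (inv_fourier g) g"
    unfolding has_fourier_L2_def f_def[symmetric]
    using f g tendsto_mult_right_zero[OF truncate_tendsto[OF f], of "sqrt c"] by simp
qed

lemma L2_norm_eq_0_of_le:
  fixes h :: "'a::euclidean_space \<Rightarrow> complex"
  assumes "h \<in> L2_space" "(b \<longlongrightarrow> 0) (at_top :: real filter)" "\<And>R. L2_norm h \<le> b R"
  shows "AE x in lborel. h x = 0"
proof -
  have "L2_norm h \<le> 0" using assms by (intro tendsto_lowerbound[OF assms(2)] always_eventually allI) auto
  then show ?thesis using L2_norm_nonneg[of h] by (intro L2_norm_eq_0_AE assms(1)) linarith
qed

lemma has_fourier_L2_unique: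
  fixes f :: "'a::euclidean_space \<Rightarrow> complex"
  assumes g: "has_fourier_L2 f g" and g': "has_fourier_L2 f g'"
  shows "AE \<xi> in lborel. g \<xi> = g' \<xi>"
proof -
  have L: "f \<in> L2_space" "g \<in> L2_space" "g' \<in> L2_space" using g g' by (auto simp: has_fourier_L2_def)
  define h where "h R = fourier_L1 (truncate R f)" for R
  have h: "h R \<in> L2_space" for R unfolding h_def by (intro fourier_L1_in_L2 truncate_integrable
      truncate_L2 L)
  have lim: "((\<lambda>R. L2_norm (\<lambda>\<xi>. h R \<xi> - g \<xi>) + L2_norm (\<lambda>\<xi>. h R \<xi> - g' \<xi>)) \<longlongrightarrow> 0 + 0) at_top"
    using g g' unfolding has_fourier_L2_def h_def by (intro tendsto_add) auto
  have le: "L2_norm (\<lambda>\<xi>. g \<xi> - g' \<xi>) \<le> L2_norm (\<lambda>\<xi>. h R \<xi> - g \<xi>) + L2_norm (\<lambda>\<xi>. h R \<xi> - g' \<xi>)" for R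
    using L2_norm_triangle[OF L2_space_diff[OF L(2) h] L2_space_diff[OF h L(3)], of R R]
      L2_norm_minus_commute[of g "h R"] by simp
  have "AE \<xi> in lborel. g \<xi> - g' \<xi> = 0"
    by (rule L2_norm_eq_0_of_le[OF L2_space_diff[OF L(2,3)]]) (use lim le in auto)
  then show ?thesis by simp
qed

lemma has_fourier_L2_inject:
  fixes f f' :: "'a::euclidean_space \<Rightarrow> complex"
  assumes g: "has_fourier_L2 f g" and g': "has_fourier_L2 f' g"
  shows "AE x in lborel. f x = f' x"
proof -
  have L: "f \<in> L2_space" "f' \<in> L2_space" "g \<in> L2_space" using g g' by (auto simp: has_fourier_L2_def)
  define c where "c = sqrt ((2 * pi) ^ DIM('a))"
  have c: "c > 0" by (simp add: c_def)
  define h where "h R = fourier_L1 (truncate R f)" for R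
  define h' where "h' R = fourier_L1 (truncate R f')" for R
  have h: "h R \<in> L2_space" "h' R \<in> L2_space" for R
    unfolding h_def h'_def by (intro fourier_L1_in_L2 truncate_integrable truncate_L2 L)+
  define b where "b R = L2_norm (\<lambda>x. truncate R f x - f x) + L2_norm (\<lambda>x. truncate R f' x - f' x)
    + (L2_norm (\<lambda>\<xi>. h R \<xi> - g \<xi>) + L2_norm (\<lambda>\<xi>. h' R \<xi> - g \<xi>)) / c" for R
  have "(b \<longlongrightarrow> 0 + 0 + (0 + 0) / c) at_top"
    using g g' c unfolding has_fourier_L2_def h_def h'_def b_def
    by (intro tendsto_intros truncate_tendsto L) auto
  then have lim: "(b \<longlongrightarrow> 0) at_top" by simp
  have le: "L2_norm (\<lambda>x. f x - f' x) \<le> b R" for R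
  proof -
    note tr = truncate_L2[OF L(1), of R] truncate_L2[OF L(2), of R]
      truncate_integrable[OF L(1), of R] truncate_integrable[OF L(2), of R]
    have "(\<lambda>\<xi>. h R \<xi> - h' R \<xi>) = fourier_L1 (\<lambda>x. truncate R f x - truncate R f' x)"
      unfolding h_def h'_def using tr by (intro ext fourier_L1_diff[symmetric])
    then have "c * L2_norm (\<lambda>x. truncate R f x - truncate R f' x) = L2_norm (\<lambda>\<xi>. h R \<xi> - h' R \<xi>)"
      using Plancherel[of "\<lambda>x. truncate R f x - truncate R f' x"] tr by (simp add: L2_space_diff c_def)
    also have "\<dots> \<le> L2_norm (\<lambda>\<xi>. h R \<xi> - g \<xi>) + L2_norm (\<lambda>\<xi>. h' R \<xi> - g \<xi>)"
      using L2_norm_triangle[OF L2_space_diff[OF h(1) L(3)] L2_space_diff[OF L(3) h(2)], of R R]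
        L2_norm_minus_commute[of g "h' R"] by simp
    finally have 1: "L2_norm (\<lambda>x. truncate R f x - truncate R f' x)
        \<le> (L2_norm (\<lambda>\<xi>. h R \<xi> - g \<xi>) + L2_norm (\<lambda>\<xi>. h' R \<xi> - g \<xi>)) / c"
      using c by (simp add: field_simps)
    have "L2_norm (\<lambda>x. f x - f' x) \<le> L2_norm (\<lambda>x. f x - truncate R f x)
        + L2_norm (\<lambda>x. truncate R f x - f' x)"
      using L2_norm_triangle[OF L2_space_diff[OF L(1) tr(1)] L2_space_diff[OF tr(1) L(2)]] by simp
    also have "L2_norm (\<lambda>x. truncate R f x - f' x) \<le> L2_norm (\<lambda>x. truncate R f x - truncate R f' x)
        + L2_norm (\<lambda>x. truncate R f' x - f' x)"
      using L2_norm_triangle[OF L2_space_diff[OF tr(1) tr(2)] L2_space_diff[OF tr(2) L(2)]] by simp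
    finally show ?thesis
      using 1 L2_norm_minus_commute[of f "truncate R f"] by (simp add: b_def)
  qed
  have "AE x in lborel. f x - f' x = 0"
    by (rule L2_norm_eq_0_of_le[OF L2_space_diff[OF L(1,2)] lim le])
  then show ?thesis by simp
qed

lemma fourier_L2_eq_fourier_L1:
  fixes f :: "'a::euclidean_space \<Rightarrow> complex"
  assumes f: "integrable lborel f" "f \<in> L2_space"
  shows "AE \<xi> in lborel. fourier_L2 f \<xi> = fourier_L1 f \<xi>" "fourier_L2 f \<in> L2_space"
proof -
  have *: "has_fourier_L2 f (fourier_L2 f)"
    unfolding fourier_L2_def by (rule someI[of _ "fourier_L1 f"]) (rule has_fourier_L2_fourier_L1[OF f])
  then show "fourier_L2 f \<in> L2_space" by (simp add: has_fourier_L2_def)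
  show "AE \<xi> in lborel. fourier_L2 f \<xi> = fourier_L1 f \<xi>"
    by (rule has_fourier_L2_unique[OF * has_fourier_L2_fourier_L1[OF f]])
qed

lemma fourier_inversion_AE:
  fixes f :: "'a::euclidean_space \<Rightarrow> complex"
  assumes f: "integrable lborel f" "f \<in> L2_space" "integrable lborel (fourier_L1 f)"
  shows "AE x in lborel. f x = inv_fourier (fourier_L1 f) x"
  by (rule has_fourier_L2_inject[OF has_fourier_L2_fourier_L1[OF f(1,2)]
        has_fourier_L2_inv_fourier[OF f(3) fourier_L1_in_L2[OF f(1,2)]]])

text \<open>The two choices in the definition of a multiplier, of a transform of \<open>f\<close> and of a function with the multiplied
transform, are both unique up to null sets, so the multiplier is represented by the inversion
integral.\<close>

lemma fourier_multiplier_eq: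
  fixes f :: "'a::euclidean_space \<Rightarrow> complex"
  assumes f: "integrable lborel f" "f \<in> L2_space" and m [measurable]: "m \<in> borel_measurable borel"
    and mf: "integrable lborel (\<lambda>\<xi>. m \<xi> * fourier_L1 f \<xi>)" "(\<lambda>\<xi>. m \<xi> * fourier_L1 f \<xi>) \<in> L2_space"
  shows "AE x in lborel. fourier_multiplier m f x = inv_fourier (\<lambda>\<xi>. m \<xi> * fourier_L1 f \<xi>) x"
    and "fourier_multiplier m f \<in> L2_space"
proof -
  define k where "k \<xi> = m \<xi> * fourier_L2 f \<xi>" for \<xi>
  note [measurable] = L2_spaceD(1)[OF fourier_L2_eq_fourier_L1(2)[OF f]] measurable_fourier_L1[OF f(1)]
  have AE: "AE \<xi> in lborel. k \<xi> = m \<xi> * fourier_L1 f \<xi>"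
    using fourier_L2_eq_fourier_L1(1)[OF f] by eventually_elim (simp add: k_def)
  have [measurable]: "k \<in> borel_measurable lborel" unfolding k_def[abs_def] by measurable
  have ki: "integrable lborel k"
    using mf(1) AE by (subst integrable_cong_AE[OF _ _ AE]) auto
  have k2: "k \<in> L2_space"
    by (rule L2_space_cong_AE[OF mf(2)]) (use AE in auto)
  have inv: "inv_fourier k = inv_fourier (\<lambda>\<xi>. m \<xi> * fourier_L1 f \<xi>)"
    unfolding inv_fourier_def[abs_def] using fourier_L1_cong_AE[OF AE] by simp
  have "has_fourier_L2 (fourier_multiplier m f) k"
    unfolding fourier_multiplier_def k_def[symmetric]
    by (rule someI[of _ "inv_fourier k"]) (rule has_fourier_L2_inv_fourier[OF ki k2])
  then show "AE x in lborel. fourier_multiplier m f x = inv_fourier (\<lambda>\<xi>. m \<xi> * fourier_L1 f \<xi>) x"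
      "fourier_multiplier m f \<in> L2_space"
    unfolding inv[symmetric] using has_fourier_L2_inject[OF _ has_fourier_L2_inv_fourier[OF ki k2]]
    by (auto simp: has_fourier_L2_def)
qed

section \<open>Weighted spaces\<close>

lemma integrable_lborel_inverse_1_plus_square: "integrable lborel (\<lambda>x::real. 1 / (1 + x\<^sup>2))"
  using integrable_inverse_1_plus_square by (simp add: set_integrable_def inverse_eq_divide)

text \<open>The exponent is the dimension, so that this weight is dominated by the product of the functions
\<open>1 / (1 + x\<^sup>2)\<close> of the coordinates.\<close>

definition decay :: "'a::euclidean_space \<Rightarrow> real" where
  "decay x = 1 / (1 + (norm x)\<^sup>2) ^ DIM('a)"

lemma decay_pos: "decay x > 0"
  by (simp add: decay_def add_pos_nonneg)

lemma decay_nonneg [simp]: "0 \<le> decay x"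
  using decay_pos[of x] by simp

lemma measurable_decay [measurable]: "decay \<in> borel_measurable borel"
  unfolding decay_def[abs_def] by measurable

lemma integrable_decay: "integrable lborel (decay :: 'a::euclidean_space \<Rightarrow> real)"
proof (rule Bochner_Integration.integrable_bound)
  show "integrable lborel (\<lambda>x::'a. \<Prod>b\<in>Basis. 1 / (1 + (x \<bullet> b)\<^sup>2))"
    by (rule integrable_lborel_prod) (rule integrable_lborel_inverse_1_plus_square)
  have le: "decay x \<le> (\<Prod>b\<in>Basis. 1 / (1 + (x \<bullet> b)\<^sup>2))" for x :: 'a
  proof -
    have "(\<Prod>b\<in>(Basis::'a set). 1 + (x \<bullet> b)\<^sup>2) \<le> (\<Prod>b\<in>(Basis::'a set). 1 + (norm x)\<^sup>2)"
      using Basis_le_norm[of _ x] by (intro prod_mono) (auto simp: abs_le_square_iff[symmetric])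
    moreover have "(\<Prod>b\<in>(Basis::'a set). 1 + (x \<bullet> b)\<^sup>2) > 0"
      by (intro prod_pos) (simp add: add_pos_nonneg)
    ultimately show ?thesis by (simp add: decay_def prod_dividef frac_le)
  qed
  then show "AE x in lborel. norm (decay x) \<le> norm (\<Prod>b\<in>Basis. 1 / (1 + ((x::'a) \<bullet> b)\<^sup>2))"
    by (auto intro!: AE_I2 order_trans[OF le abs_ge_self])
qed simp

text \<open>Cauchy-Schwarz with the weight \<open>decay\<close>. The exponent \<open>d + 1\<close> is the order of decay and of smoothness of the
solution; so this gives the integrability of \<open>(1 + |x|) u\<close> and, applied to the transform, that of the
transforms of \<open>u\<close> and of its first derivatives.\<close>

lemma
  fixes g :: "'a::euclidean_space \<Rightarrow> real"
  assumes g [measurable]: "g \<in> borel_measurable borel"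
    and int: "integrable lborel (\<lambda>x. (1 + (norm x)\<^sup>2) ^ (DIM('a) + 1) * (g x)\<^sup>2)"
  shows weighted_L1: "integrable lborel (\<lambda>x. (1 + norm x) * g x)"
    and weighted_L1_le: "(LINT x|lborel. (1 + norm x) * \<bar>g x\<bar>)
      \<le> sqrt (2 * integral\<^sup>L lborel (decay :: 'a \<Rightarrow> real))
        * sqrt (LINT x|lborel. (1 + (norm x)\<^sup>2) ^ (DIM('a) + 1) * (g x)\<^sup>2)"
proof -
  define D where "D x = sqrt (2 * decay x)" for x :: 'a
  define G where "G x = sqrt ((1 + (norm x)\<^sup>2) ^ (DIM('a) + 1)) * g x" for x
  have meas [measurable]: "D \<in> borel_measurable lborel" "G \<in> borel_measurable lborel"
    unfolding D_def[abs_def] G_def[abs_def] by measurable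
  have D2: "(D x)\<^sup>2 = 2 * decay x" for x by (simp add: D_def)
  have G2: "(G x)\<^sup>2 = (1 + (norm x)\<^sup>2) ^ (DIM('a) + 1) * (g x)\<^sup>2" for x
    by (simp add: G_def power_mult_distrib del: power_Suc)
  have le: "(1 + norm x) * \<bar>g x\<bar> \<le> \<bar>D x * G x\<bar>" for x
  proof -
    have "(1 + norm x)\<^sup>2 \<le> 2 * (1 + (norm x)\<^sup>2)"
      using sum_squares_bound[of 1 "norm x"] by (simp add: power2_sum)
    then have "1 + norm x \<le> sqrt (2 * (1 + (norm x)\<^sup>2))" by (rule real_le_rsqrt)
    also have "2 * (1 + (norm x)\<^sup>2) = 2 * decay x * (1 + (norm x)\<^sup>2) ^ (DIM('a) + 1)"
      using add_pos_nonneg[OF zero_less_one zero_le_power2[of "norm x"]] by (simp add: decay_def)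
    also have "sqrt \<dots> = D x * sqrt ((1 + (norm x)\<^sup>2) ^ (DIM('a) + 1))" by
        (simp only: D_def real_sqrt_mult)
    finally have "(1 + norm x) * \<bar>g x\<bar> \<le> D x * sqrt ((1 + (norm x)\<^sup>2) ^ (DIM('a) + 1)) * \<bar>g x\<bar>"
      by (rule mult_right_mono) simp
    then show ?thesis by (simp add: G_def abs_mult D_def mult.assoc del: power_Suc)
  qed
  have DG: "integrable lborel (\<lambda>x. D x * G x)"
    "(LINT x|lborel. \<bar>D x * G x\<bar>) \<le> sqrt (LINT x|lborel. (D x)\<^sup>2) * sqrt (LINT x|lborel. (G x)\<^sup>2)"
    by (rule Cauchy_Schwarz_integral; use int integrable_decay in \<open>simp add: D2 G2 del: power_Suc\<close>)+
  show "integrable lborel (\<lambda>x. (1 + norm x) * g x)"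
    by (rule Bochner_Integration.integrable_bound[OF DG(1)]) (use le in \<open>auto simp: abs_mult\<close>)
  then have "integrable lborel (\<lambda>x. (1 + norm x) * \<bar>g x\<bar>)"
    using integrable_abs by (fastforce simp: abs_mult)
  then have "(LINT x|lborel. (1 + norm x) * \<bar>g x\<bar>) \<le> (LINT x|lborel. \<bar>D x * G x\<bar>)"
    using DG(1) le by (intro integral_mono) auto
  also note DG(2)
  finally show "(LINT x|lborel. (1 + norm x) * \<bar>g x\<bar>)
      \<le> sqrt (2 * integral\<^sup>L lborel (decay :: 'a \<Rightarrow> real))
        * sqrt (LINT x|lborel. (1 + (norm x)\<^sup>2) ^ (DIM('a) + 1) * (g x)\<^sup>2)"
    by (simp add: D2 G2 del: power_Suc)
qed

lemma Z_spaceD: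
  fixes v :: "'a::euclidean_space \<Rightarrow> real"
  assumes "v \<in> Z_space s r"
  shows "v \<in> borel_measurable borel" "cplx v \<in> L2_space" "v \<in> L2_space"
    "(\<lambda>x. norm x powr r * v x) \<in> L2_space" "sobolev_weighted s (cplx v) \<in> L2_space"
proof -
  show c: "cplx v \<in> L2_space" and w: "(\<lambda>x. norm x powr r * v x) \<in> L2_space"
    "sobolev_weighted s (cplx v) \<in> L2_space"
    using assms by (auto simp: Z_space_def sobolev_space_def)
  have "(\<lambda>x. Re (cplx v x)) \<in> borel_measurable lborel" using L2_spaceD(1)[OF c] by measurable
  then show m: "v \<in> borel_measurable borel" by simp
  show "v \<in> L2_space" using L2_spaceD(2)[OF c] m by (intro L2_spaceI) auto
qed

lemma Z_space_weight:
  fixes v :: "'a::euclidean_space \<Rightarrow> real"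
  assumes v: "v \<in> Z_space s (real DIM('a) + 1)"
  shows "integrable lborel (\<lambda>x. (1 + (norm x)\<^sup>2) ^ (DIM('a) + 1) * (v x)\<^sup>2)"
proof -
  define d where "d = DIM('a)"
  note Z = Z_spaceD[OF v]
  note [measurable] = Z(1)
  have powr: "(norm x powr (real d + 1))\<^sup>2 = (norm x)\<^sup>2 ^ (d + 1)" for x :: 'a
  proof (cases "x = 0")
    case False
    then have "norm x powr (real d + 1) = norm x ^ (d + 1)"
      using powr_realpow[of "norm x" "d + 1"] by (simp add: add.commute)
    then show ?thesis by (simp only: power_mult[symmetric] mult.commute)
  qed simp
  have int: "integrable lborel (\<lambda>x. 2 ^ (d + 1) * ((v x)\<^sup>2 + (norm x powr (real d + 1) * v x)\<^sup>2))"
    using L2_spaceD(2)[OF Z(3)] L2_spaceD(2)[OF Z(4)] by (simp add: d_def)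
  have le: "(1 + (norm x)\<^sup>2) ^ (d + 1) * (v x)\<^sup>2 \<le> 2 ^ (d + 1) * ((v x)\<^sup>2 + (norm x powr (real d
      + 1) * v x)\<^sup>2)" for x
  proof -
    have "(1 + (norm x)\<^sup>2) ^ (d + 1) \<le> (2 * max 1 ((norm x)\<^sup>2)) ^ (d + 1)"
      by (intro power_mono) auto
    also have "\<dots> \<le> 2 ^ (d + 1) * (1 + (norm x)\<^sup>2 ^ (d + 1))"
      unfolding power_mult_distrib by (intro mult_left_mono) (auto simp: max_def simp del: power_Suc)
    finally have "(1 + (norm x)\<^sup>2) ^ (d + 1) * (v x)\<^sup>2 \<le> 2 ^ (d + 1) * (1 + (norm x)\<^sup>2 ^ (d + 1))
        * (v x)\<^sup>2"
      by (rule mult_right_mono) simp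
    then show ?thesis unfolding power_mult_distrib[of "norm x powr _"] powr by (simp add: algebra_simps)
  qed
  show ?thesis unfolding d_def[symmetric]
    by (rule Bochner_Integration.integrable_bound[OF int])
       (use le in \<open>auto intro!: AE_I2 order_trans[OF le] simp del: power_Suc\<close>)
qed

lemma Z_space_L1:
  fixes v :: "'a::euclidean_space \<Rightarrow> real"
  assumes v: "v \<in> Z_space s (real DIM('a) + 1)"
  shows "integrable lborel (\<lambda>x. (1 + norm x) * v x)" "integrable lborel v" "integrable lborel (cplx v)"
proof -
  note [measurable] = Z_spaceD(1)[OF v]
  show 1: "integrable lborel (\<lambda>x. (1 + norm x) * v x)"
    by (rule weighted_L1[OF _ Z_space_weight[OF v]]) measurable
  show "integrable lborel v"
    by (rule Bochner_Integration.integrable_bound[OF 1]) (auto simp: abs_mult mult_le_cancel_right1)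
  then show "integrable lborel (cplx v)" by simp
qed

lemma
  fixes v :: "'a::euclidean_space \<Rightarrow> real"
  assumes v: "v \<in> Z_space (real DIM('a) + 1) (real DIM('a) + 1)"
  shows Z_space_fourier_L1: "integrable lborel (\<lambda>\<xi>. (1 + norm \<xi>) * norm (fourier_L1 (cplx v) \<xi>))"
    and Z_space_fourier_L1_le: "(LINT \<xi>|lborel. (1 + norm \<xi>) * norm (fourier_L1 (cplx v) \<xi>))
      \<le> sqrt (2 * integral\<^sup>L lborel (decay :: 'a \<Rightarrow> real)) * sobolev_norm (real DIM('a) + 1) (cplx v)"
    and Z_space_fourier_weight: "integrable lborel (\<lambda>\<xi>. (1 + (norm \<xi>)\<^sup>2) ^ (DIM('a) + 1)
        * (norm (fourier_L1 (cplx v) \<xi>))\<^sup>2)"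
    and sobolev_norm_ge: "L2_norm (fourier_L1 (cplx v)) \<le> sobolev_norm (real DIM('a) + 1) (cplx v)"
proof -
  note Z = Z_spaceD[OF v]
  note L1 = Z_space_L1(3)[OF v]
  note [measurable] = Z(1) measurable_fourier_L1[OF L1]
  note F = fourier_L2_eq_fourier_L1[OF L1 Z(2)]
  note S = L2_spaceD[OF Z(5)]
  have powr: "((1 + (norm \<xi>)\<^sup>2) powr ((real DIM('a) + 1) / 2))\<^sup>2 = (1 + (norm \<xi>)\<^sup>2) ^ (DIM('a)
      + 1)" for \<xi> :: 'a
  proof -
    have p: "1 + (norm \<xi>)\<^sup>2 > 0" by (simp add: add_pos_nonneg)
    have "((1 + (norm \<xi>)\<^sup>2) powr ((real DIM('a) + 1) / 2))\<^sup>2 = (1 + (norm \<xi>)\<^sup>2) powr (real (DIM('a)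
        + 1))"
      unfolding power2_eq_square[of "_ powr _"] powr_add[symmetric] field_sum_of_halves by
          (simp add: add.commute)
    then show ?thesis using powr_realpow[OF p, of "DIM('a) + 1"] by simp
  qed
  have AE: "AE \<xi> in lborel. (norm (sobolev_weighted (real DIM('a) + 1) (cplx v) \<xi>))\<^sup>2
      = (1 + (norm \<xi>)\<^sup>2) ^ (DIM('a) + 1) * (norm (fourier_L1 (cplx v) \<xi>))\<^sup>2"
    using F(1) by eventually_elim (simp only: sobolev_weighted_def norm_scaleR power_mult_distrib
        power2_abs powr)
  show int: "integrable lborel (\<lambda>\<xi>. (1 + (norm \<xi>)\<^sup>2) ^ (DIM('a) + 1) * (norm (fourier_L1 (cplx v) \<xi>))\<^sup>2)"
    using S AE by (subst integrable_cong_AE[OF _ _ AE_symmetric[OF AE]]) (auto simp del: power_Suc)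
  have eq: "sqrt (LINT \<xi>|lborel. (1 + (norm \<xi>)\<^sup>2) ^ (DIM('a) + 1) * (norm (fourier_L1 (cplx v) \<xi>))\<^sup>2)
      = sobolev_norm (real DIM('a) + 1) (cplx v)"
    unfolding sobolev_norm_def L2_norm_def
  proof (intro arg_cong[where f = sqrt] integral_cong_AE)
    show "(\<lambda>\<xi>. (norm (sobolev_weighted (real DIM('a) + 1) (cplx v) \<xi>))\<^sup>2) \<in> borel_measurable lborel"
      using S by measurable
  qed (measurable, rule AE_symmetric[OF AE])
  show "integrable lborel (\<lambda>\<xi>. (1 + norm \<xi>) * norm (fourier_L1 (cplx v) \<xi>))"
    by (rule weighted_L1[OF _ int]) measurable
  show "(LINT \<xi>|lborel. (1 + norm \<xi>) * norm (fourier_L1 (cplx v) \<xi>))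
      \<le> sqrt (2 * integral\<^sup>L lborel (decay :: 'a \<Rightarrow> real)) * sobolev_norm (real DIM('a) + 1) (cplx v)"
    unfolding eq[symmetric] using weighted_L1_le[OF _ int] by simp
  show "L2_norm (fourier_L1 (cplx v)) \<le> sobolev_norm (real DIM('a) + 1) (cplx v)"
    unfolding eq[symmetric] L2_norm_def
  proof (intro real_sqrt_le_mono integral_mono int)
    show "integrable lborel (\<lambda>\<xi>. (norm (fourier_L1 (cplx v) \<xi>))\<^sup>2)"
      using fourier_L1_in_L2[OF L1 Z(2)] by (simp add: L2_space_def)
    fix \<xi> :: 'a
    have "1 \<le> (1 + (norm \<xi>)\<^sup>2) ^ (DIM('a) + 1)" by (rule one_le_power) simp
    then show "(norm (fourier_L1 (cplx v) \<xi>))\<^sup>2 \<le> (1 + (norm \<xi>)\<^sup>2) ^ (DIM('a) + 1)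
        * (norm (fourier_L1 (cplx v) \<xi>))\<^sup>2"
      using mult_right_mono[of 1 "(1 + (norm \<xi>)\<^sup>2) ^ (DIM('a)
          + 1)" "(norm (fourier_L1 (cplx v) \<xi>))\<^sup>2"] by simp
  qed
qed

lemma L2_norm_le_sobolev_norm:
  fixes v :: "'a::euclidean_space \<Rightarrow> real"
  assumes v: "v \<in> Z_space (real DIM('a) + 1) (real DIM('a) + 1)"
  shows "sqrt ((2 * pi) ^ DIM('a)) * L2_norm v \<le> sobolev_norm (real DIM('a) + 1) (cplx v)"
proof -
  have "L2_norm (cplx v) = L2_norm v" by (simp add: L2_norm_def)
  then show ?thesis
    using Plancherel[OF Z_space_L1(3)[OF v] Z_spaceD(2)[OF v]] sobolev_norm_ge[OF v] by simp
qed

section \<open>The nonlinear term\<close>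

lemma norm_inv_fourier_le:
  "norm (inv_fourier g x) \<le> (LINT \<xi>|lborel. norm (g \<xi>)) / (2
      * pi) ^ DIM('a)" for x :: "'a::euclidean_space"
  unfolding inv_fourier_def by (simp add: norm_divide norm_mult norm_power divide_right_mono
      norm_fourier_L1_le)

lemma continuous_inv_fourier:
  fixes g :: "'a::euclidean_space \<Rightarrow> complex"
  assumes "integrable lborel g"
  shows "continuous_on UNIV (inv_fourier g)"
  unfolding inv_fourier_def
  by (intro continuous_intros continuous_on_compose2[OF continuous_fourier_L1[OF assms, of UNIV]]) auto

lemma integrable_mult_inv_fourier:
  fixes f h :: "'a::euclidean_space \<Rightarrow> complex"
  assumes f: "integrable lborel f" and h: "integrable lborel h"
  shows "integrable lborel (\<lambda>x. f x * inv_fourier h x)"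
proof (rule Bochner_Integration.integrable_bound)
  define B where "B = (LINT \<xi>|lborel. norm (h \<xi>)) / (2 * pi) ^ DIM('a)"
  have B: "norm (inv_fourier h x) \<le> B" for x unfolding B_def by (rule norm_inv_fourier_le)
  have B0: "B \<ge> 0" by (simp add: B_def)
  show "integrable lborel (\<lambda>x. B * norm (f x))" using f by simp
  show "AE x in lborel. norm (f x * inv_fourier h x) \<le> norm (B * norm (f x))"
    using B B0 by (intro AE_I2) (simp add: norm_mult abs_mult mult.commute[of B] mult_left_mono)
  show "(\<lambda>x. f x * inv_fourier h x) \<in> borel_measurable lborel"
    using borel_measurable_integrable[OF f] borel_measurable_continuous_onI[OF
        continuous_inv_fourier[OF h]]
    by measurable
qed

text \<open>The transform of a product is the convolution of the transforms. If one factor is an inversion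
integral, this is the multiplication formula.\<close>

lemma fourier_mult_inv_fourier:
  fixes f h :: "'a::euclidean_space \<Rightarrow> complex"
  assumes f: "integrable lborel f" and h: "integrable lborel h"
  shows "fourier_L1 (\<lambda>x. f x * inv_fourier h x) \<xi>
    = (LINT \<eta>|lborel. h \<eta> * fourier_L1 f (\<xi> - \<eta>)) / complex_of_real ((2 * pi) ^ DIM('a))"
proof -
  define c where "c = complex_of_real ((2 * pi) ^ DIM('a))"
  define p where "p x = iexp_conj (x \<bullet> \<xi>) * f x" for x
  have p: "integrable lborel p" unfolding p_def[abs_def] by (rule integrable_fourier_kernel[OF f])
  note [measurable] = borel_measurable_integrable[OF p] measurable_fourier_L1[OF h]
  have pr: "integrable lborel (\<lambda>x. p (- x))"
    using p by (subst integrable_lborel_uminus) auto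
  have Fpr: "fourier_L1 (\<lambda>x. p (- x)) \<eta> = fourier_L1 f (\<xi> - \<eta>)" for \<eta>
  proof -
    have "iexp_conj (x \<bullet> (- \<eta>)) * iexp_conj (x \<bullet> \<xi>)
        = iexp_conj (x \<bullet> (\<xi> - \<eta>))" for x
      unfolding mult_exp_exp by (simp add: inner_diff_right algebra_simps)
    then have "fourier_L1 p (- \<eta>) = fourier_L1 f (\<xi> - \<eta>)"
      unfolding fourier_L1_def p_def by (simp only: mult.assoc[symmetric])
    then show ?thesis using fourier_L1_reflect[of p \<eta>] by simp
  qed
  have "fourier_L1 (\<lambda>x. f x * inv_fourier h x) \<xi> = (LINT x|lborel. p x * fourier_L1 h (- x)) / c"
    unfolding inv_fourier_def c_def[symmetric] p_def integral_divide_zero[symmetric]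
    by (subst fourier_L1_def[of "\<lambda>x. f x * (fourier_L1 h (- x) / c)"]) (simp add: mult.assoc)
  also have "(LINT x|lborel. p x * fourier_L1 h (- x)) = (LINT x|lborel. p (- x) * fourier_L1 h x)"
    using integral_lborel_uminus[of "\<lambda>x. p x * fourier_L1 h (- x)"] by simp
  also have "\<dots> = (LINT \<eta>|lborel. fourier_L1 (\<lambda>x. p (- x)) \<eta> * h \<eta>)"
    by (rule multiplication_formula[OF pr h, symmetric])
  finally show ?thesis by (simp add: Fpr c_def mult.commute)
qed

lemma convolution_integrable:
  fixes h k :: "'a::euclidean_space \<Rightarrow> complex"
  assumes h: "integrable lborel h" and k: "integrable lborel k"
  shows "integrable lborel (\<lambda>\<xi>. LINT \<eta>|lborel. h \<eta> * k (\<xi> - \<eta>))"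
proof (rule integrableI_bounded)
  note [measurable] = borel_measurable_integrable[OF h] borel_measurable_integrable[OF k]
  have meas: "(\<lambda>p. h (snd p) * k (fst p - snd p)) \<in> borel_measurable (lborel \<Otimes>\<^sub>M lborel)" by measurable
  show "(\<lambda>\<xi>. LINT \<eta>|lborel. h \<eta> * k (\<xi> - \<eta>)) \<in> borel_measurable lborel" by measurable
  have "(\<integral>\<^sup>+\<xi>. ennreal (norm (LINT \<eta>|lborel. h \<eta> * k (\<xi> - \<eta>))) \<partial>lborel)
      \<le> (\<integral>\<^sup>+\<xi>. \<integral>\<^sup>+\<eta>. ennreal (norm (h \<eta>)) * ennreal (norm (k (\<xi> - \<eta>))) \<partial>lborel \<partial>lborel)"
    by (intro nn_integral_mono order_trans[OF norm_integral_le_nn_integral])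
        (simp add: norm_mult ennreal_mult')
  also have "\<dots> = (\<integral>\<^sup>+\<eta>. \<integral>\<^sup>+\<xi>. ennreal (norm (h \<eta>)) * ennreal (norm (k (\<xi> - \<eta>))) \<partial>lborel \<partial>lborel)"
    by (rule lborel_pair.Fubini') measurable
  also have "\<dots> = (\<integral>\<^sup>+\<eta>. ennreal (norm (h \<eta>)) * (\<integral>\<^sup>+\<xi>. ennreal (norm (k \<xi>)) \<partial>lborel) \<partial>lborel)"
  proof (rule nn_integral_cong)
    fix \<eta>
    have "(\<integral>\<^sup>+\<xi>. ennreal (norm (k (\<xi> - \<eta>))) \<partial>lborel) = (\<integral>\<^sup>+\<xi>. ennreal (norm (k \<xi>)) \<partial>lborel)"
      using nn_integral_lborel_translate[of "\<lambda>\<xi>. ennreal (norm (k \<xi>))" "- \<eta>"] by simp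
    then show "(\<integral>\<^sup>+\<xi>. ennreal (norm (h \<eta>)) * ennreal (norm (k (\<xi> - \<eta>))) \<partial>lborel)
        = ennreal (norm (h \<eta>)) * (\<integral>\<^sup>+\<xi>. ennreal (norm (k \<xi>)) \<partial>lborel)"
      by (simp add: nn_integral_cmult)
  qed
  also have "\<dots> = (\<integral>\<^sup>+\<eta>. ennreal (norm (h \<eta>)) \<partial>lborel) * (\<integral>\<^sup>+\<xi>. ennreal (norm (k \<xi>)) \<partial>lborel)"
    by (rule nn_integral_multc) measurable
  also have "\<dots> < \<infinity>"
    using h k by (simp add: ennreal_mult_less_top integrable_iff_bounded)
  finally show "(\<integral>\<^sup>+\<xi>. ennreal (norm (LINT \<eta>|lborel. h \<eta> * k (\<xi> - \<eta>))) \<partial>lborel) < \<infinity>" .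
qed

text \<open>The unit vector \<open>e\<close> is the direction of the derivative.\<close>

locale Z_function =
  fixes v :: "'a::euclidean_space \<Rightarrow> real" and e :: 'a
  assumes v: "v \<in> Z_space (real DIM('a) + 1) (real DIM('a) + 1)"
    and e: "norm e = 1"
begin

definition "v_hat = fourier_L1 (cplx v)"
definition "dv_hat \<xi> = (\<i> * complex_of_real (\<xi> \<bullet> e)) * v_hat \<xi>"

lemma v_hat_integrable: "integrable lborel v_hat"
  and dv_hat_integrable: "integrable lborel dv_hat"
  and dv_hat_norm_le: "(LINT \<xi>|lborel. norm (dv_hat \<xi>)) \<le> (LINT \<xi>|lborel. (1 + norm \<xi>)
      * norm (fourier_L1 (cplx v) \<xi>))"
proof -
  note W = Z_space_fourier_L1[OF v]
  note [measurable] = measurable_fourier_L1[OF Z_space_L1(3)[OF v]]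
  have [measurable]: "v_hat \<in> borel_measurable borel" unfolding v_hat_def by measurable
  show "integrable lborel v_hat"
    by (rule Bochner_Integration.integrable_bound[OF W]) (auto simp: v_hat_def mult_le_cancel_right1)
  have [measurable]: "dv_hat \<in> borel_measurable borel" unfolding dv_hat_def[abs_def] by measurable
  have le: "norm (dv_hat \<xi>) \<le> (1 + norm \<xi>) * norm (fourier_L1 (cplx v) \<xi>)" for \<xi>
  proof -
    have "\<bar>\<xi> \<bullet> e\<bar> \<le> 1 + norm \<xi>" using Cauchy_Schwarz_ineq2[of \<xi> e] e by simp
    then show ?thesis by (simp add: dv_hat_def v_hat_def norm_mult mult_right_mono)
  qed
  show i: "integrable lborel dv_hat"
    by (rule Bochner_Integration.integrable_bound[OF W]) (use le in auto)
  show "(LINT \<xi>|lborel. norm (dv_hat \<xi>)) \<le> (LINT \<xi>|lborel. (1 + norm \<xi>) * norm (fourier_L1 (cplx v) \<xi>))"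
    using i W le by (intro integral_mono) auto
qed

lemma v_inversion: "AE x in lborel. cplx v x = inv_fourier v_hat x"
  unfolding v_hat_def by (rule fourier_inversion_AE[OF Z_space_L1(3)[OF v] Z_spaceD(2)[OF v]]) (rule
      v_hat_integrable[unfolded v_hat_def])

lemma dv_hat_L2: "dv_hat \<in> L2_space"
proof (rule L2_spaceI)
  note [measurable] = measurable_fourier_L1[OF Z_space_L1(3)[OF v]]
  show [measurable]: "dv_hat \<in> borel_measurable lborel" using dv_hat_integrable
      by (rule borel_measurable_integrable)
  have le: "(norm (dv_hat \<xi>))\<^sup>2 \<le> (1 + (norm \<xi>)\<^sup>2) ^ (DIM('a) + 1)
      * (norm (fourier_L1 (cplx v) \<xi>))\<^sup>2" for \<xi>
  proof -
    have "\<bar>\<xi> \<bullet> e\<bar> \<le> norm \<xi>" using Cauchy_Schwarz_ineq2[of \<xi> e] e by simp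
    then have "(\<xi> \<bullet> e)\<^sup>2 \<le> (norm \<xi>)\<^sup>2" by (simp add: abs_le_square_iff[symmetric])
    also have "\<dots> \<le> (1 + (norm \<xi>)\<^sup>2) ^ 1" by simp
    also have "\<dots> \<le> (1 + (norm \<xi>)\<^sup>2) ^ (DIM('a) + 1)" by (rule power_increasing) auto
    finally show ?thesis by (simp add: dv_hat_def v_hat_def norm_mult power_mult_distrib
        mult_right_mono del: power_Suc)
  qed
  show "integrable lborel (\<lambda>\<xi>. (norm (dv_hat \<xi>))\<^sup>2)"
    by (rule Bochner_Integration.integrable_bound[OF Z_space_fourier_weight[OF v]])
       (auto intro!: AE_I2 order_trans[OF le] simp del: power_Suc)
qed

end

text \<open>Any representative \<open>DU\<close> of the derivative of \<open>v\<close> in the direction \<open>e\<close>.\<close>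

locale Z_product = Z_function v e for v :: "'a::euclidean_space \<Rightarrow> real" and e :: 'a +
  fixes DU :: "'a \<Rightarrow> complex"
  assumes DU: "AE x in lborel. DU x = inv_fourier dv_hat x"
    and DU_meas: "DU \<in> borel_measurable lborel"
begin

lemma product_AE: "AE x in lborel. cplx v x * DU x = cplx v x * inv_fourier dv_hat x"
  using DU by eventually_elim simp

lemma product_meas [measurable]: "(\<lambda>x. cplx v x * DU x) \<in> borel_measurable lborel"
  using DU_meas Z_spaceD(1)[OF v] by measurable

lemma product_integrable: "integrable lborel (\<lambda>x. cplx v x * DU x)"
proof -
  have "integrable lborel (\<lambda>x. cplx v x * inv_fourier dv_hat x)"
    by (rule integrable_mult_inv_fourier[OF Z_space_L1(3)[OF v] dv_hat_integrable])
  then show ?thesis by (subst integrable_cong_AE[OF _ _ product_AE]) auto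
qed

text \<open>As the transform of the derivative is integrable, the derivative is bounded, and the product inherits square
integrability from \<open>v\<close>. The bound is linear in the \<open>L\<^sup>2\<close> norm of \<open>v\<close>, as a Gronwall argument requires.\<close>

lemma product_L2: "(\<lambda>x. cplx v x * DU x) \<in> L2_space"
  and product_L2_norm: "L2_norm (\<lambda>x. cplx v x * DU x)
    \<le> (LINT \<xi>|lborel. (1 + norm \<xi>) * norm (fourier_L1 (cplx v) \<xi>)) / (2 * pi) ^ DIM('a) * L2_norm v"
proof -
  define B where "B = (LINT \<xi>|lborel. (1 + norm \<xi>) * norm (fourier_L1 (cplx v) \<xi>)) / (2 * pi) ^ DIM('a)"
  have B: "B \<ge> 0" by (simp add: B_def)
  have le: "AE x in lborel. norm (cplx v x * DU x) \<le> norm (B *\<^sub>R v x)"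
    using product_AE
  proof eventually_elim
    case (elim x)
    have "norm (inv_fourier dv_hat x) \<le> B"
      unfolding B_def by (rule order_trans[OF norm_inv_fourier_le divide_right_mono[OF
          dv_hat_norm_le]]) simp
    then show ?case unfolding elim using B by (simp add: norm_mult abs_mult mult.commute[of B]
        mult_left_mono)
  qed
  note bd = L2_space_bound[OF L2_space_scaleR[OF Z_spaceD(3)[OF v], of B] product_meas le]
  show "(\<lambda>x. cplx v x * DU x) \<in> L2_space" by (rule bd(1))
  show "L2_norm (\<lambda>x. cplx v x * DU x)
    \<le> (LINT \<xi>|lborel. (1 + norm \<xi>) * norm (fourier_L1 (cplx v) \<xi>)) / (2 * pi) ^ DIM('a) * L2_norm v"
    using bd(2) B unfolding L2_norm_scaleR[OF Z_spaceD(3)[OF v]] B_def[symmetric] by simp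
qed

lemma fourier_product_conv:
  "fourier_L1 (\<lambda>x. cplx v x * DU x) \<xi> = (LINT \<eta>|lborel. dv_hat \<eta> * v_hat (\<xi>
      - \<eta>)) / complex_of_real ((2 * pi) ^ DIM('a))"
proof -
  have i: "integrable lborel (\<lambda>x. cplx v x * inv_fourier dv_hat x)"
    by (rule integrable_mult_inv_fourier[OF Z_space_L1(3)[OF v] dv_hat_integrable])
  have "fourier_L1 (\<lambda>x. cplx v x * DU x) = fourier_L1 (\<lambda>x. cplx v x * inv_fourier dv_hat x)"
    by (rule fourier_L1_cong_AE[OF product_AE]) (use i in auto)
  then show ?thesis
    using fourier_mult_inv_fourier[OF Z_space_L1(3)[OF v] dv_hat_integrable, of \<xi>] by
        (simp add: v_hat_def)
qed

lemma fourier_product_integrable: "integrable lborel (fourier_L1 (\<lambda>x. cplx v x * DU x))"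
proof -
  have "integrable lborel (\<lambda>\<xi>. (LINT \<eta>|lborel. dv_hat \<eta> * v_hat (\<xi> - \<eta>)) / complex_of_real ((2
      * pi) ^ DIM('a)))"
    using convolution_integrable[OF dv_hat_integrable v_hat_integrable] by (rule integrable_divide_zero)
  then show ?thesis by (simp only: fourier_product_conv[abs_def, symmetric])
qed

text \<open>The product rule \<open>v \<partial>v = \<partial>(v\<^sup>2)/2\<close> on the side of the transforms: in the convolution of \<open>\<i> \<eta>\<^sub>e v_hat(\<eta>)\<close> with \<open>v_hat\<close>,
the substitution \<open>\<eta> \<mapsto> \<xi> - \<eta>\<close> exchanges the factors, and the mean of the two forms has the factor
\<open>\<i> \<xi>\<^sub>e/2\<close> in place of \<open>\<i> \<eta>\<^sub>e\<close>.\<close>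

lemma fourier_product:
  "fourier_L1 (\<lambda>x. cplx v x * DU x) \<xi>
    = \<i> * complex_of_real ((\<xi> \<bullet> e) / 2) * fourier_L1 (\<lambda>x. complex_of_real ((v x)\<^sup>2)) \<xi>"
proof -
  define c where "c = complex_of_real ((2 * pi) ^ DIM('a))"
  note [measurable] = borel_measurable_integrable[OF v_hat_integrable]
      borel_measurable_integrable[OF dv_hat_integrable]
  have v_hat_bound: "norm (v_hat \<eta>) \<le> (LINT x|lborel. norm (cplx v x))" for \<eta> unfolding v_hat_def
      by (rule norm_fourier_L1_le)
  have i1: "integrable lborel (\<lambda>\<eta>. dv_hat \<eta> * v_hat (\<xi> - \<eta>))"
  proof (rule Bochner_Integration.integrable_bound)
    show "integrable lborel (\<lambda>\<eta>. (LINT x|lborel. norm (cplx v x)) * norm (dv_hat \<eta>))"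
        using dv_hat_integrable by simp
    show "AE \<eta> in lborel. norm (dv_hat \<eta> * v_hat (\<xi> - \<eta>)) \<le> norm ((LINT x|lborel. norm (cplx v x))
        * norm (dv_hat \<eta>))"
      using v_hat_bound by (intro AE_I2) (simp add: norm_mult abs_mult mult.commute mult_left_mono)
  qed measurable
  have i2: "integrable lborel (\<lambda>\<eta>. dv_hat (\<xi> - \<eta>) * v_hat \<eta>)"
    using integrable_lborel_affine_iff[of "\<lambda>\<eta>. dv_hat \<eta> * v_hat (\<xi> - \<eta>)" "-1" \<xi>] i1 by simp
  have sw: "(LINT \<eta>|lborel. dv_hat (\<xi> - \<eta>) * v_hat \<eta>) = (LINT \<eta>|lborel. dv_hat \<eta> * v_hat (\<xi> - \<eta>))"
    using integral_lborel_affine[of "\<lambda>\<eta>. dv_hat \<eta> * v_hat (\<xi> - \<eta>)" "-1" \<xi>] by simp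
  have "AE x in lborel. complex_of_real ((v x)\<^sup>2) = cplx v x * inv_fourier v_hat x"
    using v_inversion by eventually_elim (simp add: power2_eq_square)
  then have "fourier_L1 (\<lambda>x. complex_of_real ((v x)\<^sup>2)) = fourier_L1 (\<lambda>x. cplx v x
      * inv_fourier v_hat x)"
    by (rule fourier_L1_cong_AE)
       (use Z_spaceD(1)[OF v] integrable_mult_inv_fourier[OF Z_space_L1(3)[OF v] v_hat_integrable]
           in auto)
  then have sq: "fourier_L1 (\<lambda>x. complex_of_real ((v x)\<^sup>2)) \<xi> = (LINT \<eta>|lborel. v_hat \<eta> * v_hat (\<xi>
      - \<eta>)) / c"
    using fourier_mult_inv_fourier[OF Z_space_L1(3)[OF v] v_hat_integrable, of \<xi>] by
        (simp add: v_hat_def c_def)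
  have "2 * (LINT \<eta>|lborel. dv_hat \<eta> * v_hat (\<xi> - \<eta>)) = (LINT \<eta>|lborel. dv_hat \<eta> * v_hat (\<xi> - \<eta>)
      + dv_hat (\<xi> - \<eta>) * v_hat \<eta>)"
    using i1 i2 sw by simp
  also have "\<dots> = (LINT \<eta>|lborel. (\<i> * complex_of_real (\<xi> \<bullet> e)) * (v_hat \<eta> * v_hat (\<xi> - \<eta>)))"
    by (intro Bochner_Integration.integral_cong) (simp_all add: dv_hat_def inner_diff_left algebra_simps)
  also have "\<dots> = (\<i> * complex_of_real (\<xi> \<bullet> e)) * (LINT \<eta>|lborel. v_hat \<eta> * v_hat (\<xi> - \<eta>))"
    by (rule integral_mult_right_zero)
  finally have "(LINT \<eta>|lborel. dv_hat \<eta> * v_hat (\<xi> - \<eta>)) = \<i> * complex_of_real ((\<xi> \<bullet> e) / 2)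
      * (LINT \<eta>|lborel. v_hat \<eta> * v_hat (\<xi> - \<eta>))"
    by (simp add: mult.commute[of _ 2])
  then show ?thesis unfolding fourier_product_conv sq c_def by (simp only: times_divide_eq_right)
qed

end

section \<open>Differences, Riemann sums and the continuity of squares\<close>

lemma continuous_AE_eq:
  fixes f g :: "'a::euclidean_space \<Rightarrow> complex"
  assumes f: "continuous_on UNIV f" and g: "continuous_on UNIV g" and AE: "AE x in lborel. f x = g x"
  shows "f = g"
proof -
  have op: "open {x. f x \<noteq> g x}"
    using open_Collect_neq[OF f g] .
  then have [measurable]: "{x. f x \<noteq> g x} \<in> sets borel" by (rule borel_open)
  have "emeasure lborel {x. f x \<noteq> g x} = 0"
    using AE by (subst (asm) AE_iff_measurable[of "{x. f x \<noteq> g x}"]) auto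
  then have "negligible {x. f x \<noteq> g x}"
    by (auto simp: negligible_iff_null_sets null_sets_completionI null_setsI)
  then show ?thesis using open_not_negligible[OF op] by auto
qed

lemma Z_space_diff:
  fixes v w :: "'a::euclidean_space \<Rightarrow> real"
  assumes v: "v \<in> Z_space (real DIM('a) + 1) (real DIM('a) + 1)" and w: "w \<in> Z_space (real DIM('a)
      + 1) (real DIM('a) + 1)"
  shows "(\<lambda>x. v x - w x) \<in> Z_space (real DIM('a) + 1) (real DIM('a) + 1)"
proof -
  note Zv = Z_spaceD[OF v] and Zw = Z_spaceD[OF w]
  note Lv = Z_space_L1(3)[OF v] and Lw = Z_space_L1(3)[OF w]
  let ?r = "real DIM('a) + 1"
  let ?d = "\<lambda>x. v x - w x"
  have d_eq: "cplx ?d = (\<lambda>x. cplx v x - cplx w x)" by auto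
  have d2: "cplx ?d \<in> L2_space" unfolding d_eq by (rule L2_space_diff[OF Zv(2) Zw(2)])
  have d1: "integrable lborel (cplx ?d)" unfolding d_eq using Lv Lw by simp
  note F = fourier_L2_eq_fourier_L1[OF d1 d2]
  have Fd: "fourier_L1 (cplx ?d) \<xi> = fourier_L1 (cplx v) \<xi> - fourier_L1 (cplx w) \<xi>" for \<xi>
    unfolding d_eq by (rule fourier_L1_diff[OF Lv Lw])
  have AE: "AE \<xi> in lborel. norm (sobolev_weighted ?r (cplx ?d) \<xi>)
      = norm (sobolev_weighted ?r (cplx v) \<xi> - sobolev_weighted ?r (cplx w) \<xi>)"
    using F(1) fourier_L2_eq_fourier_L1(1)[OF Lv Zv(2)] fourier_L2_eq_fourier_L1(1)[OF Lw Zw(2)]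
    by eventually_elim (simp only: sobolev_weighted_def Fd scaleR_diff_right)
  have "sobolev_weighted ?r (cplx ?d) \<in> L2_space"
  proof (rule L2_space_cong_AE[OF L2_space_diff[OF Zv(5) Zw(5)] _ AE])
    show "sobolev_weighted ?r (cplx ?d) \<in> borel_measurable lborel"
      unfolding sobolev_weighted_def[abs_def] using L2_spaceD(1)[OF F(2)] by measurable
  qed
  moreover have "(\<lambda>x. norm x powr ?r * ?d x) \<in> L2_space"
    using L2_space_diff[OF Zv(4) Zw(4)] by (simp add: right_diff_distrib)
  ultimately show ?thesis using d2 by (simp add: Z_space_def sobolev_space_def)
qed

text \<open>The requirement on the divisions does not refer to the integrand: one sequence of divisions serves all
frequencies at once.\<close>

lemma Riemann_sums_tendsto_integral:
  fixes \<phi> :: "real \<Rightarrow> complex"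
  assumes \<phi>: "continuous_on {a..b} \<phi>" and D: "\<And>n. D n tagged_division_of {a..b}"
    and fine: "\<And>n. (\<lambda>x. ball x (\<delta> n)) fine D n" and \<delta>: "\<delta> \<longlonglongrightarrow> 0"
  shows "(\<lambda>n. \<Sum>(\<tau>,K)\<in>D n. measure lborel K *\<^sub>R \<phi> \<tau>) \<longlonglongrightarrow> integral {a..b} \<phi>"
proof (cases "a \<le> b")
  case True
  show ?thesis
  proof (rule LIMSEQ_I)
    fix e :: real assume e: "e > 0"
    define e' where "e' = e / (b - a + 1)"
    have e': "e' > 0" using e True by (simp add: e'_def)
    have "uniformly_continuous_on {a..b} \<phi>" by (rule compact_uniformly_continuous[OF \<phi>]) simp
    then obtain d where d: "d > 0" "\<And>x y. x \<in> {a..b} \<Longrightarrow> y \<in> {a..b} \<Longrightarrow> dist y x < d \<Longrightarrow> dist (\<phi> y) (\<phi> x) < e'"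
      using e' unfolding uniformly_continuous_on_def by metis
    from order_tendstoD(2)[OF \<delta> d(1)] obtain N where N: "\<And>n. n \<ge> N \<Longrightarrow> \<delta> n < d"
      unfolding eventually_sequentially by blast
    have "norm ((\<Sum>(\<tau>,K)\<in>D n. measure lborel K *\<^sub>R \<phi> \<tau>) - integral {a..b} \<phi>) < e" if n: "n \<ge> N" for n
    proof -
      have int: "\<phi> integrable_on {a..b}" using \<phi> by (rule integrable_continuous_interval)
      have Dc: "D n tagged_division_of cbox a b" using D by simp
      have eq: "integral {a..b} \<phi> = (\<Sum>(\<tau>,K)\<in>D n. integral K \<phi>)"
        using integral_combine_tagged_division_topdown[OF _ Dc, of \<phi>] int by simp
      have "norm ((\<Sum>(\<tau>,K)\<in>D n. measure lborel K *\<^sub>R \<phi> \<tau>) - integral {a..b} \<phi>)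
          = norm (\<Sum>(\<tau>,K)\<in>D n. measure lborel K *\<^sub>R \<phi> \<tau> - integral K \<phi>)"
        unfolding eq by (simp add: sum_subtractf split_def)
      also have "\<dots> \<le> (\<Sum>(\<tau>,K)\<in>D n. e' * measure lborel K)"
      proof (rule sum_norm_le)
        fix p assume p: "p \<in> D n"
        obtain \<tau> K where pK: "p = (\<tau>, K)" by (cases p)
        have K: "\<tau> \<in> K" "K \<subseteq> {a..b}" "K \<subseteq> ball \<tau> (\<delta> n)" "\<exists>x y. K = cbox x y"
          using tagged_division_ofD(2-4)[OF D p[unfolded pK]] fineD[OF fine p[unfolded pK]] by auto
        then obtain x y where xy: "K = cbox x y" by auto
        have iK: "\<phi> integrable_on K"
          unfolding xy by (rule integrable_continuous) (use \<phi> K xy continuous_on_subset in blast)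
        have "((\<lambda>s. \<phi> s - \<phi> \<tau>) has_integral (integral K \<phi> - measure lborel K *\<^sub>R \<phi> \<tau>)) (cbox x y)"
          using has_integral_diff[OF integrable_integral[OF iK, unfolded xy] has_integral_const[of
              "\<phi> \<tau>" x y]] by (simp add: xy)
        then have "norm (integral K \<phi> - measure lborel K *\<^sub>R \<phi> \<tau>) \<le> e' * measure lborel (cbox x y)"
        proof (rule has_integral_bound[rotated])
          fix s assume "s \<in> cbox x y"
          then have s: "s \<in> K" by (simp add: xy)
          then have "dist s \<tau> < d" using K(3) N[OF n] by (force simp: dist_commute)
          then have "dist (\<phi> s) (\<phi> \<tau>) < e'" using d(2) K s by blast
          then show "norm (\<phi> s - \<phi> \<tau>) \<le> e'" by (simp add: dist_norm)
        qed (use e' in simp)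
        then show "norm (case p of (\<tau>, K) \<Rightarrow> measure lborel K *\<^sub>R \<phi> \<tau> - integral K \<phi>)
            \<le> (case p of (\<tau>, K) \<Rightarrow> e' * measure lborel K)"
          by (simp add: pK xy norm_minus_commute)
      qed
      also have "\<dots> = e' * (\<Sum>(\<tau>,K)\<in>D n. measure lborel K)"
        by (simp add: sum_distrib_left split_def)
      also have "(\<Sum>(\<tau>,K)\<in>D n. measure lborel K) = b - a"
        using additive_content_tagged_division[OF Dc] True by simp
      also have "e' * (b - a) < e" using e True by (simp add: e'_def field_simps)
      finally show ?thesis .
    qed
    then show "\<exists>N. \<forall>n\<ge>N. norm ((\<Sum>(\<tau>,K)\<in>D n. measure lborel K *\<^sub>R \<phi> \<tau>) - integral {a..b} \<phi>) < e" by blast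
  qed
next
  case False
  then have "D n = {}" for n using D[of n] by (simp add: tagged_division_of_trivial)
  then show ?thesis using False by simp
qed

text \<open>Cauchy-Schwarz for \<open>v\<^sup>2 - w\<^sup>2 = (v - w) ((v - w) + 2 w)\<close>.\<close>

lemma fourier_square_diff_le:
  fixes v w :: "'a::euclidean_space \<Rightarrow> real"
  assumes v: "v \<in> L2_space" and w: "w \<in> L2_space"
  shows "norm (fourier_L1 (\<lambda>x. complex_of_real ((v x)\<^sup>2)) \<xi>
      - fourier_L1 (\<lambda>x. complex_of_real ((w x)\<^sup>2)) \<xi>)
    \<le> L2_norm (\<lambda>x. v x - w x) * (L2_norm (\<lambda>x. v x - w x) + 2 * L2_norm w)"
proof -
  note V = L2_spaceD[OF v] and W = L2_spaceD[OF w]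
  have d: "(\<lambda>x. v x - w x) \<in> L2_space" by (rule L2_space_diff[OF v w])
  have s: "(\<lambda>x. (v x - w x) + 2 *\<^sub>R w x) \<in> L2_space" by (rule L2_space_add[OF d L2_space_scaleR[OF w]])
  have i: "integrable lborel (\<lambda>x. complex_of_real ((v x)\<^sup>2))" "integrable lborel (\<lambda>x.
      complex_of_real ((w x)\<^sup>2))"
    using integrable_of_real[of lborel "\<lambda>x. (v x)\<^sup>2"] integrable_of_real[of lborel "\<lambda>x. (w x)\<^sup>2"] V
        W by simp_all
  have "fourier_L1 (\<lambda>x. complex_of_real ((v x)\<^sup>2)) \<xi> - fourier_L1 (\<lambda>x. complex_of_real ((w x)\<^sup>2)) \<xi>
      = fourier_L1 (\<lambda>x. complex_of_real ((v x)\<^sup>2) - complex_of_real ((w x)\<^sup>2)) \<xi>"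
    by (rule fourier_L1_diff[OF i, symmetric])
  also have "norm \<dots> \<le> (LINT x|lborel. norm (complex_of_real ((v x)\<^sup>2) - complex_of_real ((w x)\<^sup>2)))"
    by (rule norm_fourier_L1_le)
  also have "\<dots> = (LINT x|lborel. \<bar>(v x - w x) * ((v x - w x) + 2 *\<^sub>R w x)\<bar>)"
  proof (intro Bochner_Integration.integral_cong refl)
    fix x
    show "norm (complex_of_real ((v x)\<^sup>2) - complex_of_real ((w x)\<^sup>2)) = \<bar>(v x - w x) * ((v x - w x)
        + 2 *\<^sub>R w x)\<bar>"
      unfolding of_real_diff[symmetric] norm_of_real by (simp add: power2_eq_square algebra_simps)
  qed
  also have "\<dots> \<le> L2_norm (\<lambda>x. v x - w x) * L2_norm (\<lambda>x. (v x - w x) + 2 *\<^sub>R w x)"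
    using Cauchy_Schwarz_integral(2)[of "\<lambda>x. v x - w x" lborel "\<lambda>x. (v x - w x) + 2 *\<^sub>R w x"]
      L2_spaceD[OF d] L2_spaceD[OF s] by (simp add: L2_norm_def)
  also have "\<dots> \<le> L2_norm (\<lambda>x. v x - w x) * (L2_norm (\<lambda>x. v x - w x) + 2 * L2_norm w)"
    using L2_norm_triangle[OF d L2_space_scaleR[OF w, of 2]] L2_norm_scaleR[OF w, of 2]
    by (intro mult_left_mono) auto
  finally show ?thesis .
qed

section \<open>Duhamel's formula at each frequency\<close>

lemma inv_fourier_diff:
  assumes "integrable lborel f" "integrable lborel g"
  shows "inv_fourier (\<lambda>x. f x - g x) \<xi> = inv_fourier f \<xi> - inv_fourier g \<xi>"
  unfolding inv_fourier_def using assms by (simp add: fourier_L1_diff diff_divide_distrib)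

lemma inv_fourier_scaleR: "inv_fourier (\<lambda>x. r *\<^sub>R f x) \<xi> = r *\<^sub>R inv_fourier f \<xi>"
  unfolding inv_fourier_def scaleR_conv_of_real by (simp add: fourier_L1_cmult)

lemma inv_fourier_sum:
  assumes "\<And>i. i \<in> I \<Longrightarrow> integrable lborel (f i)"
  shows "inv_fourier (\<lambda>x. \<Sum>i\<in>I. f i x) \<xi> = (\<Sum>i\<in>I. inv_fourier (f i) \<xi>)"
  unfolding inv_fourier_def fourier_L1_def using integrable_fourier_kernel[OF assms]
  by (simp add: sum_distrib_left sum_divide_distrib)

lemma inner_axis_1 [simp]: "x \<bullet> axis 1 1 = x $ 1" for x :: "real ^ 'n::{finite,one}"
  by (simp add: inner_axis)

text \<open>The dispersion relation: the group at time \<open>t\<close> multiplies the transform by \<open>iexp (t * dispersion \<xi>)\<close>.\<close>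

definition dispersion :: "real ^ 'n::{finite,one} \<Rightarrow> real" where
  "dispersion \<xi> = \<xi> $ 1 * norm \<xi>"

lemma continuous_dispersion [continuous_intros]: "continuous_on S dispersion"
  unfolding dispersion_def by (intro continuous_intros)

lemma measurable_dispersion [measurable]: "dispersion \<in> borel_measurable borel"
  by (rule borel_measurable_continuous_onI) (rule continuous_dispersion)

locale duhamel_solution =
  fixes u :: "real \<Rightarrow> real ^ 'n::{finite,one} \<Rightarrow> real" and u0 :: "real ^ 'n::{finite,one} \<Rightarrow> real"
      and T :: real
  assumes T: "T > 0"
    and u_cont: "u \<in> C_Zdot T (real CARD('n) + 1) (real CARD('n) + 1)"
    and u_sol: "is_duhamel_solution T u0 u"
begin

definition "u_hat t = fourier_L1 (cplx (u t))"
definition "sq_hat t = fourier_L1 (\<lambda>x. complex_of_real ((u t x)\<^sup>2))"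
text \<open>The transform of \<open>u \<partial>\<^sub>1 u\<close> (see \<open>fourier_nonlin\<close>), expressed by that of \<open>u\<^sup>2\<close>: it is then continuous in time and
frequency because \<open>u\<close> is continuous in time with values in \<open>L\<^sup>2\<close>.\<close>

definition "nonlin_hat t \<xi> = \<i> * complex_of_real (\<xi> $ 1 / 2) * sq_hat t \<xi>"

lemma u_Z: "t \<in> {0..T} \<Longrightarrow> u t \<in> Z_space (real DIM(real ^ 'n::{finite,one})
    + 1) (real DIM(real ^ 'n::{finite,one}) + 1)"
  and u_hat_at_0: "t \<in> {0..T} \<Longrightarrow> u_hat t 0 = 0"
  and Z_norm_tendsto: "t \<in> {0..T} \<Longrightarrow>
    ((\<lambda>t'. Z_norm (real CARD('n) + 1) (real CARD('n) + 1) (\<lambda>x. u t' x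
        - u t x)) \<longlongrightarrow> 0) (at t within {0..T})"
  using u_cont by (auto simp: C_Zdot_def Zdot_space_def u_hat_def)

lemma u_diff_Z:
  "t \<in> {0..T} \<Longrightarrow> t' \<in> {0..T} \<Longrightarrow> (\<lambda>x. u t' x - u t x) \<in> Z_space (real DIM(real ^ 'n::{finite,one})
      + 1) (real DIM(real ^ 'n::{finite,one}) + 1)"
  by (rule Z_space_diff[OF u_Z u_Z])

lemma sobolev_norm_nonneg: "0 \<le> sobolev_norm s f"
  by (simp add: sobolev_norm_def)

lemma tendsto_within_squeeze:
  fixes f g :: "real \<Rightarrow> real"
  assumes "(g \<longlongrightarrow> 0) (at t within S)" "\<And>x. x \<in> S \<Longrightarrow> 0 \<le> f x" "\<And>x. x \<in> S \<Longrightarrow> f x \<le> g x"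
  shows "(f \<longlongrightarrow> 0) (at t within S)"
  by (rule tendsto_sandwich[OF _ _ tendsto_const assms(1)])
     (use assms in \<open>auto simp: eventually_at_filter\<close>)

lemma sobolev_tendsto:
  assumes t: "t \<in> {0..T}"
  shows "((\<lambda>t'. sobolev_norm (real CARD('n) + 1) (cplx (\<lambda>x. u t' x - u t x))) \<longlongrightarrow> 0) (at t within {0..T})"
  by (rule tendsto_within_squeeze[OF Z_norm_tendsto[OF t]]) (auto simp: Z_norm_def sobolev_norm_nonneg)

lemma weight_tendsto:
  assumes t: "t \<in> {0..T}"
  shows "((\<lambda>t'. L2_norm (\<lambda>x. norm x powr (real CARD('n) + 1) * (u t' x
      - u t x))) \<longlongrightarrow> 0) (at t within {0..T})"
  by (rule tendsto_within_squeeze[OF Z_norm_tendsto[OF t]]) (auto simp: Z_norm_def sobolev_norm_nonneg)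

lemma L2_tendsto:
  assumes t: "t \<in> {0..T}"
  shows "((\<lambda>t'. L2_norm (\<lambda>x. u t' x - u t x)) \<longlongrightarrow> 0) (at t within {0..T})"
proof -
  define c where "c = sqrt ((2 * pi) ^ DIM(real ^ 'n::{finite,one}))"
  have c: "c > 0" by (simp add: c_def)
  have "((\<lambda>t'. sobolev_norm (real CARD('n) + 1) (cplx (\<lambda>x. u t' x
      - u t x)) / c) \<longlongrightarrow> 0) (at t within {0..T})"
    using tendsto_divide[OF sobolev_tendsto[OF t] tendsto_const[of c]] c by simp
  then show ?thesis
  proof (rule tendsto_within_squeeze)
    fix t' assume t': "t' \<in> {0..T}"
    show "L2_norm (\<lambda>x. u t' x - u t x) \<le> sobolev_norm (real CARD('n) + 1) (cplx (\<lambda>x. u t' x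
        - u t x)) / c"
    proof -
      have "c * L2_norm (\<lambda>x. u t' x - u t x) \<le> sobolev_norm (real CARD('n) + 1) (cplx (\<lambda>x. u t' x
          - u t x))"
        using L2_norm_le_sobolev_norm[OF u_diff_Z[OF t t']] unfolding c_def by simp
      then show ?thesis using c by (simp add: pos_le_divide_eq mult.commute)
    qed
  qed simp
qed

lemma sq_integrable:
  assumes t: "t \<in> {0..T}"
  shows "integrable lborel (\<lambda>x. (u t x)\<^sup>2)" "integrable lborel (\<lambda>x. complex_of_real ((u t x)\<^sup>2))"
proof -
  show "integrable lborel (\<lambda>x. (u t x)\<^sup>2)" using L2_spaceD(2)[OF Z_spaceD(3)[OF u_Z[OF t]]] by simp
  then show "integrable lborel (\<lambda>x. complex_of_real ((u t x)\<^sup>2))" by (rule integrable_of_real)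
qed

lemma jointly_continuous_sq_hat: "continuous_on ({0..T} \<times> UNIV) (\<lambda>(t, \<xi>). sq_hat t \<xi>)"
proof (unfold continuous_on_def, intro ballI)
  fix p assume "p \<in> {0..T} \<times> (UNIV :: (real ^ 'n::{finite,one}) set)"
  then obtain t \<xi> where p: "p = (t, \<xi>)" and t: "t \<in> {0..T}" by auto
  define a where "a t' = L2_norm (\<lambda>x. u t' x - u t x)" for t'
  define b where "b t' = a t' * (a t' + 2 * L2_norm (u t))" for t'
  have "(b \<longlongrightarrow> 0 * (0 + 2 * L2_norm (u t))) (at t within {0..T})"
    unfolding b_def a_def by (intro tendsto_intros L2_tendsto t)
  moreover have "b t = 0" by (simp add: b_def a_def L2_norm_def)
  ultimately have b: "continuous (at t within {0..T}) b" by (simp add: continuous_within)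
  have fst: "continuous (at p within {0..T} \<times> UNIV) (\<lambda>q :: real \<times> (real ^ 'n::{finite,one}). fst q)"
      by (intro continuous_intros)
  have "continuous (at p within {0..T} \<times> UNIV) (b \<circ> fst)"
    by (rule continuous_within_compose[OF fst]) (use b p t in \<open>auto simp: fst_image_times\<close>)
  then have b': "((\<lambda>q. b (fst q)) \<longlongrightarrow> 0) (at p within {0..T} \<times> UNIV)"
    using \<open>b t = 0\<close> by (simp add: continuous_within p comp_def)
  have 1: "((\<lambda>q. sq_hat (fst q) (snd q) - sq_hat t (snd q)) \<longlongrightarrow> 0) (at p within {0..T} \<times> UNIV)"
  proof (rule Lim_null_comparison[OF _ b'])
    have "norm (sq_hat (fst q) (snd q) - sq_hat t (snd q)) \<le> b (fst q)" if "q \<in> {0..T} \<times> UNIV" for q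
      using fourier_square_diff_le[OF Z_spaceD(3)[OF u_Z] Z_spaceD(3)[OF u_Z[OF t]], of "fst q" "snd
          q"] that
      by (auto simp: sq_hat_def b_def a_def)
    then show "eventually (\<lambda>q. norm (sq_hat (fst q) (snd q) - sq_hat t (snd q))
        \<le> b (fst q)) (at p within {0..T} \<times> UNIV)"
      by (auto simp: eventually_at_filter)
  qed
  have "continuous_on UNIV (\<lambda>q :: real \<times> (real ^ 'n::{finite,one}). sq_hat t (snd q))"
    unfolding sq_hat_def
    by (intro continuous_on_compose2[OF continuous_fourier_L1[OF sq_integrable(2)[OF t], of UNIV]]
        continuous_intros) auto
  then have "continuous (at p within {0..T} \<times> UNIV) (\<lambda>q :: real \<times> (real ^ 'n::{finite,one}). sq_hat
      t (snd q))"
    by (metis UNIV_I continuous_at_imp_continuous_at_within continuous_on_eq_continuous_at open_UNIV)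
  then have 2: "((\<lambda>q. sq_hat t (snd q)) \<longlongrightarrow> sq_hat t \<xi>) (at p within {0..T} \<times> UNIV)"
    by (simp add: continuous_within p)
  show "((\<lambda>(t, \<xi>). sq_hat t \<xi>) \<longlongrightarrow> (case p of (t, \<xi>) \<Rightarrow> sq_hat t \<xi>)) (at p within {0..T} \<times> UNIV)"
    using tendsto_add[OF 1 2] by (simp add: p split_def)
qed

lemma continuous_on_sq_hat:
  assumes "continuous_on S f" "continuous_on S g" "f ` S \<subseteq> {0..T}"
  shows "continuous_on S (\<lambda>x. sq_hat (f x) (g x))"
proof -
  have "continuous_on S (\<lambda>x. case (f x, g x) of (t, \<xi>) \<Rightarrow> sq_hat t \<xi>)"
    by (rule continuous_on_compose2[OF jointly_continuous_sq_hat continuous_on_Pair[OF assms(1,2)]])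
        (use assms(3) in auto)
  then show ?thesis by simp
qed

lemma continuous_on_nonlin_hat:
  assumes "continuous_on S f" "continuous_on S g" "f ` S \<subseteq> {0..T}"
  shows "continuous_on S (\<lambda>x. nonlin_hat (f x) (g x))"
  unfolding nonlin_hat_def by (intro continuous_intros continuous_on_sq_hat assms) auto

lemma u_Z_function: "t \<in> {0..T} \<Longrightarrow> Z_function (u t) (axis 1 1)"
  by standard (use u_Z in auto)

lemma partial_1_Z_product:
  assumes t: "t \<in> {0..T}"
  shows "Z_product (u t) (axis 1 1) (partial_1 (cplx (u t)))"
proof -
  interpret Z_function "u t" "axis 1 1" by (rule u_Z_function[OF t])
  have eq: "(\<lambda>\<xi>. (\<i> * complex_of_real (\<xi> $ 1)) * fourier_L1 (cplx (u t)) \<xi>) = dv_hat"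
    by (rule ext) (simp add: dv_hat_def v_hat_def)
  have m: "(\<lambda>\<xi>::real ^ 'n::{finite,one}. \<i> * complex_of_real (\<xi> $ 1)) \<in> borel_measurable borel"
      by measurable
  note forcing = fourier_multiplier_eq[OF Z_space_L1(3)[OF u_Z[OF t]] Z_spaceD(2)[OF u_Z[OF t]] m,
      unfolded eq, OF dv_hat_integrable dv_hat_L2]
  show ?thesis
    by standard (use forcing L2_spaceD(1)[OF forcing(2)] in \<open>auto simp: partial_1_def\<close>)
qed

definition "nonlin t = (\<lambda>x. cplx (u t) x * partial_1 (cplx (u t)) x)"

lemma
  assumes t: "t \<in> {0..T}"
  shows nonlin_integrable: "integrable lborel (nonlin t)" and nonlin_L2: "nonlin t \<in> L2_space"
    and fourier_nonlin: "fourier_L1 (nonlin t) = nonlin_hat t"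
    and nonlin_hat_integrable: "integrable lborel (nonlin_hat t)"
        and nonlin_hat_L2: "nonlin_hat t \<in> L2_space"
    and L2_norm_nonlin_le: "L2_norm (nonlin t) \<le> (LINT \<xi>|lborel. (1 + norm \<xi>)
        * norm (fourier_L1 (cplx (u t)) \<xi>)) / (2 * pi) ^ DIM(real ^ 'n::{finite,one}) * L2_norm (u t)"
proof -
  interpret Z_product "u t" "axis 1 1" "partial_1 (cplx (u t))" by (rule partial_1_Z_product[OF t])
  show i: "integrable lborel (nonlin t)" and L: "nonlin t \<in> L2_space"
    unfolding nonlin_def by (rule product_integrable product_L2)+
  show F: "fourier_L1 (nonlin t) = nonlin_hat t"
    unfolding nonlin_def by (rule ext) (simp add: fourier_product nonlin_hat_def sq_hat_def)
  show "integrable lborel (nonlin_hat t)" unfolding F[symmetric] unfolding nonlin_def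
      by (rule fourier_product_integrable)
  show "nonlin_hat t \<in> L2_space" unfolding F[symmetric] by (rule fourier_L1_in_L2[OF i L])
  show "L2_norm (nonlin t) \<le> (LINT \<xi>|lborel. (1 + norm \<xi>) * norm (fourier_L1 (cplx (u t)) \<xi>)) / (2
      * pi) ^ DIM(real ^ 'n::{finite,one}) * L2_norm (u t)"
    unfolding nonlin_def by (rule product_L2_norm)
qed

lemma
  fixes f :: "real ^ 'n::{finite,one} \<Rightarrow> complex"
  assumes f: "integrable lborel f" "f \<in> L2_space"
  shows phase_int: "integrable lborel (\<lambda>\<xi>. iexp (s * dispersion \<xi>) * f \<xi>)"
    and phase_L2: "(\<lambda>\<xi>. iexp (s * dispersion \<xi>) * f \<xi>) \<in> L2_space"
proof -
  note [measurable] = borel_measurable_integrable[OF f(1)]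
  have [measurable]: "(\<lambda>\<xi>. iexp (s * dispersion \<xi>) * f \<xi>) \<in> borel_measurable lborel" by measurable
  show "integrable lborel (\<lambda>\<xi>. iexp (s * dispersion \<xi>) * f \<xi>)"
    by (rule Bochner_Integration.integrable_bound[OF f(1)]) (auto simp: norm_mult simp del: of_real_mult)
  show "(\<lambda>\<xi>. iexp (s * dispersion \<xi>) * f \<xi>) \<in> L2_space"
    by (rule L2_space_bound[OF f(2)]) (auto simp: norm_mult simp del: of_real_mult)
qed

lemma dispersive_group_eq:
  fixes f :: "real ^ 'n::{finite,one} \<Rightarrow> complex"
  assumes f: "integrable lborel f" "f \<in> L2_space" and F: "integrable lborel (fourier_L1 f)"
  shows "AE x in lborel. dispersive_group s f x = inv_fourier (\<lambda>\<xi>. iexp (s * dispersion \<xi>)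
      * fourier_L1 f \<xi>) x"
    and "dispersive_group s f \<in> L2_space"
proof -
  have m: "(\<lambda>\<xi>::real ^ 'n::{finite,one}. iexp (s * dispersion \<xi>)) \<in> borel_measurable borel" by measurable
  have eq: "dispersive_group s = fourier_multiplier (\<lambda>\<xi>::real ^ 'n::{finite,one}. iexp (s
      * dispersion \<xi>))"
    unfolding dispersive_group_def dispersion_def by (simp add: mult.assoc)
  note forcing = fourier_multiplier_eq[OF f m phase_int[OF F fourier_L1_in_L2[OF f]] phase_L2[OF F
      fourier_L1_in_L2[OF f]]]
  show "AE x in lborel. dispersive_group s f x = inv_fourier (\<lambda>\<xi>. iexp (s * dispersion \<xi>)
      * fourier_L1 f \<xi>) x"
    "dispersive_group s f \<in> L2_space"
    unfolding eq by (rule forcing)+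
qed

lemma u_hat_integrable: "t \<in> {0..T} \<Longrightarrow> integrable lborel (u_hat t)"
  and u_hat_L2: "t \<in> {0..T} \<Longrightarrow> u_hat t \<in> L2_space"
proof -
  assume t: "t \<in> {0..T}"
  interpret Z_function "u t" "axis 1 1" by (rule u_Z_function[OF t])
  show "integrable lborel (u_hat t)" using v_hat_integrable by (simp add: u_hat_def v_hat_def)
  show "u_hat t \<in> L2_space" unfolding u_hat_def by (rule fourier_L1_in_L2[OF Z_space_L1(3)[OF v]
      Z_spaceD(2)[OF v]])
qed


text \<open>By Plancherel's theorem the \<open>L\<^sup>2\<close> integral turns into an \<open>L\<^sup>2\<close> limit of Riemann sums of the transforms. Along
divisions whose mesh also tends to zero, these sums converge at each frequency to the integral of
a continuous function of time. Fatou's lemma identifies the two limits almost everywhere, and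
continuity in the frequency identifies them everywhere.\<close>

lemma Duhamel_fourier:
  assumes t: "t \<in> {0..T}"
  shows "u_hat t \<xi> = iexp (t * dispersion \<xi>) * u_hat 0 \<xi>
    - integral {0..t} (\<lambda>\<tau>. iexp ((t - \<tau>) * dispersion \<xi>) * nonlin_hat \<tau> \<xi>)"
proof -
  have t0: "0 \<in> {0..T}" using T by simp
  have sub: "\<tau> \<in> {0..T}" if "\<tau> \<in> {0..t}" for \<tau> using that t by auto
  define K where "K \<tau> \<xi> = iexp ((t - \<tau>) * dispersion \<xi>) * nonlin_hat \<tau> \<xi>" for \<tau> \<xi>
  define h where "h \<xi> = iexp (t * dispersion \<xi>) * u_hat 0 \<xi> - u_hat t \<xi>" for \<xi>
  define I where "I \<xi> = integral {0..t} (\<lambda>\<tau>. K \<tau> \<xi>)" for \<xi>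
  define c where "c = sqrt ((2 * pi) ^ DIM(real ^ 'n::{finite,one}))"
  have c: "c > 0" by (simp add: c_def)
  have Ki: "integrable lborel (K \<tau>)" and K2: "K \<tau> \<in> L2_space" if "\<tau> \<in> {0..t}" for \<tau>
    unfolding K_def[abs_def] using sub[OF that] by (intro phase_int phase_L2 nonlin_hat_integrable
        nonlin_hat_L2; simp)+
  note ph = phase_int[OF u_hat_integrable[OF t0] u_hat_L2[OF t0], of t] phase_L2[OF
      u_hat_integrable[OF t0] u_hat_L2[OF t0], of t]
  have hi: "integrable lborel h"
    unfolding h_def[abs_def] by (rule Bochner_Integration.integrable_diff[OF ph(1)
        u_hat_integrable[OF t]])
  have h2: "h \<in> L2_space"
    unfolding h_def[abs_def] by (rule L2_space_diff[OF ph(2) u_hat_L2[OF t]])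
  have u0: "u0 \<in> L2_space" "AE x in lborel. u 0 x = u0 x" using u_sol by
      (auto simp: is_duhamel_solution_def)
  obtain w where w: "has_L2_integral
          (\<lambda>\<tau>. dispersive_group (t - \<tau>) (nonlin \<tau>)) w 0 t"
        "AE x in lborel. cplx (u t) x = dispersive_group t (cplx u0) x - w x"
    using u_sol t unfolding is_duhamel_solution_def nonlin_def by blast
  have wL2: "w \<in> L2_space" using w(1) by (simp add: has_L2_integral_def)
  \<comment> \<open>The \<open>L\<^sup>2\<close> integral, expressed by the two other terms of the formula.\<close>
  have w_eq: "AE x in lborel. w x = inv_fourier h x"
  proof -
    note Z0 = Z_spaceD[OF u_Z[OF t0]] and L0 = Z_space_L1(3)[OF u_Z[OF t0]]
    have AE0: "AE x in lborel. cplx (u 0) x = cplx u0 x" using u0(2) by eventually_elim simp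
    have m0: "cplx u0 \<in> borel_measurable lborel" using L2_spaceD(1)[OF u0(1)] by measurable
    have m1: "cplx (u 0) \<in> borel_measurable lborel" using L2_spaceD(1)[OF Z0(2)] .
    have i0: "integrable lborel (cplx u0)" using L0 by (subst (asm) integrable_cong_AE[OF m1 m0 AE0])
    have L20: "cplx u0 \<in> L2_space" by (rule L2_space_cong_AE[OF Z0(2) m0]) (use AE0 in auto)
    have F0: "fourier_L1 (cplx u0) = u_hat 0"
      unfolding u_hat_def using fourier_L1_cong_AE[OF AE0 m1 m0] by simp
    have "AE x in lborel. dispersive_group t (cplx u0) x = inv_fourier (\<lambda>\<xi>. iexp (t * dispersion \<xi>)
        * u_hat 0 \<xi>) x"
      using dispersive_group_eq(1)[OF i0 L20, of t] u_hat_integrable[OF t0] by (simp add: F0)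
    moreover have "AE x in lborel. cplx (u t) x = inv_fourier (u_hat t) x"
      using fourier_inversion_AE[OF Z_space_L1(3)[OF u_Z[OF t]] Z_spaceD(2)[OF u_Z[OF t]]]
          u_hat_integrable[OF t]
      by (simp add: u_hat_def)
    ultimately show ?thesis using w(2)
    proof eventually_elim
      case (elim x)
      have "w x = dispersive_group t (cplx u0) x - cplx (u t) x" using elim(3) by simp
      then show ?case
        unfolding h_def inv_fourier_diff[OF ph(1) u_hat_integrable[OF t], of x] elim(1,2) .
    qed
  qed
  have disp: "AE x in lborel. dispersive_group (t - \<tau>) (nonlin \<tau>) x
      = inv_fourier (K \<tau>) x" if "\<tau> \<in> {0..t}" for \<tau>
    using dispersive_group_eq(1)[OF nonlin_integrable[OF sub[OF that]] nonlin_L2[OF sub[OF that]],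
        of "t - \<tau>"]
      nonlin_hat_integrable[OF sub[OF that]] unfolding fourier_nonlin[OF sub[OF that]]
          K_def[abs_def] by simp
  define \<delta> where "\<delta> n = 1 / real (Suc n)" for n
  have \<delta>: "\<delta> n > 0" for n by (simp add: \<delta>_def)
  have \<delta>0: "\<delta> \<longlonglongrightarrow> 0" unfolding \<delta>_def[abs_def] using LIMSEQ_inverse_real_of_nat by
      (simp add: inverse_eq_divide)
  have "\<exists>D. D tagged_division_of {0..t} \<and> (\<lambda>x. ball x (\<delta> n)) fine D \<and>
     L2_norm (\<lambda>x. (\<Sum>(\<tau>, K)\<in>D. measure lborel K *\<^sub>R dispersive_group (t - \<tau>) (nonlin \<tau>) x) - w x)
         < \<delta> n" for n
  proof -
    obtain \<gamma> where \<gamma>: "gauge \<gamma>" "\<forall>D. D tagged_division_of {0..t} \<and> \<gamma> fine D \<longrightarrow>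
       L2_norm (\<lambda>x. (\<Sum>(\<tau>, K)\<in>D. measure lborel K *\<^sub>R dispersive_group (t - \<tau>) (nonlin \<tau>) x) - w x) < \<delta> n"
      using w(1)[unfolded has_L2_integral_def, THEN conjunct2, THEN conjunct2, rule_format, OF \<delta>[of n]]
      by (elim exE conjE)
    \<comment> \<open>Refine the gauge by balls, to control the mesh as well.\<close>
    have "gauge (\<lambda>x. \<gamma> x \<inter> ball x (\<delta> n))"
      using \<gamma>(1) gauge_ball_dependent[of "\<lambda>_. \<delta> n"] \<delta> by (intro gauge_Int) auto
    then obtain D where D: "D tagged_division_of {0..t}" "(\<lambda>x. \<gamma> x \<inter> ball x (\<delta> n)) fine D"
      by (rule fine_division_exists_real)
    then have "\<gamma> fine D" "(\<lambda>x. ball x (\<delta> n)) fine D" by (simp_all add: fine_Int)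
    then show ?thesis using \<gamma>(2) D(1) by blast
  qed
  then have "\<forall>n. \<exists>D. D tagged_division_of {0..t} \<and> (\<lambda>x. ball x (\<delta> n)) fine D \<and>
     L2_norm (\<lambda>x. (\<Sum>(\<tau>, K)\<in>D. measure lborel K *\<^sub>R dispersive_group (t - \<tau>) (nonlin \<tau>) x) - w x)
         < \<delta> n" ..
  from choice[OF this] obtain D where DD: "\<forall>n. D n tagged_division_of {0..t}
      \<and> (\<lambda>x. ball x (\<delta> n)) fine D n \<and>
     L2_norm (\<lambda>x. (\<Sum>(\<tau>, K)\<in>D n. measure lborel K *\<^sub>R dispersive_group (t - \<tau>) (nonlin \<tau>) x) - w x) < \<delta> n"
    by (elim exE)
  have D: "\<And>n. D n tagged_division_of {0..t}" "\<And>n. (\<lambda>x. ball x (\<delta> n)) fine D n"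
    and DL: "\<And>n. L2_norm (\<lambda>x. (\<Sum>(\<tau>, K)\<in>D n. measure lborel K *\<^sub>R dispersive_group (t
        - \<tau>) (nonlin \<tau>) x) - w x) < \<delta> n"
    using DD by simp_all
  have tag: "fst p \<in> {0..t}" if "p \<in> D n" for p n
    using tag_in_interval[OF D(1)[of n], of "fst p" "snd p"] that by simp
  define S where "S n \<xi> = (\<Sum>p\<in>D n. measure lborel (snd p) *\<^sub>R K (fst p) \<xi>)" for n \<xi>
  have Si: "integrable lborel (S n)" for n
    unfolding S_def[abs_def] using Ki tag by (intro Bochner_Integration.integrable_sum
        integrable_scaleR_right) auto
  have S2: "S n \<in> L2_space" for n
    unfolding S_def[abs_def] using K2 tag by (intro L2_space_sum L2_space_scaleR) auto
  note [measurable] = borel_measurable_integrable[OF Si] borel_measurable_integrable[OF hi]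
  have SL: "L2_norm (\<lambda>\<xi>. S n \<xi> - h \<xi>) \<le> c * \<delta> n" for n
  proof -
    have i: "integrable lborel (\<lambda>\<xi>. S n \<xi> - h \<xi>)" using Si hi by simp
    have L: "(\<lambda>\<xi>. S n \<xi> - h \<xi>) \<in> L2_space" by (rule L2_space_diff[OF S2 h2])
    have "finite (D n)" using D(1) by (rule tagged_division_of_finite)
    then have "AE x in lborel. \<forall>p\<in>D n. dispersive_group (t - fst p) (nonlin (fst p)) x
        = inv_fourier (K (fst p)) x"
      using disp tag by (subst AE_finite_all) auto
    then have AE: "AE x in lborel. inv_fourier (\<lambda>\<xi>. S n \<xi> - h \<xi>) x
        = (\<Sum>(\<tau>, K)\<in>D n. measure lborel K *\<^sub>R dispersive_group (t - \<tau>) (nonlin \<tau>) x) - w x"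
      using w_eq
    proof eventually_elim
      case (elim x)
      have "inv_fourier (S n) x = (\<Sum>p\<in>D n. measure lborel (snd p) *\<^sub>R inv_fourier (K (fst p)) x)"
        unfolding S_def[abs_def] using Ki tag
        by (subst inv_fourier_sum) (auto simp: inv_fourier_scaleR)
      then show ?case using elim inv_fourier_diff[OF Si hi] by (simp add: split_def)
    qed
    have "L2_norm (inv_fourier (\<lambda>\<xi>. S n \<xi> - h \<xi>))
        = L2_norm (\<lambda>x. (\<Sum>(\<tau>, K)\<in>D n. measure lborel K *\<^sub>R dispersive_group (t - \<tau>) (nonlin \<tau>) x) - w x)"
    proof (rule L2_norm_cong_AE)
      show "inv_fourier (\<lambda>\<xi>. S n \<xi> - h \<xi>) \<in> borel_measurable lborel"
        using inv_fourier_L2[OF i L] by (simp add: L2_space_def)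
      have "dispersive_group (t - fst p) (nonlin (fst p)) \<in> borel_measurable lborel" if "p \<in> D n" for p
        using w(1) tag[OF that] by (auto simp: has_L2_integral_def L2_space_def)
      then show "(\<lambda>x. (\<Sum>(\<tau>, K)\<in>D n. measure lborel K *\<^sub>R dispersive_group (t - \<tau>) (nonlin \<tau>) x)
          - w x) \<in> borel_measurable lborel"
        unfolding split_def using L2_spaceD(1)[OF wL2]
        by (intro borel_measurable_diff borel_measurable_sum borel_measurable_scaleR) auto
      show "AE x in lborel. norm (inv_fourier (\<lambda>\<xi>. S n \<xi> - h \<xi>) x)
        = norm ((\<Sum>(\<tau>, K)\<in>D n. measure lborel K *\<^sub>R dispersive_group (t - \<tau>) (nonlin \<tau>) x) - w x)"
        using AE by eventually_elim simp
    qed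
    then have "L2_norm (inv_fourier (\<lambda>\<xi>. S n \<xi> - h \<xi>)) \<le> \<delta> n" using DL[of n] by simp
    then show ?thesis unfolding L2_norm_inv_fourier[OF i L] c_def by (intro mult_left_mono) auto
  qed
  have cK: "continuous_on ({0..t} \<times> UNIV) (\<lambda>(\<tau>, \<xi>). K \<tau> \<xi>)"
    unfolding K_def split_def using sub
    by (intro continuous_intros continuous_on_nonlin_hat continuous_on_compose2[OF
        continuous_dispersion[of UNIV]]) auto
  have "(\<lambda>n. \<Sum>(\<tau>,k)\<in>D n. measure lborel k *\<^sub>R K \<tau> \<xi>) \<longlonglongrightarrow> I \<xi>" for \<xi>
    unfolding I_def
  proof (rule Riemann_sums_tendsto_integral[OF _ D \<delta>0])
    show "continuous_on {0..t} (\<lambda>\<tau>. K \<tau> \<xi>)"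
      unfolding K_def using sub by (intro continuous_intros continuous_on_nonlin_hat) auto
  qed
  then have lim: "(\<lambda>n. S n \<xi>) \<longlonglongrightarrow> I \<xi>" for \<xi> by (simp add: S_def split_def)
  have cI: "continuous_on UNIV I"
  proof -
    have sw: "continuous_on (UNIV \<times> cbox 0 t) (\<lambda>p. (snd p, fst p))" by (intro continuous_intros)
    have "(\<lambda>p. (snd p, fst p)) ` (UNIV \<times> cbox 0 t) \<subseteq> {0..t} \<times> UNIV" by auto
    from continuous_on_compose2[OF cK sw this]
    have "continuous_on (UNIV \<times> cbox 0 t) (\<lambda>(\<xi>, \<tau>). K \<tau> \<xi>)" by (simp add: split_def)
    from integral_continuous_on_param[OF this] show ?thesis by (simp add: I_def[abs_def])
  qed
  have ch: "continuous_on UNIV h"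
    unfolding h_def using t t0
    by (intro continuous_intros continuous_dispersion) (auto simp: u_hat_def intro!:
        continuous_fourier_L1 Z_space_L1(3)[OF u_Z])
  have [measurable]: "I \<in> borel_measurable borel" by (rule borel_measurable_continuous_onI[OF cI])
  have "(\<integral>\<^sup>+\<xi>. ennreal ((norm (I \<xi> - h \<xi>))\<^sup>2) \<partial>lborel) = (\<integral>\<^sup>+\<xi>. liminf (\<lambda>n. ennreal ((norm (S n \<xi>
      - h \<xi>))\<^sup>2)) \<partial>lborel)"
  proof (rule nn_integral_cong)
    fix \<xi>
    have "(\<lambda>n. ennreal ((norm (S n \<xi> - h \<xi>))\<^sup>2)) \<longlonglongrightarrow> ennreal ((norm (I \<xi> - h \<xi>))\<^sup>2)"
      by (intro tendsto_ennrealI tendsto_intros lim)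
    then show "ennreal ((norm (I \<xi> - h \<xi>))\<^sup>2) = liminf (\<lambda>n. ennreal ((norm (S n \<xi> - h \<xi>))\<^sup>2))"
      using lim_imp_Liminf[OF sequentially_bot] by metis
  qed
  also have "\<dots> \<le> liminf (\<lambda>n. \<integral>\<^sup>+\<xi>. ennreal ((norm (S n \<xi> - h \<xi>))\<^sup>2) \<partial>lborel)"
    by (rule nn_integral_liminf) measurable
  also have "\<dots> \<le> liminf (\<lambda>n. ennreal ((c * \<delta> n)\<^sup>2))"
  proof (intro Liminf_mono always_eventually allI)
    fix n
    have "(\<integral>\<^sup>+\<xi>. ennreal ((norm (S n \<xi> - h \<xi>))\<^sup>2) \<partial>lborel) = ennreal ((L2_norm (\<lambda>\<xi>. S n \<xi> - h \<xi>))\<^sup>2)"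
      unfolding L2_norm_sq using L2_spaceD(2)[OF L2_space_diff[OF S2 h2]]
          by (intro nn_integral_eq_integral) auto
    also have "\<dots> \<le> ennreal ((c * \<delta> n)\<^sup>2)" using SL by (intro ennreal_leI power_mono) auto
    finally show "(\<integral>\<^sup>+\<xi>. ennreal ((norm (S n \<xi> - h \<xi>))\<^sup>2) \<partial>lborel) \<le> ennreal ((c * \<delta> n)\<^sup>2)" .
  qed
  also have "\<dots> = 0"
  proof -
    have "(\<lambda>n. ennreal ((c * \<delta> n)\<^sup>2)) \<longlonglongrightarrow> ennreal ((c * 0)\<^sup>2)"
        by (intro tendsto_ennrealI tendsto_intros \<delta>0)
    then show ?thesis using lim_imp_Liminf[OF sequentially_bot] by fastforce
  qed
  finally have "AE \<xi> in lborel. I \<xi> = h \<xi>"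
    by (simp add: nn_integral_0_iff_AE)
  from continuous_AE_eq[OF cI ch this] have "I \<xi> = h \<xi>" by simp
  then show ?thesis by (simp add: I_def h_def K_def algebra_simps)
qed

end

section \<open>Vanishing propagates in time\<close>

lemma norm_integral_sq_le:
  fixes g :: "real \<Rightarrow> complex"
  assumes g: "continuous_on {0..1} g"
  shows "ennreal ((norm (integral {0..1} g))\<^sup>2) \<le> (\<integral>\<^sup>+\<theta>. indicator {0..1} \<theta>
      * ennreal ((norm (g \<theta>))\<^sup>2) \<partial>lborel)"
proof -
  define f where "f \<theta> = indicator {0..1} \<theta> * norm (g \<theta>)" for \<theta> :: real
  define k where "k \<theta> = indicat_real {0..1} \<theta>" for \<theta> :: real
  have i1: "integrable lborel (\<lambda>\<theta>. indicator {0..1} \<theta> *\<^sub>R g \<theta>)"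
    using borel_integrable_compact[OF compact_Icc g] .
  have "continuous_on {0..1} (\<lambda>\<theta>. (norm (g \<theta>))\<^sup>2)" using g by (intro continuous_intros)
  from borel_integrable_compact[OF compact_Icc this]
  have i2: "integrable lborel (\<lambda>\<theta>. indicator {0..1} \<theta> *\<^sub>R (norm (g \<theta>))\<^sup>2)" .
  have f2: "(f \<theta>)\<^sup>2 = indicator {0..1} \<theta> *\<^sub>R (norm (g \<theta>))\<^sup>2" for \<theta> by (simp add: f_def indicator_def)
  have k2: "(k \<theta>)\<^sup>2 = indicator {0..1} \<theta>" for \<theta> by (simp add: k_def indicator_def)
  have fm: "f \<in> borel_measurable lborel"
  proof -
    have "f = (\<lambda>\<theta>. norm (indicator {0..1} \<theta> *\<^sub>R g \<theta>))" by (auto simp: f_def indicator_def)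
    then show ?thesis using borel_measurable_integrable[OF integrable_norm[OF i1]] by simp
  qed
  have km: "k \<in> borel_measurable lborel" unfolding k_def[abs_def]
      by (intro borel_measurable_indicator) simp
  have kint: "integrable lborel (\<lambda>\<theta>. (k \<theta>)\<^sup>2)" unfolding k2 by simp
  have "integral {0..1} g = (LINT \<theta>|lborel. indicator {0..1} \<theta> *\<^sub>R g \<theta>)"
    using set_borel_integral_eq_integral(2)[of "{0..1}" g] i1 by
        (simp add: set_integrable_def set_lebesgue_integral_def)
  then have "norm (integral {0..1} g) \<le> (LINT \<theta>|lborel. norm (indicator {0..1} \<theta> *\<^sub>R g \<theta>))"
    by (simp only: integral_norm_bound)
  also have "\<dots> = (LINT \<theta>|lborel. \<bar>f \<theta> * k \<theta>\<bar>)"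
    by (intro Bochner_Integration.integral_cong) (auto simp: f_def k_def indicator_def)
  also have "\<dots> \<le> sqrt (LINT \<theta>|lborel. (f \<theta>)\<^sup>2) * sqrt (LINT \<theta>|lborel. (k \<theta>)\<^sup>2)"
    by (rule Cauchy_Schwarz_integral[OF fm _ km kint]) (use i2 in \<open>simp add: f2\<close>)
  also have "(LINT \<theta>|lborel. (k \<theta>)\<^sup>2) = 1" unfolding k2 by simp
  finally have "(norm (integral {0..1} g))\<^sup>2 \<le> (sqrt (LINT \<theta>|lborel. (f \<theta>)\<^sup>2))\<^sup>2"
    by (intro power_mono) auto
  also have "\<dots> = (LINT \<theta>|lborel. indicator {0..1} \<theta> *\<^sub>R (norm (g \<theta>))\<^sup>2)"
    unfolding f2[symmetric] by simp
  finally have "ennreal ((norm (integral {0..1} g))\<^sup>2) \<le> ennreal (LINT \<theta>|lborel. indicator {0..1} \<theta>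
      *\<^sub>R (norm (g \<theta>))\<^sup>2)"
    by (rule ennreal_leI)
  also have "\<dots> = (\<integral>\<^sup>+\<theta>. ennreal (indicator {0..1} \<theta> *\<^sub>R (norm (g \<theta>))\<^sup>2) \<partial>lborel)"
    by (rule nn_integral_eq_integral[symmetric, OF i2]) auto
  also have "\<dots> = (\<integral>\<^sup>+\<theta>. indicator {0..1} \<theta> * ennreal ((norm (g \<theta>))\<^sup>2) \<partial>lborel)"
    by (intro nn_integral_cong) (auto simp: indicator_def)
  finally show ?thesis .
qed

context duhamel_solution
begin

text \<open>The solution with the linear evolution undone: \<open>profile\<close> has the time derivative \<open>- forcing\<close>.\<close>

definition "profile t \<xi> = iexp_conj (t * dispersion \<xi>) * u_hat t \<xi>"

definition "forcing \<tau> \<xi> = iexp_conj (\<tau> * dispersion \<xi>) * nonlin_hat \<tau> \<xi>"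

lemma norm_profile: "norm (profile t \<xi>) = norm (u_hat t \<xi>)"
  by (simp add: profile_def norm_mult del: of_real_mult)

lemma norm_forcing: "norm (forcing t \<xi>) = norm (nonlin_hat t \<xi>)"
  by (simp add: forcing_def norm_mult del: of_real_mult)

lemma profile_eq:
  assumes t: "t \<in> {0..T}"
  shows "profile t \<xi> = u_hat 0 \<xi> - integral {0..t} (\<lambda>\<tau>. forcing \<tau> \<xi>)"
proof -
  have e1: "iexp_conj (t * dispersion \<xi>) * iexp (t * dispersion \<xi>) = 1"
    unfolding mult_exp_exp by simp
  have e2: "iexp_conj (t * dispersion \<xi>) * iexp ((t - \<tau>) * dispersion \<xi>)
      = iexp_conj (\<tau> * dispersion \<xi>)" for \<tau>
    unfolding mult_exp_exp by (simp add: algebra_simps)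
  have "profile t \<xi> = iexp_conj (t * dispersion \<xi>) * iexp (t * dispersion \<xi>) * u_hat 0 \<xi>
     - iexp_conj (t * dispersion \<xi>) * integral {0..t} (\<lambda>\<tau>. iexp ((t - \<tau>) * dispersion \<xi>)
         * nonlin_hat \<tau> \<xi>)"
    unfolding profile_def Duhamel_fourier[OF t] by (simp only: right_diff_distrib mult.assoc)
  also have "iexp_conj (t * dispersion \<xi>) * integral {0..t} (\<lambda>\<tau>. iexp ((t - \<tau>) * dispersion \<xi>)
      * nonlin_hat \<tau> \<xi>)
     = integral {0..t} (\<lambda>\<tau>. iexp_conj (t * dispersion \<xi>) * (iexp ((t - \<tau>) * dispersion \<xi>)
         * nonlin_hat \<tau> \<xi>))"
    by (rule integral_mult_right[symmetric])
  finally show ?thesis unfolding e1 mult.assoc[symmetric] e2 forcing_def by simp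
qed

text \<open>Parametrising the segment between two times by \<open>[0,1]\<close> gives formulas that hold for either order of
the times.\<close>

definition path :: "real \<Rightarrow> real \<Rightarrow> real \<Rightarrow> real" where
  "path t1 t2 \<theta> = t1 + \<theta> * (t2 - t1)"

lemma path_in:
  assumes "t1 \<in> {a..b}" "t2 \<in> {a..b}" "\<theta> \<in> {0..1}"
  shows "path t1 t2 \<theta> \<in> {a..b}"
proof -
  have "path t1 t2 \<theta> = (1 - \<theta>) * t1 + \<theta> * t2" by (simp add: path_def algebra_simps)
  moreover have "convex {a..b}" by simp
  ultimately show ?thesis using assms convexD_alt[of "{a..b}" t1 t2 \<theta>] by simp
qed

lemma continuous_path [continuous_intros]: "continuous_on S (path t1 t2)"
  unfolding path_def by (intro continuous_intros)

lemma continuous_on_forcing: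
  assumes "continuous_on S f" "continuous_on S g" "f ` S \<subseteq> {0..T}"
  shows "continuous_on S (\<lambda>x. forcing (f x) (g x))"
  unfolding forcing_def
  by (intro continuous_intros continuous_on_nonlin_hat assms continuous_on_compose2[OF
      continuous_dispersion[of UNIV] assms(2)]) auto

lemma profile_increment:
  assumes t: "t1 \<in> {0..T}" "t2 \<in> {0..T}"
  shows "profile t2 \<xi> - profile t1 \<xi> = - (complex_of_real (t2 - t1)
      * integral {0..1} (\<lambda>\<theta>. forcing (path t1 t2 \<theta>) \<xi>))"
proof -
  define W where "W t = integral {0..t} (\<lambda>\<tau>. forcing \<tau> \<xi>)" for t
  have cM: "continuous_on {0..T} (\<lambda>\<tau>. forcing \<tau> \<xi>)" by (intro continuous_on_forcing
      continuous_intros) auto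
  have img: "path t1 t2 ` {0..1} \<subseteq> {0..T}" using path_in[OF t] by auto
  have "((\<lambda>\<theta>. (t2 - t1) *\<^sub>R forcing (path t1 t2 \<theta>) \<xi>) has_integral (W \<circ> path t1 t2) 1
      - (W \<circ> path t1 t2) 0) {0..1}"
  proof (rule fundamental_theorem_of_calculus)
    fix \<theta> :: real assume \<theta>: "\<theta> \<in> {0..1}"
    have "(W has_vector_derivative forcing (path t1 t2 \<theta>) \<xi>) (at (path t1 t2 \<theta>) within {0..T})"
      unfolding W_def by (rule integral_has_vector_derivative[OF cM path_in[OF t \<theta>]])
    then have 1: "(W has_vector_derivative forcing (path t1 t2 \<theta>) \<xi>) (at (path t1 t2 \<theta>) within path
        t1 t2 ` {0..1})"
      by (rule has_vector_derivative_within_subset[OF _ img])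
    have 2: "(path t1 t2 has_vector_derivative (t2 - t1)) (at \<theta> within {0..1})"
      unfolding path_def by (auto intro!: derivative_eq_intros)
    show "(W \<circ> path t1 t2 has_vector_derivative (t2 - t1) *\<^sub>R forcing (path t1 t2 \<theta>) \<xi>) (at \<theta> within
        {0..1})"
      by (rule vector_diff_chain_within[OF 2 1])
  qed simp
  moreover have "path t1 t2 1 = t2" "path t1 t2 0 = t1" by (simp_all add: path_def)
  ultimately have "((\<lambda>\<theta>. (t2 - t1) *\<^sub>R forcing (path t1 t2 \<theta>) \<xi>) has_integral W t2 - W t1) {0..1}"
    by (simp only: comp_def)
  from integral_unique[OF this]
  have "W t2 - W t1 = integral {0..1} (\<lambda>\<theta>. (t2 - t1) *\<^sub>R forcing (path t1 t2 \<theta>) \<xi>)" ..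
  moreover have "profile t2 \<xi> - profile t1 \<xi> = - (W t2 - W t1)"
    unfolding profile_eq[OF t(1)] profile_eq[OF t(2)] by (simp add: W_def)
  ultimately show ?thesis by (simp add: scaleR_conv_of_real del: of_real_diff)
qed

lemma zero_of_L2_norm:
  assumes t: "t \<in> {0..T}" and z: "L2_norm (u t) = 0"
  shows "AE x in lborel. u t x = 0" "u_hat t \<xi> = 0"
proof -
  show AE: "AE x in lborel. u t x = 0"
    by (rule L2_norm_eq_0_AE[OF Z_spaceD(3)[OF u_Z[OF t]] z])
  have "fourier_L1 (cplx (u t)) = fourier_L1 (\<lambda>x. 0)"
    by (rule fourier_L1_cong_AE) (use AE Z_spaceD(1)[OF u_Z[OF t]] in auto)
  then show "u_hat t \<xi> = 0" by (simp add: u_hat_def) (simp add: fourier_L1_def)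
qed

lemma Plancherel_u:
  assumes t: "t \<in> {0..T}"
  shows "L2_norm (u_hat t) = sqrt ((2 * pi) ^ DIM(real ^ 'n::{finite,one})) * L2_norm (u t)"
proof -
  have "L2_norm (cplx (u t)) = L2_norm (u t)" by (simp add: L2_norm_def)
  then show ?thesis
    unfolding u_hat_def using Plancherel[OF Z_space_L1(3)[OF u_Z[OF t]] Z_spaceD(2)[OF u_Z[OF t]]]
        by simp
qed

lemma continuous_L2_norm_u: "continuous_on {0..T} (\<lambda>t. L2_norm (u t))"
  unfolding continuous_on_def
proof
  fix t assume t: "t \<in> {0..T}"
  have "((\<lambda>t'. \<bar>L2_norm (u t') - L2_norm (u t)\<bar>) \<longlongrightarrow> 0) (at t within {0..T})"
  proof (rule tendsto_within_squeeze[OF L2_tendsto[OF t]])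
    fix t' assume t': "t' \<in> {0..T}"
    note L = Z_spaceD(3)[OF u_Z[OF t]] Z_spaceD(3)[OF u_Z[OF t']]
    show "\<bar>L2_norm (u t') - L2_norm (u t)\<bar> \<le> L2_norm (\<lambda>x. u t' x - u t x)"
      using L2_norm_triangle_diff[OF L(1,2)] L2_norm_triangle_diff[OF L(2,1)]
          L2_norm_minus_commute[of "u t" "u t'"] by simp
  qed simp
  then show "((\<lambda>t. L2_norm (u t)) \<longlongrightarrow> L2_norm (u t)) (at t within {0..T})"
    using LIM_zero_iff tendsto_rabs_zero_iff by blast
qed

text \<open>Cauchy-Schwarz in \<open>\<theta>\<close> and Tonelli's theorem for the increment of the profile, which starts from zero.\<close>

lemma L2_norm_u_hat_le:
  assumes t: "t0 \<in> {0..T}" "t \<in> {0..T}" and z: "L2_norm (u t0) = 0" and b: "b \<ge> 0"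
    and bound: "\<And>\<theta>. \<theta> \<in> {0..1} \<Longrightarrow> L2_norm (nonlin_hat (path t0 t \<theta>)) \<le> b"
  shows "L2_norm (u_hat t) \<le> \<bar>t - t0\<bar> * b"
proof -
  have pin: "path t0 t \<theta> \<in> {0..T}" if "\<theta> \<in> {0..1}" for \<theta> by (rule path_in[OF t that])
  define q where "q p = indicator ({0..1} \<times> UNIV) p *\<^sub>R nonlin_hat (path t0 t (fst p)) (snd p)" for
      p :: "real \<times> (real ^ 'n::{finite,one})"
  have [measurable]: "q \<in> borel_measurable borel"
    unfolding q_def[abs_def]
    by (intro borel_measurable_continuous_on_indicator continuous_on_nonlin_hat
        continuous_on_compose2[OF continuous_path[of UNIV]] continuous_intros)
       (use pin in \<open>auto intro: borel_closed closed_Times\<close>)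
  have qm [measurable]: "q \<in> borel_measurable (lborel \<Otimes>\<^sub>M lborel)" unfolding lborel_prod by simp
  have pt: "ennreal ((norm (u_hat t \<xi>))\<^sup>2) \<le> ennreal ((t - t0)\<^sup>2)
      * (\<integral>\<^sup>+\<theta>. ennreal ((norm (q (\<theta>, \<xi>)))\<^sup>2) \<partial>lborel)" for \<xi>
  proof -
    define g where "g \<theta> = forcing (path t0 t \<theta>) \<xi>" for \<theta>
    have cg: "continuous_on {0..1} g" unfolding g_def by (intro continuous_on_forcing
        continuous_intros) (use pin in auto)
    have "profile t0 \<xi> = 0" by (simp add: profile_def zero_of_L2_norm[OF t(1) z])
    then have "norm (u_hat t \<xi>) = \<bar>t - t0\<bar> * norm (integral {0..1} g)"
      using profile_increment[OF t, of \<xi>] norm_profile[of t \<xi>] by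
          (simp add: g_def[abs_def] norm_mult del: of_real_diff)
    then have "(norm (u_hat t \<xi>))\<^sup>2 = (t - t0)\<^sup>2 * (norm (integral {0..1} g))\<^sup>2" by
        (simp add: power_mult_distrib)
    then have "ennreal ((norm (u_hat t \<xi>))\<^sup>2) = ennreal ((t - t0)\<^sup>2)
        * ennreal ((norm (integral {0..1} g))\<^sup>2)"
      by (simp add: ennreal_mult)
    also have "\<dots> \<le> ennreal ((t - t0)\<^sup>2) * (\<integral>\<^sup>+\<theta>. indicator {0..1} \<theta> * ennreal ((norm (g \<theta>))\<^sup>2) \<partial>lborel)"
      by (intro mult_left_mono norm_integral_sq_le cg) simp
    also have "(\<integral>\<^sup>+\<theta>. indicator {0..1} \<theta> * ennreal ((norm (g \<theta>))\<^sup>2) \<partial>lborel)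
        = (\<integral>\<^sup>+\<theta>. ennreal ((norm (q (\<theta>, \<xi>)))\<^sup>2) \<partial>lborel)"
      by (intro nn_integral_cong) (simp add: q_def g_def norm_forcing indicator_def)
    finally show ?thesis .
  qed
  have "ennreal ((L2_norm (u_hat t))\<^sup>2) = (\<integral>\<^sup>+\<xi>. ennreal ((norm (u_hat t \<xi>))\<^sup>2) \<partial>lborel)"
    unfolding L2_norm_sq using L2_spaceD(2)[OF u_hat_L2[OF t(2)]]
        by (intro nn_integral_eq_integral[symmetric]) auto
  also have "\<dots> \<le> (\<integral>\<^sup>+\<xi>. ennreal ((t - t0)\<^sup>2) * (\<integral>\<^sup>+\<theta>. ennreal ((norm (q (\<theta>, \<xi>)))\<^sup>2) \<partial>lborel) \<partial>lborel)"
    by (intro nn_integral_mono pt)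
  also have "\<dots> = ennreal ((t - t0)\<^sup>2) * (\<integral>\<^sup>+\<xi>. \<integral>\<^sup>+\<theta>. ennreal ((norm (q (\<theta>, \<xi>)))\<^sup>2) \<partial>lborel \<partial>lborel)"
    by (rule nn_integral_cmult) measurable
  also have "(\<integral>\<^sup>+\<xi>. \<integral>\<^sup>+\<theta>. ennreal ((norm (q (\<theta>, \<xi>)))\<^sup>2) \<partial>lborel \<partial>lborel)
      = (\<integral>\<^sup>+\<theta>. \<integral>\<^sup>+\<xi>. ennreal ((norm (q (\<theta>, \<xi>)))\<^sup>2) \<partial>lborel \<partial>lborel)"
    by (rule lborel_pair.Fubini'[symmetric]) measurable
  also have "\<dots> \<le> (\<integral>\<^sup>+\<theta>. indicator {0..1} \<theta> * ennreal (b\<^sup>2) \<partial>(lborel :: real measure))"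
  proof (rule nn_integral_mono)
    fix \<theta> :: real
    show "(\<integral>\<^sup>+\<xi>. ennreal ((norm (q (\<theta>, \<xi>)))\<^sup>2) \<partial>lborel) \<le> indicator {0..1} \<theta> * ennreal (b\<^sup>2)"
    proof (cases "\<theta> \<in> {0..1}")
      case True
      have "(\<integral>\<^sup>+\<xi>. ennreal ((norm (q (\<theta>, \<xi>)))\<^sup>2) \<partial>lborel)
          = ennreal ((L2_norm (nonlin_hat (path t0 t \<theta>)))\<^sup>2)"
        unfolding L2_norm_sq using L2_spaceD(2)[OF nonlin_hat_L2[OF pin[OF True]]] True
        by (subst nn_integral_eq_integral[symmetric]) (auto simp: q_def)
      also have "\<dots> \<le> ennreal (b\<^sup>2)" using bound[OF True] by (intro ennreal_leI power_mono) auto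
      finally show ?thesis using True by simp
    qed (simp add: q_def)
  qed
  also have "\<dots> = ennreal (b\<^sup>2)" by (simp add: nn_integral_multc)
  finally have "ennreal ((L2_norm (u_hat t))\<^sup>2) \<le> ennreal ((t - t0)\<^sup>2) * ennreal (b\<^sup>2)"
    by (simp add: mult_left_mono)
  also have "\<dots> = ennreal ((\<bar>t - t0\<bar> * b)\<^sup>2)" by (simp add: ennreal_mult power_mult_distrib)
  finally have "(L2_norm (u_hat t))\<^sup>2 \<le> (\<bar>t - t0\<bar> * b)\<^sup>2" by simp
  then show ?thesis by (rule power2_le_imp_le) (use b in simp)
qed

text \<open>Near \<open>t0\<close> the solution is small, since it is continuous and vanishes at \<open>t0\<close>; so the nonlinear term is bounded by a fixed
multiple of the \<open>L\<^sup>2\<close> norm of \<open>u\<close>. If \<open>d\<close> is small enough, then integrating over a time at most \<open>d\<close>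
    improves
every uniform bound of this norm by the factor \<open>1/2\<close>.\<close>

lemma zero_nearby:
  assumes t0: "t0 \<in> {0..T}" and z: "L2_norm (u t0) = 0"
  shows "\<exists>d>0. \<forall>t\<in>{0..T}. \<bar>t - t0\<bar> < d \<longrightarrow> L2_norm (u t) = 0"
proof -
  define c where "c = (2 * pi) ^ DIM(real ^ 'n::{finite,one})"
  have c: "c > 0" by (simp add: c_def)
  define A where "A = sqrt (2 * integral\<^sup>L lborel (decay :: real ^ 'n::{finite,one} \<Rightarrow> real))"
  have A: "A \<ge> 0" by (simp add: A_def)
  have "eventually (\<lambda>t. sobolev_norm (real CARD('n) + 1) (cplx (\<lambda>x. u t x - u t0 x))
      < 1) (at t0 within {0..T})"
    by (rule order_tendstoD(2)[OF sobolev_tendsto[OF t0]]) simp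
  moreover have "eventually (\<lambda>t. L2_norm (\<lambda>x. u t x - u t0 x) < 1) (at t0 within {0..T})"
    by (rule order_tendstoD(2)[OF L2_tendsto[OF t0]]) simp
  ultimately have "eventually (\<lambda>t. sobolev_norm (real CARD('n) + 1) (cplx (\<lambda>x. u t x - u t0 x)) < 1
      \<and> L2_norm (\<lambda>x. u t x - u t0 x) < 1) (at t0 within {0..T})"
    by (rule eventually_conj)
  then obtain d1 where d1: "d1 > 0" and near: "\<forall>t\<in>{0..T}. t \<noteq> t0 \<and> dist t t0 < d1 \<longrightarrow>
      sobolev_norm (real CARD('n) + 1) (cplx (\<lambda>x. u t x - u t0 x)) < 1 \<and> L2_norm (\<lambda>x. u t x
          - u t0 x) < 1"
    unfolding eventually_at by (elim exE conjE)
  define B where "B = A + 1"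
  have B: "B > 0" "A \<le> B" using A by (simp_all add: B_def)
  have algebra: "s * s / (2 * B) * (A / s * x) = s * (A / B * (1/2 * x))" if "s > 0" for s x :: real
    using that B by (simp add: field_simps)
  \<comment> \<open>The second bound gives \<open>d * (A / sqrt c) \<le> sqrt c / 2\<close>, the contraction of the iteration.\<close>
  define d where "d = min d1 (c / (2 * B))"
  have d: "d > 0" using d1 c B by (simp add: d_def)
  have AE0: "AE x in lborel. u t0 x = 0" by (rule zero_of_L2_norm[OF t0 z])
  have small: "L2_norm (u t) \<le> 1" and nonlin_hat_le: "L2_norm (nonlin_hat t) \<le> A / sqrt c
      * L2_norm (u t)"
    if t: "t \<in> {0..T}" "\<bar>t - t0\<bar> < d" for t
  proof -
    have eqd: "L2_norm (\<lambda>x. u t x - u t0 x) = L2_norm (u t)"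
    proof (rule L2_norm_cong_AE)
      show "AE x in lborel. norm (u t x - u t0 x) = norm (u t x)" using AE0 by eventually_elim simp
    qed (use Z_spaceD(1)[OF u_Z[OF t(1)]] Z_spaceD(1)[OF u_Z[OF t0]] in auto)
    have F_eq: "fourier_L1 (cplx (\<lambda>x. u t x - u t0 x)) = fourier_L1 (cplx (u t))"
    proof (rule fourier_L1_cong_AE)
      show "AE x in lborel. cplx (\<lambda>x. u t x - u t0 x) x = cplx (u t) x" using AE0 by eventually_elim simp
    qed (use Z_spaceD(1)[OF u_Z[OF t(1)]] Z_spaceD(1)[OF u_Z[OF t0]] in auto)
    have sob: "sobolev_norm (real CARD('n) + 1) (cplx (\<lambda>x. u t x - u t0 x)) \<le> 1 \<and> L2_norm (u t)
        \<le> 1 \<or> t = t0"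
      using near t d1 unfolding eqd[symmetric] by (auto simp: dist_real_def d_def less_imp_le)
    show "L2_norm (u t) \<le> 1" using sob z by auto
    note fb = L2_norm_nonlin_le[OF t(1)]
    have nonneg: "0 \<le> sqrt c * L2_norm (nonlin t)" using c by simp
    have LN: "L2_norm (nonlin_hat t) = sqrt c * L2_norm (nonlin t)"
      unfolding fourier_nonlin[OF t(1), symmetric] c_def
          by (rule Plancherel[OF nonlin_integrable[OF t(1)] nonlin_L2[OF t(1)]])
    show "L2_norm (nonlin_hat t) \<le> A / sqrt c * L2_norm (u t)"
    proof (cases "t = t0")
      case True
      then have "L2_norm (nonlin t) \<le> 0" using fb z by simp
      then have "L2_norm (nonlin t) = 0" using L2_norm_nonneg[of "nonlin t"] by linarith
      then show ?thesis using LN True z by simp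
    next
      case False
      have "(LINT \<xi>|lborel. (1 + norm \<xi>) * norm (fourier_L1 (cplx (u t)) \<xi>)) \<le> A
          * sobolev_norm (real CARD('n) + 1) (cplx (\<lambda>x. u t x - u t0 x))"
        using Z_space_fourier_L1_le[OF u_diff_Z[OF t0 t(1)]] unfolding F_eq A_def by simp
      also have "\<dots> \<le> A * 1" using sob False A by (intro mult_left_mono) auto
      finally have "(LINT \<xi>|lborel. (1 + norm \<xi>) * norm (fourier_L1 (cplx (u t)) \<xi>)) / c
          * L2_norm (u t) \<le> A / c * L2_norm (u t)"
        using c by (intro mult_right_mono divide_right_mono) auto
      with fb have "L2_norm (nonlin t) \<le> A / c * L2_norm (u t)" unfolding c_def by linarith
      then have "L2_norm (nonlin_hat t) \<le> sqrt c * (A / c * L2_norm (u t))" unfolding LN using c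
          by (intro mult_left_mono) auto
      also have "\<dots> = A / sqrt c * L2_norm (u t)" using c by (simp add: field_simps)
      finally show ?thesis .
    qed
  qed
  have iter: "L2_norm (u t) \<le> (1/2) ^ k" if "t \<in> {0..T}" "\<bar>t - t0\<bar> < d" for t k
    using that
  proof (induction k arbitrary: t)
    case 0
    then show ?case using small by simp
  next
    case (Suc k)
    have path_near: "\<bar>path t0 t \<theta> - t0\<bar> < d" if "\<theta> \<in> {0..1}" for \<theta>
    proof -
      have "\<bar>path t0 t \<theta> - t0\<bar> = \<theta> * \<bar>t - t0\<bar>" using that by (simp add: path_def abs_mult)
      also have "\<dots> \<le> 1 * \<bar>t - t0\<bar>" using that by (intro mult_right_mono) auto
      finally show ?thesis using Suc.prems by simp
    qed
    have b: "L2_norm (nonlin_hat (path t0 t \<theta>)) \<le> A / sqrt c * (1/2) ^ k" if \<theta>: "\<theta> \<in> {0..1}" for \<theta>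
    proof -
      have p: "path t0 t \<theta> \<in> {0..T}" by (rule path_in[OF t0 Suc.prems(1) \<theta>])
      have "L2_norm (nonlin_hat (path t0 t \<theta>)) \<le> A / sqrt c * L2_norm (u (path t0 t \<theta>))"
        by (rule nonlin_hat_le[OF p path_near[OF \<theta>]])
      also have "\<dots> \<le> A / sqrt c * (1/2) ^ k"
        using Suc.IH[OF p path_near[OF \<theta>]] A c by (intro mult_left_mono) auto
      finally show ?thesis .
    qed
    have "sqrt c * L2_norm (u t) \<le> \<bar>t - t0\<bar> * (A / sqrt c * (1/2) ^ k)"
      using L2_norm_u_hat_le[OF t0 Suc.prems(1) z _ b] A c Plancherel_u[OF Suc.prems(1)] by
          (simp add: c_def)
    also have "\<dots> \<le> c / (2 * B) * (A / sqrt c * (1/2) ^ k)"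
      using Suc.prems A c by (intro mult_right_mono) (auto simp: d_def)
    also have "\<dots> = sqrt c * (A / B * (1/2) ^ Suc k)" using c algebra[of "sqrt c" "(1/2) ^ k"] by simp
    also have "\<dots> \<le> sqrt c * (1 * (1/2) ^ Suc k)"
      using c A B by (intro mult_left_mono mult_right_mono) auto
    finally show ?case using c by simp
  qed
  have "L2_norm (u t) = 0" if "t \<in> {0..T}" "\<bar>t - t0\<bar> < d" for t
  proof -
    have "(\<lambda>k. (1/2::real) ^ k) \<longlonglongrightarrow> 0" by (rule LIMSEQ_power_zero) simp
    then have "L2_norm (u t) \<le> 0" by (rule LIMSEQ_le_const) (use iter[OF that] in auto)
    then show ?thesis using L2_norm_nonneg[of "u t"] by linarith
  qed
  then show ?thesis using d by blast
qed

text \<open>The zero set of the norm is closed by continuity, open by the local result, and the interval is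
connected.\<close>

lemma zero_everywhere:
  assumes t0: "t0 \<in> {0..T}" and z: "L2_norm (u t0) = 0" and t: "t \<in> {0..T}"
  shows "AE x in lborel. u t x = 0"
proof -
  define Z where "Z = {t \<in> {0..T}. L2_norm (u t) = 0}"
  have cl: "closedin (top_of_set {0..T}) Z"
    unfolding Z_def by (rule continuous_closedin_preimage_constant[OF continuous_L2_norm_u])
  have op: "openin (top_of_set {0..T}) Z"
    unfolding openin_euclidean_subtopology_iff
  proof (intro conjI ballI)
    show "Z \<subseteq> {0..T}" by (auto simp: Z_def)
    fix s assume "s \<in> Z"
    then have s: "s \<in> {0..T}" "L2_norm (u s) = 0" by (auto simp: Z_def)
    from zero_nearby[OF s] show "\<exists>e>0. \<forall>x'\<in>{0..T}. dist x' s < e \<longrightarrow> x' \<in> Z"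
      by (auto simp: Z_def dist_real_def)
  qed
  have "Z = {} \<or> Z = {0..T}"
    using connected_clopen[THEN iffD1, OF connected_Icc, rule_format, OF conjI, OF op cl] .
  moreover have "t0 \<in> Z" using t0 z by (simp add: Z_def)
  ultimately have "t \<in> Z" using t by blast
  then have "L2_norm (u t) = 0" by (simp add: Z_def)
  then show ?thesis by (rule zero_of_L2_norm[OF t])
qed

end

section \<open>The sixth difference at low frequencies\<close>

text \<open>The sixth central difference of \<open>cos\<close> at the origin with step \<open>\<theta>\<close>, up to the sign.\<close>

lemma sin_sixth: "64 * sin (\<theta> / 2) ^ 6 = 20 - 30 * cos \<theta> + 12 * cos (2 * \<theta>) - 2 * cos (3
    * \<theta>)" for \<theta> :: real
proof -
  have s: "(sin (\<theta> / 2))\<^sup>2 = (1 - cos \<theta>) / 2"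
    using cos_double_sin[of "\<theta> / 2"] by simp
  have "64 * sin (\<theta> / 2) ^ 6 = 64 * ((sin (\<theta> / 2))\<^sup>2) ^ 3" by (simp add: power_mult[symmetric])
  also have "\<dots> = 20 - 30 * cos \<theta> + 12 * (2 * (cos \<theta>)\<^sup>2 - 1) - 2 * (4 * cos \<theta> ^ 3 - 3 * cos \<theta>)"
    unfolding s by (simp add: power2_eq_square power3_eq_cube field_simps)
  finally show ?thesis by (simp only: cos_double_cos cos_treble_cos)
qed

text \<open>The combination is \<open>12 sin \<theta> (1 - cos \<theta>)\<^sup>2\<close>. Its coefficients are those of the sixth difference,
multiplied by the factors \<open>3\<close>, \<open>2\<close>, \<open>1\<close> that \<open>l\<close> acquires.\<close>

lemma sin_combination_le: "\<bar>3 * sin (3 * \<theta>) - 12 * sin (2 * \<theta>) + 15 * sin \<theta>\<bar> \<le> 12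
    * \<bar>\<theta>\<bar> ^ 3" for \<theta> :: real
proof -
  define c where "c = 1 - cos \<theta>"
  have c0: "0 \<le> c" "c \<le> 2" using cos_le_one[of \<theta>] cos_ge_minus_one[of \<theta>] unfolding c_def by linarith+
  have "c = 2 * (sin (\<theta> / 2))\<^sup>2"
    using cos_double_sin[of "\<theta> / 2"] by (simp add: c_def)
  moreover have "(sin (\<theta> / 2))\<^sup>2 \<le> (\<theta> / 2)\<^sup>2"
    using abs_sin_x_le_abs_x[of "\<theta> / 2"] by (simp only: abs_le_square_iff)
  ultimately have c2: "2 * c \<le> \<theta>\<^sup>2" by (simp add: power_divide)
  have "c\<^sup>2 \<le> 2 * c" using c0 by (simp add: power2_eq_square mult_right_mono)
  then have c3: "c\<^sup>2 \<le> \<theta>\<^sup>2" using c2 by linarith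
  have s3: "sin (3 * \<theta>) = sin \<theta> * (4 * (cos \<theta>)\<^sup>2 - 1)"
  proof -
    have "sin (2 * \<theta> + \<theta>) = sin \<theta> * (2 * (cos \<theta>)\<^sup>2 + (2 * (cos \<theta>)\<^sup>2 - 1))"
      unfolding sin_add sin_double cos_double_cos by (simp add: power2_eq_square algebra_simps)
    then show ?thesis by (simp add: algebra_simps)
  qed
  have "3 * sin (3 * \<theta>) - 12 * sin (2 * \<theta>) + 15 * sin \<theta> = 12 * (sin \<theta> * c\<^sup>2)"
    unfolding s3 sin_double c_def by (simp add: power2_eq_square algebra_simps)
  also have "\<bar>\<dots>\<bar> = 12 * (\<bar>sin \<theta>\<bar> * c\<^sup>2)" by (simp add: abs_mult)
  also have "\<dots> \<le> 12 * (\<bar>\<theta>\<bar> * \<theta>\<^sup>2)"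
    using c3 abs_sin_x_le_abs_x[of \<theta>] by (intro mult_left_mono mult_mono) auto
  also have "\<dots> = 12 * \<bar>\<theta>\<bar> ^ 3" by (simp add: power3_eq_cube power2_eq_square)
  finally show ?thesis .
qed

lemma cmod_exp_i_minus_1_le: "norm (iexp x - 1) \<le> \<bar>x\<bar>"
  using iexp_approx1[of x 0] by simp

lemma exp_difference_quotient:
  fixes z :: complex
  assumes "\<mu> \<longlonglongrightarrow> 0" "\<And>k. \<mu> k \<noteq> (0::real)"
  shows "(\<lambda>k. (exp (complex_of_real (\<mu> k) * z) - 1) / complex_of_real (\<mu> k)) \<longlonglongrightarrow> z"
proof -
  have "((\<lambda>s. exp (s * z)) has_field_derivative z) (at 0)"
    by (auto intro!: derivative_eq_intros)
  then have lim: "((\<lambda>h. (exp (h * z) - 1) / h) \<longlongrightarrow> z) (at 0)"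
    by (simp add: has_field_derivative_iff)
  have "filterlim (\<lambda>k. complex_of_real (\<mu> k)) (at 0) sequentially"
    unfolding filterlim_at using assms tendsto_of_real[OF assms(1), where 'a = complex] by simp
  from filterlim_compose[OF lim this] show ?thesis .
qed

lemma fourier_L1_ray_Re:
  fixes f :: "'a::euclidean_space \<Rightarrow> real"
  assumes f: "integrable lborel f"
  shows "Re (fourier_L1 (cplx f) (l *\<^sub>R e)) = (LINT x|lborel. cos (l * (x \<bullet> e)) * f x)"
proof -
  have i: "integrable lborel (\<lambda>x. iexp_conj (x \<bullet> (l *\<^sub>R e)) * cplx f x)"
    using f by (intro integrable_fourier_kernel) simp
  have "Re (fourier_L1 (cplx f) (l *\<^sub>R e)) = (LINT x|lborel. Re (iexp_conj (x \<bullet> (l *\<^sub>R e)) * cplx f x))"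
    unfolding fourier_L1_def by (rule integral_Re[OF i, symmetric])
  then show ?thesis by (simp add: Re_exp)
qed

lemma integrable_bounded_mult:
  fixes f g :: "'a::euclidean_space \<Rightarrow> real"
  assumes f: "integrable lborel f" and g: "g \<in> borel_measurable borel" "\<And>x. \<bar>g x\<bar> \<le> B"
  shows "integrable lborel (\<lambda>x. g x * f x)"
proof (rule Bochner_Integration.integrable_bound)
  have B: "B \<ge> 0" using g(2)[of undefined] by linarith
  show "integrable lborel (\<lambda>x. B * f x)" using f by simp
  show "AE x in lborel. norm (g x * f x) \<le> norm (B * f x)"
    using g(2) B by (intro AE_I2) (simp add: abs_mult mult_right_mono)
qed (use g f in auto)

lemma fourier_ray_sixth_difference:
  fixes f :: "'a::euclidean_space \<Rightarrow> real" and e :: 'a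
  assumes f: "integrable lborel f"
  defines "R \<equiv> \<lambda>l. Re (fourier_L1 (cplx f) (l *\<^sub>R e))"
  shows "20 * R 0 - 30 * R l + 12 * R (2 * l) - 2 * R (3 * l)
    = 64 * (LINT x|lborel. sin (l * (x \<bullet> e) / 2) ^ 6 * f x)"
proof -
  have i: "integrable lborel (\<lambda>x. cos (l * (x \<bullet> e)) * f x)" for l
    by (rule integrable_bounded_mult[OF f, of _ 1]) auto
  have "64 * (LINT x|lborel. sin (l * (x \<bullet> e) / 2) ^ 6 * f x) = (LINT x|lborel. (64 * sin (l
      * (x \<bullet> e) / 2) ^ 6) * f x)"
    unfolding mult.assoc integral_mult_right_zero ..
  also have "\<dots> = (LINT x|lborel. 20 * (cos (0 * (x \<bullet> e)) * f x) - 30 * (cos (l * (x \<bullet> e)) * f x)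
      + 12 * (cos ((2 * l) * (x \<bullet> e)) * f x) - 2 * (cos ((3 * l) * (x \<bullet> e)) * f x))"
    unfolding sin_sixth by (intro Bochner_Integration.integral_cong) (simp_all add: algebra_simps)
  also have "\<dots> = 20 * R 0 - 30 * R l + 12 * R (2 * l) - 2 * R (3 * l)"
    unfolding R_def fourier_L1_ray_Re[OF f] using i i[of 0] by simp
  finally show ?thesis by simp
qed

text \<open>To be used with \<open>s = |sin (l x\<^sub>1/2)|\<close> and \<open>t = l |x|\<close>. For \<open>d \<le> 6\<close> the power of the sine compensates the
singularity of \<open>t\<^bsup>-d-6\<^esup>\<close> at the origin, and this function decays at least as fast as \<open>decay\<close> at
    infinity.\<close>

lemma decay_sin_bound:
  fixes t :: real
  assumes d: "d \<le> 6" and t: "t > 0" and s: "0 \<le> s" "s \<le> 1" "s \<le> t"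
  shows "s ^ 12 \<le> 2 ^ d * t ^ (d + 6) / (1 + t\<^sup>2) ^ d"
proof (cases "t \<le> 1")
  case True
  have "s ^ 12 * (1 + t\<^sup>2) ^ d \<le> t ^ 12 * 2 ^ d"
    using s t True by (intro mult_mono power_mono) (auto simp: power_le_one)
  also have "\<dots> \<le> t ^ (d + 6) * 2 ^ d"
    using t True d by (intro mult_right_mono power_decreasing) auto
  finally show ?thesis using t by (simp add: field_simps add_pos_nonneg)
next
  case False
  have "(1 + t\<^sup>2) ^ d \<le> (2 * t\<^sup>2) ^ d" using False by (intro power_mono) auto
  also have "\<dots> = 2 ^ d * t ^ (2 * d)" by (simp add: power_mult_distrib power_mult)
  also have "\<dots> \<le> 2 ^ d * t ^ (d + 6)" using False d by (intro mult_left_mono power_increasing) auto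
  finally have "1 \<le> 2 ^ d * t ^ (d + 6) / (1 + t\<^sup>2) ^ d" by (simp add: field_simps add_pos_nonneg)
  moreover have "s ^ 12 \<le> 1" using s by (simp add: power_le_one)
  ultimately show ?thesis by linarith
qed

text \<open>Cauchy-Schwarz with the weight \<open>|x|\<^bsup>d/2+3\<^esup>\<close> gives the factor \<open>l\<^sup>3\<close> by scaling, and no more. The region
\<open>|x| \<le> R\<close> contributes only \<open>O(l\<^sup>6)\<close>, however, and on its complement the weighted norm of \<open>f\<close> is as
    small as
desired.\<close>

lemma weighted_low_frequency:
  fixes f :: "'a::euclidean_space \<Rightarrow> real"
  assumes f: "integrable lborel f" and w: "(\<lambda>x. norm x powr (real DIM('a) / 2 + 3) * f x) \<in> L2_space"
    and d: "DIM('a) \<le> 6" and e: "norm e = 1" and \<mu>: "\<mu> \<longlonglongrightarrow> 0" "\<And>k. \<mu> k > 0"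
  shows "(\<lambda>k. (LINT x|lborel. sin (\<mu> k * (x \<bullet> e) / 2) ^ 6 * f x) / \<mu> k ^ 3) \<longlonglongrightarrow> 0"
proof (rule LIMSEQ_I)
  fix \<epsilon> :: real assume \<epsilon>: "\<epsilon> > 0"
  note fm [measurable] = borel_measurable_integrable[OF f]
  define w where "w x = norm x powr (real DIM('a) / 2 + 3) * f x" for x
  have wL: "w \<in> L2_space" using w by (simp add: w_def[abs_def])
  then have wcL: "cplx w \<in> L2_space" by (auto simp: L2_space_def)
  note [measurable] = L2_spaceD(1)[OF wL]
  define I where "I = integral\<^sup>L lborel (decay :: 'a \<Rightarrow> real)"
  have I: "I \<ge> 0" by (simp add: I_def)
  define C where "C = sqrt (2 ^ DIM('a) * I)"
  have C: "C \<ge> 0" using I by (simp add: C_def)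
  have "eventually (\<lambda>R. L2_norm (\<lambda>x. truncate R (cplx w) x - cplx w x) < \<epsilon> / (2 * (C + 1))) at_top"
    by (rule order_tendstoD(2)[OF truncate_tendsto[OF wcL]]) (use \<epsilon> C in simp)
  then obtain R where R: "L2_norm (\<lambda>x. truncate R (cplx w) x - cplx w x) < \<epsilon> / (2 * (C + 1))"
    using eventually_happens'[OF trivial_limit_at_top_linorder] by blast
  define wt where "wt x = indicator (- cball 0 R) x * \<bar>w x\<bar>" for x
  have wt_norm: "L2_norm (\<lambda>x. truncate R (cplx w) x - cplx w x) = sqrt (LINT x|lborel. (wt x)\<^sup>2)"
    unfolding L2_norm_def
    by (intro arg_cong[where f = sqrt] Bochner_Integration.integral_cong)
        (auto simp: wt_def indicator_def)
  have wtm [measurable]: "wt \<in> borel_measurable lborel" unfolding wt_def[abs_def] by measurable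
  have wti: "integrable lborel (\<lambda>x. (wt x)\<^sup>2)"
    by (rule Bochner_Integration.integrable_bound[OF L2_spaceD(2)[OF wL]])
        (auto simp: wt_def indicator_def)
  have key: "\<bar>LINT x|lborel. sin (l * (x \<bullet> e) / 2) ^ 6 * f x\<bar>
      \<le> l ^ 6 * (\<bar>R\<bar> ^ 6 * (LINT x|lborel. \<bar>f x\<bar>)) + l ^ 3 * (C * (\<epsilon> / (2 * (C
          + 1))))" if l: "l > 0" for l
  proof -
    define s where "s x = \<bar>sin (l * (x \<bullet> e) / 2)\<bar>" for x
    have s: "0 \<le> s x" "s x \<le> 1" "s x \<le> l * norm x" for x
    proof -
      show "0 \<le> s x" "s x \<le> 1" by (auto simp: s_def)
      have "s x \<le> \<bar>l * (x \<bullet> e) / 2\<bar>" unfolding s_def by (rule abs_sin_x_le_abs_x)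
      also have "\<dots> = l * \<bar>x \<bullet> e\<bar> / 2" using l by (simp add: abs_mult)
      also have "\<dots> \<le> l * norm x / 2"
        using Cauchy_Schwarz_ineq2[of x e] e l by (intro divide_right_mono mult_left_mono) auto
      also have "\<dots> \<le> l * norm x" using l by simp
      finally show "s x \<le> l * norm x" .
    qed
    have [measurable]: "s \<in> borel_measurable borel" unfolding s_def[abs_def] by measurable
    \<comment> \<open>The factor paired with the weighted \<open>f\<close> by Cauchy-Schwarz; its squared norm scales like \<open>l ^ 6\<close>.\<close>
    define h where "h x = s x ^ 6 * norm x powr (- (real DIM('a) / 2 + 3))" for x
    have [measurable]: "h \<in> borel_measurable lborel" unfolding h_def[abs_def] by measurable
    have h2: "(h x)\<^sup>2 \<le> 2 ^ DIM('a) * l ^ (DIM('a) + 6) * decay (l *\<^sub>R x)" for x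
    proof (cases "x = 0")
      case True
      then show ?thesis using l by (simp add: h_def)
    next
      case False
      then have x: "norm x > 0" by simp
      have "(norm x powr (- (real DIM('a) / 2 + 3)))\<^sup>2 = norm x powr (- real (DIM('a) + 6))"
        unfolding power2_eq_square powr_add[symmetric]
        by (rule arg_cong[where f = "\<lambda>z. norm x powr z"]) simp
      also have "\<dots> = 1 / norm x ^ (DIM('a) + 6)"
        using x by (subst powr_minus, subst powr_realpow) (auto simp: inverse_eq_divide)
      finally have "(h x)\<^sup>2 = s x ^ 12 / norm x ^ (DIM('a) + 6)"
        by (simp add: h_def power_mult_distrib power_mult[symmetric])
      also have "\<dots> \<le> (2 ^ DIM('a) * (l * norm x) ^ (DIM('a) + 6) / (1 + (l
          * norm x)\<^sup>2) ^ DIM('a)) / norm x ^ (DIM('a) + 6)"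
        by (intro divide_right_mono decay_sin_bound d s mult_pos_pos l x) auto
      also have "\<dots> = 2 ^ DIM('a) * l ^ (DIM('a) + 6) * decay (l *\<^sub>R x)"
        using x l by (simp add: decay_def power_mult_distrib del: power_Suc)
      finally show ?thesis .
    qed
    have di: "integrable lborel (\<lambda>x::'a. 2 ^ DIM('a) * l ^ (DIM('a) + 6) * decay (l *\<^sub>R x))"
      using integrable_lborel_affine_iff[of "decay :: 'a \<Rightarrow> real" l 0] integrable_decay l by simp
    have hi: "integrable lborel (\<lambda>x. (h x)\<^sup>2)"
      by (rule Bochner_Integration.integrable_bound[OF di])
          (auto intro!: AE_I2 order_trans[OF h2] simp del: power_Suc)
    have "(LINT x|lborel. (h x)\<^sup>2) \<le> (LINT x|lborel. 2 ^ DIM('a) * l ^ (DIM('a) + 6)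
        * decay (l *\<^sub>R (x::'a)))"
      by (rule integral_mono[OF hi di h2])
    also have "\<dots> = 2 ^ DIM('a) * l ^ (DIM('a) + 6) * (1 / l ^ DIM('a) * I)"
      using integral_lborel_affine[of "decay :: 'a \<Rightarrow> real" l 0] l by (simp add: I_def)
    also have "\<dots> = (l ^ 3)\<^sup>2 * (2 ^ DIM('a) * I)" using l by (simp add: power_add power_mult[symmetric])
    finally have "sqrt (LINT x|lborel. (h x)\<^sup>2) \<le> sqrt ((l ^ 3)\<^sup>2 * (2 ^ DIM('a) * I))"
      by (rule real_sqrt_le_mono)
    also have "\<dots> = l ^ 3 * C"
      unfolding C_def real_sqrt_mult real_sqrt_abs using l by simp
    finally have hle: "sqrt (LINT x|lborel. (h x)\<^sup>2) \<le> l ^ 3 * C" .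
    have pw: "\<bar>sin (l * (x \<bullet> e) / 2) ^ 6 * f x\<bar> \<le> l ^ 6 * (\<bar>R\<bar> ^ 6 * \<bar>f x\<bar>) + \<bar>h x * wt x\<bar>" for x
    proof (cases "x \<in> cball 0 R")
      case True
      have "s x ^ 6 \<le> (l * norm x) ^ 6" using s by (intro power_mono) auto
      also have "\<dots> \<le> (l * \<bar>R\<bar>) ^ 6" using True l by (intro power_mono mult_left_mono) auto
      finally have "s x ^ 6 * \<bar>f x\<bar> \<le> (l * \<bar>R\<bar>) ^ 6 * \<bar>f x\<bar>" by (rule mult_right_mono) simp
      then show ?thesis
        by (simp add: s_def abs_mult power_abs power_mult_distrib mult.assoc add_increasing2)
    next
      case False
      show ?thesis
      proof (cases "x = 0")
        case True
        then show ?thesis by (simp add: add_nonneg_nonneg)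
      next
        case x: False
        have "h x * wt x = s x ^ 6 * (norm x powr (- (real DIM('a) / 2 + 3))
            * norm x powr (real DIM('a) / 2 + 3)) * \<bar>f x\<bar>"
          using False by (simp add: h_def wt_def w_def abs_mult indicator_def)
        also have "norm x powr (- (real DIM('a) / 2 + 3)) * norm x powr (real DIM('a) / 2 + 3) = 1"
          unfolding powr_add[symmetric] using x by simp
        finally have "\<bar>sin (l * (x \<bullet> e) / 2) ^ 6 * f x\<bar> = h x * wt x"
          by (simp add: s_def abs_mult power_abs)
        also have "\<dots> \<le> l ^ 6 * (\<bar>R\<bar> ^ 6 * \<bar>f x\<bar>) + \<bar>h x * wt x\<bar>" using l by (simp add: add_increasing)
        finally show ?thesis .
      qed
    qed
    have hw: "integrable lborel (\<lambda>x. h x * wt x)"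
      "(LINT x|lborel. \<bar>h x * wt x\<bar>) \<le> sqrt (LINT x|lborel. (h x)\<^sup>2) * sqrt (LINT x|lborel. (wt x)\<^sup>2)"
      by (rule Cauchy_Schwarz_integral; use hi wti in simp)+
    have "\<bar>LINT x|lborel. sin (l * (x \<bullet> e) / 2) ^ 6 * f x\<bar> \<le> (LINT x|lborel. \<bar>sin (l
        * (x \<bullet> e) / 2) ^ 6 * f x\<bar>)"
      by (rule integral_abs_bound)
    also have "\<dots> \<le> (LINT x|lborel. l ^ 6 * (\<bar>R\<bar> ^ 6 * \<bar>f x\<bar>) + \<bar>h x * wt x\<bar>)"
    proof (rule integral_mono[OF _ _ pw])
      show "integrable lborel (\<lambda>x. \<bar>sin (l * (x \<bullet> e) / 2) ^ 6 * f x\<bar>)"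
      proof (intro integrable_abs integrable_bounded_mult[OF f, of _ 1])
        show "\<bar>sin (l * (x \<bullet> e) / 2) ^ 6\<bar> \<le> 1" for x
          unfolding power_abs by (rule power_le_one) auto
      qed measurable
      show "integrable lborel (\<lambda>x. l ^ 6 * (\<bar>R\<bar> ^ 6 * \<bar>f x\<bar>) + \<bar>h x * wt x\<bar>)" using f hw by simp
    qed
    also have "\<dots> = l ^ 6 * (\<bar>R\<bar> ^ 6 * (LINT x|lborel. \<bar>f x\<bar>)) + (LINT x|lborel. \<bar>h x * wt x\<bar>)"
      using f hw by simp
    also have "(LINT x|lborel. \<bar>h x * wt x\<bar>) \<le> (l ^ 3 * C) * (\<epsilon> / (2 * (C + 1)))"
      using hw(2) hle R l C unfolding wt_norm by (intro order_trans[OF hw(2)] mult_mono) auto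
    finally show ?thesis by (simp add: mult.assoc)
  qed
  define D where "D = \<bar>R\<bar> ^ 6 * (LINT x|lborel. \<bar>f x\<bar>)"
  have "(\<lambda>k. \<mu> k ^ 3 * D) \<longlonglongrightarrow> 0 ^ 3 * D" by (intro tendsto_intros \<mu>)
  then have "eventually (\<lambda>k. \<mu> k ^ 3 * D < \<epsilon> / 2) sequentially" using \<epsilon> by (intro order_tendstoD(2)) auto
  then obtain n where n: "\<And>k. k \<ge> n \<Longrightarrow> \<mu> k ^ 3 * D < \<epsilon> / 2" by (auto simp: eventually_sequentially)
  have "C * (\<epsilon> / (2 * (C + 1))) \<le> \<epsilon> / 2" using C \<epsilon> by (simp add: field_simps)
  have "norm ((LINT x|lborel. sin (\<mu> k * (x \<bullet> e) / 2) ^ 6 * f x) / \<mu> k ^ 3 - 0) < \<epsilon>" if k: "k \<ge> n" for k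
  proof -
    have m: "\<mu> k ^ 3 > 0" using \<mu>(2)[of k] by simp
    have "\<bar>LINT x|lborel. sin (\<mu> k * (x \<bullet> e) / 2) ^ 6 * f x\<bar> \<le> \<mu> k ^ 6 * D + \<mu> k ^ 3 * (C * (\<epsilon> / (2
        * (C + 1))))"
      unfolding D_def by (rule key[OF \<mu>(2)])
    also have "\<mu> k ^ 6 * D = \<mu> k ^ 3 * (\<mu> k ^ 3 * D)" by
        (simp add: power_add[symmetric] mult.assoc[symmetric])
    also have "\<dots> + \<mu> k ^ 3 * (C * (\<epsilon> / (2 * (C + 1)))) = \<mu> k ^ 3 * (\<mu> k ^ 3 * D + C * (\<epsilon> / (2 * (C
        + 1))))"
      by (simp only: distrib_left)
    also have "\<dots> < \<mu> k ^ 3 * \<epsilon>"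
      using n[OF k] \<open>C * (\<epsilon> / (2 * (C + 1))) \<le> \<epsilon> / 2\<close> m by (intro mult_strict_left_mono) linarith+
    finally show ?thesis using m by (simp add: abs_divide divide_less_eq mult.commute del:
        zero_less_power)
  qed
  then show "\<exists>n. \<forall>k\<ge>n. norm ((LINT x|lborel. sin (\<mu> k * (x \<bullet> e) / 2) ^ 6 * f x) / \<mu> k ^ 3 - 0) < \<epsilon>"
      by blast
qed

context duhamel_solution
begin

section \<open>The expansion of Duhamel's formula along the first axis\<close>

abbreviation e1 :: "real ^ 'n::{finite,one}" where "e1 \<equiv> axis 1 1"

lemma norm_sq_hat_le:
  "norm (sq_hat \<tau> \<xi>) \<le> (L2_norm (u \<tau>))\<^sup>2"
proof -
  have "norm (sq_hat \<tau> \<xi>) \<le> (LINT x|lborel. norm (complex_of_real ((u \<tau> x)\<^sup>2)))"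
    unfolding sq_hat_def by (rule norm_fourier_L1_le)
  then show ?thesis by (simp add: L2_norm_sq norm_power)
qed

lemma sq_hat_at_0: "sq_hat \<tau> 0 = complex_of_real ((L2_norm (u \<tau>))\<^sup>2)"
  unfolding sq_hat_def fourier_L1_def L2_norm_sq by (simp flip: integral_complex_of_real)

lemma L2_norm_u_bounded: "\<exists>Y. \<forall>\<tau>\<in>{0..T}. L2_norm (u \<tau>) \<le> Y"
proof -
  have "bounded ((\<lambda>t. L2_norm (u t)) ` {0..T})"
    by (intro compact_imp_bounded compact_continuous_image continuous_L2_norm_u) simp
  then show ?thesis unfolding bounded_iff by (auto intro: order_trans[OF abs_ge_self])
qed

lemma weighted_norm_u_bounded:
  "\<exists>Y. \<forall>\<tau>\<in>{0..T}. L2_norm (\<lambda>x. norm x powr (real CARD('n) + 1) * u \<tau> x) \<le> Y"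
proof -
  define W where "W t = L2_norm (\<lambda>x. norm x powr (real CARD('n) + 1) * u t x)" for t
  have "continuous_on {0..T} W"
    unfolding continuous_on_def
  proof
    fix t assume t: "t \<in> {0..T}"
    have "((\<lambda>t'. \<bar>W t' - W t\<bar>) \<longlongrightarrow> 0) (at t within {0..T})"
    proof (rule tendsto_within_squeeze[OF weight_tendsto[OF t]])
      fix t' assume t': "t' \<in> {0..T}"
      note L = Z_spaceD(4)[OF u_Z[OF t]] Z_spaceD(4)[OF u_Z[OF t']]
      show "\<bar>W t' - W t\<bar> \<le> L2_norm (\<lambda>x. norm x powr (real CARD('n) + 1) * (u t' x - u t x))"
        using L2_norm_triangle_diff[OF L(1,2)] L2_norm_triangle_diff[OF L(2,1)]
          L2_norm_minus_commute[of "\<lambda>x. norm x powr (real CARD('n) + 1)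
              * u t x" "\<lambda>x. norm x powr (real CARD('n) + 1) * u t' x"]
        by (simp add: W_def right_diff_distrib)
    qed simp
    then show "(W \<longlongrightarrow> W t) (at t within {0..T})"
      using LIM_zero_iff tendsto_rabs_zero_iff by blast
  qed
  then have "bounded (W ` {0..T})"
    by (intro compact_imp_bounded compact_continuous_image) simp_all
  then show ?thesis unfolding bounded_iff W_def by (auto intro: order_trans[OF abs_ge_self])
qed

lemma
  assumes \<tau>: "\<tau> \<in> {0..T}"
  shows third_moment_integrable: "integrable lborel (\<lambda>x. \<bar>x $ 1\<bar> ^ 3 * (u \<tau> x)\<^sup>2)"
    and third_moment_le: "(LINT x|lborel. \<bar>x $ 1\<bar> ^ 3 * (u \<tau> x)\<^sup>2)
      \<le> (L2_norm (u \<tau>))\<^sup>2 + (L2_norm (\<lambda>x. norm x powr (real CARD('n) + 1) * u \<tau> x))\<^sup>2"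
proof -
  note Z = Z_spaceD[OF u_Z[OF \<tau>]]
  note [measurable] = Z(1)
  have int: "integrable lborel (\<lambda>x. (u \<tau> x)\<^sup>2 + (norm x powr (real CARD('n) + 1) * u \<tau> x)\<^sup>2)"
    using L2_spaceD(2)[OF Z(3)] L2_spaceD(2)[OF Z(4)] by simp
  have le: "\<bar>x $ 1\<bar> ^ 3 * (u \<tau> x)\<^sup>2 \<le> (u \<tau> x)\<^sup>2 + (norm x powr (real CARD('n) + 1) * u \<tau> x)\<^sup>2" for x
  proof -
    have "\<bar>x $ 1\<bar> ^ 3 \<le> norm x ^ 3" by (intro power_mono component_le_norm_cart) simp
    also have "norm x ^ 3 \<le> 1 + (norm x powr (real CARD('n) + 1))\<^sup>2"
    proof (cases "norm x \<le> 1")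
      case True
      then show ?thesis using power_le_one[of "norm x" 3] by (simp add: add_increasing2)
    next
      case False
      have "norm x powr (real CARD('n) + 1) = norm x ^ (CARD('n) + 1)"
      proof -
        have "norm x > 0" using False by linarith
        from powr_realpow[OF this, of "CARD('n) + 1"] show ?thesis by (simp add: add.commute)
      qed
      then have "(norm x powr (real CARD('n) + 1))\<^sup>2 = norm x ^ ((CARD('n) + 1) * 2)"
        by (simp only: power_mult)
      moreover have "norm x ^ 3 \<le> norm x ^ ((CARD('n) + 1) * 2)"
        using False zero_less_card_finite[where 'a = 'n] by (intro power_increasing) auto
      ultimately show ?thesis by simp
    qed
    finally have "\<bar>x $ 1\<bar> ^ 3 * (u \<tau> x)\<^sup>2 \<le> (1 + (norm x powr (real CARD('n) + 1))\<^sup>2) * (u \<tau> x)\<^sup>2"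
      by (rule mult_right_mono) simp
    then show ?thesis by (simp add: power_mult_distrib distrib_right)
  qed
  show i: "integrable lborel (\<lambda>x. \<bar>x $ 1\<bar> ^ 3 * (u \<tau> x)\<^sup>2)"
    by (rule Bochner_Integration.integrable_bound[OF int])
        (use le in \<open>auto intro!: AE_I2 simp: abs_mult\<close>)
  show "(LINT x|lborel. \<bar>x $ 1\<bar> ^ 3 * (u \<tau> x)\<^sup>2)
      \<le> (L2_norm (u \<tau>))\<^sup>2 + (L2_norm (\<lambda>x. norm x powr (real CARD('n) + 1) * u \<tau> x))\<^sup>2"
    using integral_mono[OF i int le] L2_spaceD(2)[OF Z(3)] L2_spaceD(2)[OF Z(4)]
    unfolding L2_norm_sq by simp
qed

lemma dispersion_ray: "l > 0 \<Longrightarrow> dispersion (l *\<^sub>R e1) = l\<^sup>2"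
  by (simp add: dispersion_def power2_eq_square)

text \<open>The transform vanishes at the origin, and the first moment is its derivative there.\<close>

lemma u_hat_ray_tendsto:
  assumes t: "t \<in> {0..T}" and \<mu>: "\<mu> \<longlonglongrightarrow> 0" "\<And>k. \<mu> k > 0"
  shows "(\<lambda>k. u_hat t (\<mu> k *\<^sub>R e1) / complex_of_real (\<mu> k)) \<longlonglongrightarrow> - \<i>
      * complex_of_real (LINT x|lborel. x $ 1 * u t x)"
proof -
  note L = Z_space_L1[OF u_Z[OF t]]
  note [measurable] = Z_spaceD(1)[OF u_Z[OF t]]
  define q where "q k x = (exp (complex_of_real (\<mu> k) * (- \<i> * complex_of_real (x $ 1)))
      - 1) / complex_of_real (\<mu> k)"
    for k and x :: "real ^ 'n::{finite,one}"
  have qle: "norm (q k x) \<le> \<bar>x $ 1\<bar>" for k x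
  proof -
    have "complex_of_real (\<mu> k) * (- \<i> * complex_of_real (x $ 1)) = \<i> * complex_of_real (- (\<mu> k
        * x $ 1))" by simp
    then have "norm (exp (complex_of_real (\<mu> k) * (- \<i> * complex_of_real (x $ 1))) - 1) \<le> \<bar>- (\<mu> k
        * x $ 1)\<bar>"
      using cmod_exp_i_minus_1_le[of "- (\<mu> k * x $ 1)"] by (simp only:)
    then show ?thesis using \<mu>(2)[of k] by (simp add: q_def norm_divide abs_mult pos_divide_le_eq
        mult.commute)
  qed
  have eq: "u_hat t (\<mu> k *\<^sub>R e1) / complex_of_real (\<mu> k) = (LINT x|lborel. q k x * cplx (u t) x)" for k
  proof -
    have "u_hat t (\<mu> k *\<^sub>R e1) - u_hat t 0 = (LINT x|lborel. iexp_conj (x \<bullet> (\<mu> k *\<^sub>R e1)) * cplx (u t) x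
        - iexp_conj (x \<bullet> 0) * cplx (u t) x)"
      unfolding u_hat_def fourier_L1_def using integrable_fourier_kernel(1)[OF L(3)]
      by (intro Bochner_Integration.integral_diff[symmetric])
    also have "\<dots> = (LINT x|lborel. complex_of_real (\<mu> k) * (q k x * cplx (u t) x))"
    proof (intro Bochner_Integration.integral_cong refl)
      fix x
      have "iexp_conj (x \<bullet> (\<mu> k *\<^sub>R e1)) = 1 + complex_of_real (\<mu> k) * q k x"
        using \<mu>(2)[of k] by (simp add: q_def mult_ac)
      then show "iexp_conj (x \<bullet> (\<mu> k *\<^sub>R e1)) * cplx (u t) x
          - iexp_conj (x \<bullet> 0) * cplx (u t) x = complex_of_real (\<mu> k) * (q k x * cplx (u t) x)"
        by (simp add: distrib_right)
    qed
    finally show ?thesis using \<mu>(2)[of k] u_hat_at_0[OF t] by simp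
  qed
  have "(\<lambda>k. LINT x|lborel. q k x * cplx (u t) x) \<longlonglongrightarrow> (LINT x|lborel. (- \<i> * complex_of_real (x $ 1))
      * cplx (u t) x)"
  proof (rule integral_dominated_convergence[where w = "\<lambda>x. norm ((1 + norm x) * u t x)"])
    show "AE x in lborel. (\<lambda>k. q k x * cplx (u t) x) \<longlonglongrightarrow> (- \<i> * complex_of_real (x $ 1)) * cplx (u t) x"
      unfolding q_def using \<mu>(2)
      by (intro AE_I2 tendsto_mult tendsto_const exp_difference_quotient[OF \<mu>(1)])
          (simp add: less_imp_neq[symmetric])
    show "AE x in lborel. norm (q k x * cplx (u t) x) \<le> norm ((1 + norm x) * u t x)" for k
    proof (intro AE_I2)
      fix x
      have "norm (q k x) \<le> 1 + norm x" using qle[of k x] component_le_norm_cart[of x 1] by linarith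
      then show "norm (q k x * cplx (u t) x) \<le> norm ((1 + norm x) * u t x)"
        by (simp add: norm_mult abs_mult mult_right_mono)
    qed
  qed (use L(1) in \<open>auto simp: q_def\<close>)
  also have "(LINT x|lborel. (- \<i> * complex_of_real (x $ 1)) * cplx (u t) x) = - \<i>
      * complex_of_real (LINT x|lborel. x $ 1 * u t x)"
    by (simp flip: integral_complex_of_real of_real_mult add: mult.assoc)
  finally show ?thesis unfolding eq .
qed

lemma u_hat_ray:
  assumes t: "t1 \<in> {0..T}" "t2 \<in> {0..T}" and l: "l > 0"
  shows "u_hat t2 (l *\<^sub>R e1) = iexp ((t2 - t1) * l\<^sup>2) * u_hat t1 (l *\<^sub>R e1)
    - complex_of_real (t2 - t1) * integral {0..1} (\<lambda>\<theta>. iexp ((t2 - t1) * (1 - \<theta>) * l\<^sup>2)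
        * (\<i> * complex_of_real (l / 2)) * sq_hat (path t1 t2 \<theta>) (l *\<^sub>R e1))"
proof -
  define \<xi> where "\<xi> = l *\<^sub>R e1"
  have dispersion: "dispersion \<xi> = l\<^sup>2" unfolding \<xi>_def by (rule dispersion_ray[OF l])
  define E where "E = iexp (t2 * l\<^sup>2)"
  have e2: "E * iexp_conj (t2 * l\<^sup>2) = 1"
    unfolding E_def mult_exp_exp by simp
  have e1': "E * iexp_conj (t1 * l\<^sup>2) = iexp ((t2 - t1) * l\<^sup>2)"
    unfolding E_def mult_exp_exp by (simp add: algebra_simps)
  have e3: "E * iexp_conj (path t1 t2 \<theta> * l\<^sup>2) = iexp ((t2 - t1) * (1 - \<theta>) * l\<^sup>2)" for \<theta>
    unfolding E_def mult_exp_exp path_def by (simp add: algebra_simps)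
  have nonlin_hat: "nonlin_hat \<tau> \<xi> = (\<i> * complex_of_real (l / 2)) * sq_hat \<tau> \<xi>" for \<tau> by
      (simp add: nonlin_hat_def \<xi>_def)
  have "E * profile t2 \<xi> = E * profile t1 \<xi> - complex_of_real (t2 - t1) * (E
      * integral {0..1} (\<lambda>\<theta>. forcing (path t1 t2 \<theta>) \<xi>))"
  proof -
    have "E * profile t2 \<xi> = E * profile t1 \<xi> + E * (profile t2 \<xi> - profile t1 \<xi>)" by
        (simp add: right_diff_distrib)
    then show ?thesis unfolding profile_increment[OF t, of \<xi>] by
        (simp add: mult.left_commute del: of_real_diff)
  qed
  moreover have "E * profile t2 \<xi> = u_hat t2 \<xi>" unfolding profile_def dispersion
      mult.assoc[symmetric] e2 by simp
  moreover have "E * profile t1 \<xi> = iexp ((t2 - t1) * l\<^sup>2) * u_hat t1 \<xi>"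
    unfolding profile_def dispersion mult.assoc[symmetric] e1' ..
  moreover have "E * integral {0..1} (\<lambda>\<theta>. forcing (path t1 t2 \<theta>) \<xi>)
      = integral {0..1} (\<lambda>\<theta>. iexp ((t2 - t1) * (1 - \<theta>) * l\<^sup>2)
        * (\<i> * complex_of_real (l / 2)) * sq_hat (path t1 t2 \<theta>) \<xi>)"
    unfolding integral_mult_right[symmetric] forcing_def dispersion nonlin_hat mult.assoc[symmetric]
        e3 ..
  ultimately show ?thesis by (simp only: \<xi>_def)
qed

text \<open>Minus the imaginary part of the transform of \<open>u\<^sup>2\<close> on the first axis.\<close>

definition "sine_moment \<tau> l = (LINT x|lborel. sin (l * x $ 1) * (u \<tau> x)\<^sup>2)"

lemma Re_sq_hat_ray:
  assumes \<tau>: "\<tau> \<in> {0..T}"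
  shows "Re ((\<i> * complex_of_real (l / 2)) * sq_hat \<tau> (l *\<^sub>R e1)) = l / 2 * sine_moment \<tau> l"
proof -
  have "Im (sq_hat \<tau> (l *\<^sub>R e1)) = (LINT x|lborel. Im (iexp_conj (x \<bullet> (l *\<^sub>R e1))
      * complex_of_real ((u \<tau> x)\<^sup>2)))"
    unfolding sq_hat_def fourier_L1_def
    by (rule integral_Im[OF integrable_fourier_kernel(1)[OF sq_integrable(2)[OF \<tau>]], symmetric])
  also have "\<dots> = (LINT x|lborel. - (sin (l * x $ 1) * (u \<tau> x)\<^sup>2))"
    by (intro Bochner_Integration.integral_cong) (simp_all add: Im_exp Re_exp flip: of_real_power)
  finally show ?thesis by (simp add: sine_moment_def)
qed

lemma sine_moment_combination_le:
  assumes \<tau>: "\<tau> \<in> {0..T}" and l: "l > 0"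
  shows "\<bar>3 * sine_moment \<tau> (3 * l) - 12 * sine_moment \<tau> (2 * l) + 15 * sine_moment \<tau> l\<bar>
    \<le> 12 * l ^ 3 * (LINT x|lborel. \<bar>x $ 1\<bar> ^ 3 * (u \<tau> x)\<^sup>2)"
proof -
  note [measurable] = Z_spaceD(1)[OF u_Z[OF \<tau>]]
  have i: "integrable lborel (\<lambda>x. sin (l * x $ 1) * (u \<tau> x)\<^sup>2)" for l
    by (rule integrable_bounded_mult[OF sq_integrable(1)[OF \<tau>], of _ 1]) auto
  define g where "g x = 3 * (sin ((3 * l) * x $ 1) * (u \<tau> x)\<^sup>2) - 12 * (sin ((2 * l) * x $ 1)
      * (u \<tau> x)\<^sup>2)
    + 15 * (sin (l * x $ 1) * (u \<tau> x)\<^sup>2)" for x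
  have gi: "integrable lborel g"
    unfolding g_def[abs_def] by (intro Bochner_Integration.integrable_add
        Bochner_Integration.integrable_diff integrable_mult_right i)
  have eq: "3 * sine_moment \<tau> (3 * l) - 12 * sine_moment \<tau> (2 * l) + 15 * sine_moment \<tau> l
      = (LINT x|lborel. g x)"
    unfolding sine_moment_def g_def using i[of "3 * l"] i[of "2 * l"] i[of l] by simp
  have "\<bar>LINT x|lborel. g x\<bar> \<le> (LINT x|lborel. \<bar>g x\<bar>)"
    by (rule integral_abs_bound)
  also have "\<dots> \<le> (LINT x|lborel. 12 * l ^ 3 * (\<bar>x $ 1\<bar> ^ 3 * (u \<tau> x)\<^sup>2))"
  proof (rule integral_mono)
    show "integrable lborel (\<lambda>x. \<bar>g x\<bar>)" using gi by (rule integrable_abs)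
    show "integrable lborel (\<lambda>x. 12 * l ^ 3 * (\<bar>x $ 1\<bar> ^ 3 * (u \<tau> x)\<^sup>2))"
      by (intro integrable_mult_right third_moment_integrable \<tau>)
    fix x
    have "g x = (3 * sin (3 * (l * x $ 1)) - 12 * sin (2 * (l * x $ 1)) + 15 * sin (l * x $ 1))
        * (u \<tau> x)\<^sup>2"
      by (simp add: g_def algebra_simps)
    then have "\<bar>g x\<bar> = \<bar>3 * sin (3 * (l * x $ 1)) - 12 * sin (2 * (l * x $ 1)) + 15 * sin (l
        * x $ 1)\<bar> * (u \<tau> x)\<^sup>2"
      by (simp add: abs_mult)
    also have "\<dots> \<le> 12 * \<bar>l * x $ 1\<bar> ^ 3 * (u \<tau> x)\<^sup>2"
      by (intro mult_right_mono sin_combination_le) simp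
    also have "\<dots> = 12 * l ^ 3 * (\<bar>x $ 1\<bar> ^ 3 * (u \<tau> x)\<^sup>2)" using l by
        (simp add: abs_mult power_mult_distrib)
    finally show "\<bar>g x\<bar> \<le> 12 * l ^ 3 * (\<bar>x $ 1\<bar> ^ 3 * (u \<tau> x)\<^sup>2)" .
  qed
  finally show ?thesis unfolding eq by simp
qed


definition "ray_diff t1 t2 l = Re (u_hat t2 (l *\<^sub>R e1) - u_hat t1 (l *\<^sub>R e1))"

text \<open>What Duhamel's integral contributes to \<open>ray_diff\<close>, up to the factor \<open>- (t2 - t1)\<close>, if the group is replaced by the
identity. It is of order \<open>l\<^sup>2\<close>, and so dominates the term of order \<open>l\<^sup>3\<close> that is looked for; but it
    is a smooth even
function of \<open>l\<close> to the extent that \<open>u\<^sup>2\<close> has moments, and its sixth difference is \<open>O(l\<^sup>4)\<close>.\<close>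

definition "smooth_part t1 t2 l = integral {0..1} (\<lambda>\<theta>. l / 2 * sine_moment (path t1 t2 \<theta>) l)"

definition "energy t1 t2 = integral {0..1} (\<lambda>\<theta>. (1 - \<theta>) * (L2_norm (u (path t1 t2 \<theta>)))\<^sup>2)"

lemma continuous_on_sq_hat_path:
  assumes t: "t1 \<in> {0..T}" "t2 \<in> {0..T}"
  shows "continuous_on {0..1} (\<lambda>\<theta>. sq_hat (path t1 t2 \<theta>) \<xi>)"
  using path_in[OF t] by (intro continuous_on_sq_hat continuous_path continuous_on_const) auto

lemma continuous_on_energy:
  assumes t: "t1 \<in> {0..T}" "t2 \<in> {0..T}"
  shows "continuous_on {0..1} (\<lambda>\<theta>. (1 - \<theta>) * (L2_norm (u (path t1 t2 \<theta>)))\<^sup>2)"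
proof -
  have "continuous_on {0..1} (\<lambda>\<theta>. L2_norm (u (path t1 t2 \<theta>)))"
    by (rule continuous_on_compose2[OF continuous_L2_norm_u continuous_path]) (use path_in[OF t] in auto)
  then show ?thesis by (intro continuous_intros)
qed

text \<open>What remains has two terms with the factor \<open>e\<^bsup>isl\<^sup>2\<^esup> - 1\<close>, asymptotically \<open>i s l\<^sup>2\<close>: one with \<open>s = t2 - t1\<close>, multiplied by the
transform of \<open>u(t1)\<close>, and under the integral one with \<open>s = (t2 - t1) (1 - \<theta>)\<close>, multiplied by
\<open>i l/2\<close> and the transform of \<open>u\<^sup>2\<close>, whose value at the origin is the squared norm.\<close>

lemma singular_part_tendsto:
  assumes t: "t1 \<in> {0..T}" "t2 \<in> {0..T}" and \<mu>: "\<mu> \<longlonglongrightarrow> 0" "\<And>k. \<mu> k > 0"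
  defines "m \<equiv> LINT x|lborel. x $ 1 * u t1 x"
  shows "(\<lambda>k. (ray_diff t1 t2 (\<mu> k) + (t2 - t1) * smooth_part t1 t2 (\<mu> k)) / \<mu> k ^ 3)
    \<longlonglongrightarrow> (t2 - t1) * m + (t2 - t1)\<^sup>2 / 2 * energy t1 t2"
proof -
  define \<sigma> where "\<sigma> = t2 - t1"
  obtain Y where Y: "\<And>\<tau>. \<tau> \<in> {0..T} \<Longrightarrow> L2_norm (u \<tau>) \<le> Y" using L2_norm_u_bounded by blast
  have \<mu>0: "\<mu> k \<noteq> 0" for k using \<mu>(2)[of k] by simp
  have sq0: "(\<lambda>k. (\<mu> k)\<^sup>2) \<longlonglongrightarrow> 0" using tendsto_power[OF \<mu>(1), of 2] by simp
  have quot: "(\<lambda>k. (iexp (s * (\<mu> k)\<^sup>2) - 1) / complex_of_real ((\<mu> k)\<^sup>2)) \<longlonglongrightarrow> \<i> * complex_of_real s" for s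
  proof -
    have "(\<lambda>k. (exp (complex_of_real ((\<mu> k)\<^sup>2) * (\<i> * complex_of_real s))
        - 1) / complex_of_real ((\<mu> k)\<^sup>2)) \<longlonglongrightarrow> \<i> * complex_of_real s"
      by (rule exp_difference_quotient[OF sq0]) (simp add: \<mu>0)
    then show ?thesis by (simp add: mult_ac)
  qed
  define K where "K k \<theta> = (iexp (\<sigma> * (1 - \<theta>) * (\<mu> k)\<^sup>2) - 1) / complex_of_real ((\<mu> k)\<^sup>2)
      * (\<i> / 2) * sq_hat (path t1 t2 \<theta>) (\<mu> k *\<^sub>R e1)" for k \<theta>
  have Kc: "continuous_on {0..1} (K k)" for k
    unfolding K_def by (intro continuous_intros continuous_on_sq_hat_path t) (simp add: \<mu>0)
  have Klim: "(\<lambda>k. integral {0..1} (K k)) \<longlonglongrightarrow> integral {0..1} (\<lambda>\<theta>. (\<i> * complex_of_real (\<sigma> * (1 - \<theta>)))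
      * (\<i> / 2) * sq_hat (path t1 t2 \<theta>) 0)"
  proof (rule dominated_convergence(2))
    show "K k integrable_on {0..1}" for k by (rule integrable_continuous_interval[OF Kc])
    show "(\<lambda>\<theta>. \<bar>\<sigma>\<bar> * (1/2) * Y\<^sup>2) integrable_on {0..1::real}" by (rule integrable_const_ivl)
    fix \<theta> :: real assume \<theta>: "\<theta> \<in> {0..1}"
    have p: "path t1 t2 \<theta> \<in> {0..T}" by (rule path_in[OF t \<theta>])
    show "norm (K k \<theta>) \<le> \<bar>\<sigma>\<bar> * (1/2) * Y\<^sup>2" for k
    proof -
      have "norm (iexp (\<sigma> * (1 - \<theta>) * (\<mu> k)\<^sup>2) - 1) \<le> \<bar>\<sigma> * (1 - \<theta>) * (\<mu> k)\<^sup>2\<bar>"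
        by (rule cmod_exp_i_minus_1_le)
      also have "\<dots> = \<bar>\<sigma>\<bar> * (1 - \<theta>) * (\<mu> k)\<^sup>2" using \<theta> by (simp add: abs_mult)
      also have "\<dots> \<le> \<bar>\<sigma>\<bar> * 1 * (\<mu> k)\<^sup>2" using \<theta> by (intro mult_right_mono mult_left_mono) auto
      finally have "norm ((iexp (\<sigma> * (1 - \<theta>) * (\<mu> k)\<^sup>2) - 1) / complex_of_real ((\<mu> k)\<^sup>2)) \<le> \<bar>\<sigma>\<bar>"
        using \<mu>0[of k] by (simp add: norm_divide norm_power divide_le_eq del: of_real_mult)
      moreover have "norm (sq_hat (path t1 t2 \<theta>) (\<mu> k *\<^sub>R e1)) \<le> Y\<^sup>2"
        by (rule order_trans[OF norm_sq_hat_le power_mono[OF Y[OF p]]]) simp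
      ultimately show ?thesis
        unfolding K_def norm_mult by (intro mult_mono) (auto simp: norm_divide)
    qed
    have "isCont (sq_hat (path t1 t2 \<theta>)) 0"
      using continuous_fourier_L1[OF sq_integrable(2)[OF p], of UNIV] by
          (simp add: sq_hat_def continuous_on_eq_continuous_at)
    moreover have "(\<lambda>k. \<mu> k *\<^sub>R e1) \<longlonglongrightarrow> 0" using tendsto_scaleR[OF \<mu>(1) tendsto_const[of e1]] by simp
    ultimately have "(\<lambda>k. sq_hat (path t1 t2 \<theta>) (\<mu> k *\<^sub>R e1)) \<longlonglongrightarrow> sq_hat (path t1 t2 \<theta>) 0"
      by (rule isCont_tendsto_compose)
    then show "(\<lambda>k. K k \<theta>) \<longlonglongrightarrow> (\<i> * complex_of_real (\<sigma> * (1 - \<theta>))) * (\<i> / 2) * sq_hat (path t1 t2 \<theta>) 0"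
      unfolding K_def by (intro tendsto_mult tendsto_const quot)
  qed
  have "integral {0..1} (\<lambda>\<theta>. (\<i> * complex_of_real (\<sigma> * (1 - \<theta>))) * (\<i> / 2) * sq_hat (path t1 t2 \<theta>) 0)
      = integral {0..1} (\<lambda>\<theta>. complex_of_real (- \<sigma> / 2 * ((1 - \<theta>) * (L2_norm (u (path t1 t2 \<theta>)))\<^sup>2)))"
  proof (intro Henstock_Kurzweil_Integration.integral_cong)
    fix \<theta> :: real
    have "(\<i> * complex_of_real (\<sigma> * (1 - \<theta>))) * (\<i> / 2) = complex_of_real (- \<sigma> / 2 * (1 - \<theta>))"
      by (simp add: complex_eq_iff)
    then show "(\<i> * complex_of_real (\<sigma> * (1 - \<theta>))) * (\<i> / 2) * sq_hat (path t1 t2 \<theta>) 0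
      = complex_of_real (- \<sigma> / 2 * ((1 - \<theta>) * (L2_norm (u (path t1 t2 \<theta>)))\<^sup>2))"
      unfolding sq_hat_at_0 by (simp only: of_real_mult mult.assoc)
  qed
  also have "\<dots> = complex_of_real (integral {0..1} (\<lambda>\<theta>. - \<sigma> / 2 * ((1 - \<theta>)
      * (L2_norm (u (path t1 t2 \<theta>)))\<^sup>2)))"
  proof -
    have "(\<lambda>\<theta>. - \<sigma> / 2 * ((1 - \<theta>) * (L2_norm (u (path t1 t2 \<theta>)))\<^sup>2)) integrable_on {0..1}"
      by (intro integrable_continuous_interval continuous_on_mult continuous_on_const
          continuous_on_energy t)
    from integral_linear[OF this bounded_linear_of_real] show ?thesis by (simp only: comp_def)
  qed
  also have "integral {0..1} (\<lambda>\<theta>. - \<sigma> / 2 * ((1 - \<theta>) * (L2_norm (u (path t1 t2 \<theta>)))\<^sup>2)) = - \<sigma> / 2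
      * energy t1 t2"
    unfolding energy_def by (rule integral_mult_right)
  finally have Klim': "(\<lambda>k. integral {0..1} (K k)) \<longlonglongrightarrow> complex_of_real (- \<sigma> / 2 * energy t1 t2)"
    using Klim by simp
  define P where "P k = (iexp (\<sigma> * (\<mu> k)\<^sup>2) - 1) / complex_of_real ((\<mu> k)\<^sup>2)
    * (u_hat t1 (\<mu> k *\<^sub>R e1) / complex_of_real (\<mu> k))" for k
  have Plim: "P \<longlonglongrightarrow> (\<i> * complex_of_real \<sigma>) * (- \<i> * complex_of_real m)"
    unfolding P_def m_def by (intro tendsto_mult quot u_hat_ray_tendsto t \<mu>)
  have "(\<lambda>k. Re (P k) - \<sigma> * Re (integral {0..1} (K k))) \<longlonglongrightarrow> Re ((\<i> * complex_of_real \<sigma>) * (- \<i>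
      * complex_of_real m))
      - \<sigma> * Re (complex_of_real (- \<sigma> / 2 * energy t1 t2))"
    by (intro tendsto_intros Plim Klim')
  also have "Re ((\<i> * complex_of_real \<sigma>) * (- \<i> * complex_of_real m)) - \<sigma>
      * Re (complex_of_real (- \<sigma> / 2 * energy t1 t2))
      = (t2 - t1) * m + (t2 - t1)\<^sup>2 / 2 * energy t1 t2"
    unfolding \<sigma>_def[symmetric] by (simp add: power2_eq_square)
  finally have lim: "(\<lambda>k. Re (P k) - \<sigma> * Re (integral {0..1} (K k)))
      \<longlonglongrightarrow> (t2 - t1) * m + (t2 - t1)\<^sup>2 / 2 * energy t1 t2" .
  have "(ray_diff t1 t2 (\<mu> k) + (t2 - t1) * smooth_part t1 t2 (\<mu> k)) / \<mu> k ^ 3 = Re (P k) - \<sigma>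
      * Re (integral {0..1} (K k))" for k
  proof -
    define l where "l = \<mu> k"
    have l: "l > 0" using \<mu>(2) by (simp add: l_def)
    define J where "J \<theta> = iexp (\<sigma> * (1 - \<theta>) * l\<^sup>2) * (\<i> * complex_of_real (l / 2))
        * sq_hat (path t1 t2 \<theta>) (l *\<^sub>R e1)" for \<theta>
    define H where "H \<theta> = (\<i> * complex_of_real (l / 2)) * sq_hat (path t1 t2 \<theta>) (l *\<^sub>R e1)" for \<theta>
    have Hc: "H integrable_on {0..1}"
      unfolding H_def by (intro integrable_continuous_interval continuous_intros
          continuous_on_sq_hat_path t)
    have split: "J \<theta> = complex_of_real (l ^ 3) * K k \<theta> + H \<theta>" for \<theta>
      using l by (simp add: J_def K_def H_def l_def[symmetric] field_simps power2_eq_square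
          power3_eq_cube)
    have "integral {0..1} J = complex_of_real (l ^ 3) * integral {0..1} (K k) + integral {0..1} H"
      unfolding split[abs_def] integral_mult_right[symmetric]
      by (rule Henstock_Kurzweil_Integration.integral_add)
         (intro Hc integrable_continuous_interval continuous_intros Kc)+
    then have ReJ: "Re (integral {0..1} J) = l ^ 3 * Re (integral {0..1} (K k))
        + Re (integral {0..1} H)" by simp
    have "Re (integral {0..1} H) = integral {0..1} (\<lambda>\<theta>. Re (H \<theta>))"
      using integral_linear[OF Hc bounded_linear_Re] by (simp add: comp_def)
    also have "\<dots> = smooth_part t1 t2 l"
      unfolding smooth_part_def H_def
      by (intro Henstock_Kurzweil_Integration.integral_cong Re_sq_hat_ray path_in[OF t])
    finally have ReH: "Re (integral {0..1} H) = smooth_part t1 t2 l" .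
    have PP: "(iexp (\<sigma> * l\<^sup>2) - 1) * u_hat t1 (l *\<^sub>R e1) = complex_of_real (l ^ 3) * P k"
      using l by (simp add: P_def l_def[symmetric] field_simps power2_eq_square power3_eq_cube)
    have "u_hat t2 (l *\<^sub>R e1) - u_hat t1 (l *\<^sub>R e1) = (iexp (\<sigma> * l\<^sup>2) - 1) * u_hat t1 (l *\<^sub>R e1)
        - complex_of_real \<sigma> * integral {0..1} J"
      unfolding u_hat_ray[OF t l] J_def \<sigma>_def by (simp add: algebra_simps)
    then have "ray_diff t1 t2 l = l ^ 3 * Re (P k) - \<sigma> * (l ^ 3 * Re (integral {0..1} (K k))
        + smooth_part t1 t2 l)"
      unfolding ray_diff_def PP ReJ[symmetric] ReH[symmetric] by simp
    then show ?thesis using l by (simp add: l_def[symmetric] \<sigma>_def field_simps)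
  qed
  then show ?thesis using lim by simp
qed

lemma smooth_part_combination_tendsto:
  assumes t: "t1 \<in> {0..T}" "t2 \<in> {0..T}" and \<mu>: "\<mu> \<longlonglongrightarrow> 0" "\<And>k. \<mu> k > 0"
  shows "(\<lambda>k. (smooth_part t1 t2 (3 * \<mu> k) - 6 * smooth_part t1 t2 (2 * \<mu> k) + 15
      * smooth_part t1 t2 (\<mu> k)) / \<mu> k ^ 3) \<longlonglongrightarrow> 0"
proof -
  obtain Y where Y: "\<And>\<tau>. \<tau> \<in> {0..T} \<Longrightarrow> L2_norm (u \<tau>) \<le> Y" using L2_norm_u_bounded by blast
  obtain W where W: "\<And>\<tau>. \<tau> \<in> {0..T} \<Longrightarrow> L2_norm (\<lambda>x. norm x powr (real CARD('n) + 1) * u \<tau> x) \<le> W"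
    using weighted_norm_u_bounded by blast
  define B where "B = Y\<^sup>2 + W\<^sup>2"
  have mom: "(LINT x|lborel. \<bar>x $ 1\<bar> ^ 3 * (u \<tau> x)\<^sup>2) \<le> B" if "\<tau> \<in> {0..T}" for \<tau>
    unfolding B_def
    by (rule order_trans[OF third_moment_le[OF that] add_mono[OF power_mono[OF Y[OF that]]
        power_mono[OF W[OF that]]]]) auto
  have cont: "continuous_on {0..1} (\<lambda>\<theta>. l / 2 * sine_moment (path t1 t2 \<theta>) l)" for l
  proof -
    have "continuous_on {0..1} (\<lambda>\<theta>. Re ((\<i> * complex_of_real (l / 2))
        * sq_hat (path t1 t2 \<theta>) (l *\<^sub>R e1)))"
      by (intro continuous_intros continuous_on_sq_hat_path t) simp
    then show ?thesis
      by (rule continuous_on_eq) (rule Re_sq_hat_ray[OF path_in[OF t]])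
  qed
  have le: "\<bar>smooth_part t1 t2 (3 * l) - 6 * smooth_part t1 t2 (2 * l) + 15 * smooth_part t1 t2 l\<bar>
      \<le> 6 * l ^ 4 * B" if l: "l > 0" for l
  proof -
    define g where "g \<theta> = (3 * l) / 2 * sine_moment (path t1 t2 \<theta>) (3 * l) - 6 * ((2 * l) / 2
        * sine_moment (path t1 t2 \<theta>) (2 * l))
      + 15 * (l / 2 * sine_moment (path t1 t2 \<theta>) l)" for \<theta>
    have gc: "continuous_on {0..1} g"
      unfolding g_def by (intro continuous_on_add continuous_on_diff continuous_on_mult[OF
          continuous_on_const cont] cont)
    note i = integrable_continuous_interval[OF cont]
    have i6: "(\<lambda>\<theta>. 6 * (2 * l / 2 * sine_moment (path t1 t2 \<theta>) (2 * l))) integrable_on {0..1}"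
      and i15: "(\<lambda>\<theta>. 15 * (l / 2 * sine_moment (path t1 t2 \<theta>) l)) integrable_on {0..1}"
      by (intro integrable_continuous_interval continuous_on_mult[OF continuous_on_const cont])+
    have "integral {0..1} g = smooth_part t1 t2 (3 * l) - 6 * smooth_part t1 t2 (2 * l) + 15
        * smooth_part t1 t2 l"
      unfolding g_def smooth_part_def integral_mult_right[symmetric, of 6]
          integral_mult_right[symmetric, of 15]
      by (subst Henstock_Kurzweil_Integration.integral_add[OF
          Henstock_Kurzweil_Integration.integrable_diff[OF i i6] i15],
          subst Henstock_Kurzweil_Integration.integral_diff[OF i i6]) (rule refl)
    moreover have "norm (integral {0..1} g) \<le> integral {0..1} (\<lambda>\<theta>::real. 6 * l ^ 4 * B)"
    proof (rule integral_norm_bound_integral)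
      show "g integrable_on {0..1}" by (rule integrable_continuous_interval[OF gc])
      show "(\<lambda>\<theta>::real. 6 * l ^ 4 * B) integrable_on {0..1}" by (rule integrable_const_ivl)
      fix \<theta> :: real assume "\<theta> \<in> {0..1}"
      then have p: "path t1 t2 \<theta> \<in> {0..T}" by (rule path_in[OF t])
      have gl: "g \<theta> = l / 2 * (3 * sine_moment (path t1 t2 \<theta>) (3 * l) - 12
          * sine_moment (path t1 t2 \<theta>) (2 * l)
          + 15 * sine_moment (path t1 t2 \<theta>) l)"
        by (simp add: g_def algebra_simps)
      have "\<bar>g \<theta>\<bar> = l / 2 * \<bar>3 * sine_moment (path t1 t2 \<theta>) (3 * l) - 12
          * sine_moment (path t1 t2 \<theta>) (2 * l)
          + 15 * sine_moment (path t1 t2 \<theta>) l\<bar>"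
        unfolding gl abs_mult using l by simp
      also have "\<dots> \<le> l / 2 * (12 * l ^ 3 * B)"
        using sine_moment_combination_le[OF p l] mom[OF p] l
        by (intro mult_left_mono) (auto intro: order_trans mult_left_mono)
      also have "\<dots> = 6 * l ^ 4 * B" by (simp add: power_numeral_reduce)
      finally show "norm (g \<theta>) \<le> 6 * l ^ 4 * B" by simp
    qed
    ultimately show ?thesis by simp
  qed
  have lim: "(\<lambda>k. 6 * \<mu> k * B) \<longlonglongrightarrow> 0"
    using tendsto_mult[OF tendsto_mult[OF tendsto_const[of 6] \<mu>(1)] tendsto_const[of B]] by simp
  show ?thesis
  proof (rule Lim_null_comparison[OF always_eventually lim], intro allI)
    fix k
    have m: "\<mu> k ^ 3 > 0" using \<mu>(2)[of k] by simp
    have eq: "6 * \<mu> k ^ 4 * B = (6 * \<mu> k * B) * \<mu> k ^ 3" by (simp add: power_numeral_reduce)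
    show "norm ((smooth_part t1 t2 (3 * \<mu> k) - 6 * smooth_part t1 t2 (2 * \<mu> k) + 15
        * smooth_part t1 t2 (\<mu> k)) / \<mu> k ^ 3) \<le> 6 * \<mu> k * B"
      using le[OF \<mu>(2)[of k], unfolded eq] m by (simp add: abs_divide pos_divide_le_eq del:
          zero_less_power)
  qed
qed

lemma ray_combination_tendsto:
  assumes t: "t1 \<in> {0..T}" "t2 \<in> {0..T}" and d: "CARD('n) \<le> 6" and \<mu>: "\<mu> \<longlonglongrightarrow> 0" "\<And>k. \<mu> k > 0"
    and decay: "(\<lambda>x. norm x powr (real CARD('n) / 2 + 3) * u t1 x) \<in> L2_space"
      "(\<lambda>x. norm x powr (real CARD('n) / 2 + 3) * u t2 x) \<in> L2_space"
  shows "(\<lambda>k. (ray_diff t1 t2 (3 * \<mu> k) - 6 * ray_diff t1 t2 (2 * \<mu> k) + 15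
      * ray_diff t1 t2 (\<mu> k)) / \<mu> k ^ 3) \<longlonglongrightarrow> 0"
proof -
  define f where "f x = u t2 x - u t1 x" for x
  have fi: "integrable lborel f" unfolding f_def[abs_def]
      using Z_space_L1(2)[OF u_Z[OF t(1)]] Z_space_L1(2)[OF u_Z[OF t(2)]] by simp
  have w: "(\<lambda>x. norm x powr (real DIM(real ^ 'n::{finite,one}) / 2 + 3) * f x) \<in> L2_space"
    using L2_space_diff[OF decay(2,1)] by (simp add: f_def right_diff_distrib)
  have cf: "cplx f = (\<lambda>x. cplx (u t2) x - cplx (u t1) x)" by (simp add: f_def)
  have R: "Re (fourier_L1 (cplx f) (l *\<^sub>R e1)) = ray_diff t1 t2 l" for l
    unfolding cf fourier_L1_diff[OF Z_space_L1(3)[OF u_Z[OF t(2)]] Z_space_L1(3)[OF u_Z[OF t(1)]]]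
        ray_diff_def u_hat_def ..
  have R0: "ray_diff t1 t2 0 = 0" by (simp add: ray_diff_def u_hat_at_0[OF t(1)] u_hat_at_0[OF t(2)])
  have "(\<lambda>k. - 32 * ((LINT x|lborel. sin (\<mu> k * (x \<bullet> e1) / 2) ^ 6 * f x) / \<mu> k ^ 3)) \<longlonglongrightarrow> - 32 * 0"
    by (intro tendsto_mult tendsto_const weighted_low_frequency[OF fi w _ _ \<mu>]) (use d in auto)
  moreover have "(ray_diff t1 t2 (3 * l) - 6 * ray_diff t1 t2 (2 * l) + 15 * ray_diff t1 t2 l)
      = - 32 * (LINT x|lborel. sin (l * (x \<bullet> e1) / 2) ^ 6 * f x)" for l
    using fourier_ray_sixth_difference[OF fi, of e1 l] unfolding R R0 by linarith
  ultimately show ?thesis by simp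
qed

text \<open>In the sixth difference, \<open>l\<^sup>2\<close> has the coefficient \<open>3\<^sup>2 - 6 * 2\<^sup>2 + 15 = 0\<close> and \<open>|l|\<^sup>3\<close> has
\<open>3\<^sup>3 - 6 * 2\<^sup>3 + 15 = -6\<close>. So the difference of \<open>ray_diff\<close> is asymptotically \<open>-6 l\<^sup>3\<close> times the limit in
\<open>singular_part_tendsto\<close>, whereas the decay of \<open>u(t1)\<close> and \<open>u(t2)\<close> makes it \<open>o(l\<^sup>3)\<close>.\<close>

lemma third_order_obstruction:
  assumes t: "t1 \<in> {0..T}" "t2 \<in> {0..T}" "t1 \<noteq> t2" and d: "CARD('n) \<le> 6"
    and decay: "(\<lambda>x. norm x powr (real CARD('n) / 2 + 3) * u t1 x) \<in> L2_space"
      "(\<lambda>x. norm x powr (real CARD('n) / 2 + 3) * u t2 x) \<in> L2_space"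
  shows "(LINT x|lborel. x $ 1 * u t1 x) + (t2 - t1) / 2 * energy t1 t2 = 0"
proof -
  define \<mu> where "\<mu> k = 1 / real (Suc k)" for k
  have \<mu>: "\<mu> \<longlonglongrightarrow> 0" "\<And>k. \<mu> k > 0"
    unfolding \<mu>_def[abs_def] using LIMSEQ_inverse_real_of_nat by (simp_all add: inverse_eq_divide)
  define L where "L = (t2 - t1) * (LINT x|lborel. x $ 1 * u t1 x) + (t2 - t1)\<^sup>2 / 2 * energy t1 t2"
  define G where "G l = ray_diff t1 t2 l + (t2 - t1) * smooth_part t1 t2 l" for l
  have scaled: "(\<lambda>k. G (j * \<mu> k) / \<mu> k ^ 3) \<longlonglongrightarrow> j ^ 3 * L" if j: "j > 0" for j
  proof -
    have "(\<lambda>k. j * \<mu> k) \<longlonglongrightarrow> 0" using tendsto_mult[OF tendsto_const[of j] \<mu>(1)] by simp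
    from singular_part_tendsto[OF t(1,2) this] j \<mu>(2)
    have "(\<lambda>k. G (j * \<mu> k) / (j * \<mu> k) ^ 3) \<longlonglongrightarrow> L" by (simp add: G_def L_def)
    from tendsto_mult[OF tendsto_const[of "j ^ 3"] this] show ?thesis
      using j by (simp add: power_mult_distrib)
  qed
  have "(\<lambda>k. G (3 * \<mu> k) / \<mu> k ^ 3 - 6 * (G (2 * \<mu> k) / \<mu> k ^ 3) + 15 * (G (1 * \<mu> k) / \<mu> k ^ 3))
      \<longlonglongrightarrow> 3 ^ 3 * L - 6 * (2 ^ 3 * L) + 15 * (1 ^ 3 * L)"
    by (intro tendsto_intros scaled) auto
  then have lim1: "(\<lambda>k. G (3 * \<mu> k) / \<mu> k ^ 3 - 6 * (G (2 * \<mu> k) / \<mu> k ^ 3) + 15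
      * (G (\<mu> k) / \<mu> k ^ 3)) \<longlonglongrightarrow> - 6 * L"
    by simp
  have lim2: "(\<lambda>k. (ray_diff t1 t2 (3 * \<mu> k) - 6 * ray_diff t1 t2 (2 * \<mu> k) + 15
      * ray_diff t1 t2 (\<mu> k)) / \<mu> k ^ 3
     + (t2 - t1) * ((smooth_part t1 t2 (3 * \<mu> k) - 6 * smooth_part t1 t2 (2 * \<mu> k) + 15
         * smooth_part t1 t2 (\<mu> k)) / \<mu> k ^ 3))
     \<longlonglongrightarrow> 0 + (t2 - t1) * 0"
    by (intro tendsto_add tendsto_mult tendsto_const ray_combination_tendsto
        smooth_part_combination_tendsto t d decay \<mu>)
  have "(ray_diff t1 t2 (3 * l) - 6 * ray_diff t1 t2 (2 * l) + 15 * ray_diff t1 t2 l) / l ^ 3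
     + (t2 - t1) * ((smooth_part t1 t2 (3 * l) - 6 * smooth_part t1 t2 (2 * l) + 15
         * smooth_part t1 t2 l) / l ^ 3)
     = G (3 * l) / l ^ 3 - 6 * (G (2 * l) / l ^ 3) + 15 * (G l / l ^ 3)" for l
    by (simp add: G_def add_divide_distrib diff_divide_distrib algebra_simps)
  with lim2 have "(\<lambda>k. G (3 * \<mu> k) / \<mu> k ^ 3 - 6 * (G (2 * \<mu> k) / \<mu> k ^ 3) + 15
      * (G (\<mu> k) / \<mu> k ^ 3)) \<longlonglongrightarrow> 0"
    by simp
  from LIMSEQ_unique[OF lim1 this] have "L = 0" by simp
  then have "(t2 - t1) * ((LINT x|lborel. x $ 1 * u t1 x) + (t2 - t1) / 2 * energy t1 t2) = 0"
    by (simp add: L_def power2_eq_square algebra_simps)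
  then show ?thesis using t(3) by simp
qed

lemma vanishing_of_moment:
  assumes t: "t1 \<in> {0..T}" "t2 \<in> {0..T}" "t1 \<noteq> t2" and d: "CARD('n) \<le> 6"
    and decay: "(\<lambda>x. norm x powr (real CARD('n) / 2 + 3) * u t1 x) \<in> L2_space"
      "(\<lambda>x. norm x powr (real CARD('n) / 2 + 3) * u t2 x) \<in> L2_space"
    and m: "(LINT x|lborel. x $ 1 * u t1 x) = 0"
  shows "L2_norm (u t1) = 0"
proof -
  have "energy t1 t2 = 0" using third_order_obstruction[OF t d decay] m t(3) by simp
  then have "\<forall>\<theta>\<in>{0..1}. (1 - \<theta>) * (L2_norm (u (path t1 t2 \<theta>)))\<^sup>2 = 0"
    unfolding energy_def
    by (subst (asm) integral_eq_0_iff[OF continuous_on_energy[OF t(1,2)]]) auto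
  from bspec[OF this, of 0] show ?thesis by (simp add: path_def)
qed

end

section \<open>Unique continuation from two times\<close>

theorem theorem1p4:
  fixes u :: "real \<Rightarrow> real ^ 'n::{finite,one} \<Rightarrow> real"
    and u0 :: "real ^ 'n::{finite,one} \<Rightarrow> real"
    and T r t1 t2 :: real
  assumes dim: "(CARD('n) = 2 \<and> r = 3) \<or> (CARD('n) = 3 \<and> r = 4)"
    and T: "T > 0"
    and u_cont: "u \<in> C_Zdot T r r"
    and u_sol: "is_duhamel_solution T u0 u"
    and times: "t1 \<in> {0..T}" "t2 \<in> {0..T}" "t1 \<noteq> t2"
    and decay: "u t1 \<in> Z_space (real CARD('n) / 2 + 3) (real CARD('n) / 2 + 3)"
      "u t2 \<in> Z_space (real CARD('n) / 2 + 3) (real CARD('n) / 2 + 3)"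
    and moment: "(LINT x|lborel. x $ 1 * u t1 x) = 0 \<or> (LINT x|lborel. x $ 1 * u t2 x) = 0"
  shows "\<forall>t\<in>{0..T}. AE x in lborel. u t x = 0"
proof -
  have r: "r = real CARD('n) + 1" and d: "CARD('n) \<le> 6" using dim by auto
  interpret duhamel_solution u u0 T
    using T u_cont u_sol unfolding r by unfold_locales
  note w = Z_spaceD(4)[OF decay(1)] Z_spaceD(4)[OF decay(2)]
  from moment obtain t0 where t0: "t0 \<in> {0..T}" "L2_norm (u t0) = 0"
  proof
    assume "(LINT x|lborel. x $ 1 * u t1 x) = 0"
    from vanishing_of_moment[OF times d w this] times(1) that show ?thesis by blast
  next
    assume "(LINT x|lborel. x $ 1 * u t2 x) = 0"
    from vanishing_of_moment[OF times(2,1) times(3)[symmetric] d w(2,1) this] times(2) that show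
        ?thesis by blast
  qed
  then show ?thesis using zero_everywhere by blast
qed

end
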